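(* Any linearly recurrent Arnoux-Rauzy word $\omega$ (over three letters) with recurrent directive sequence generates a symbolic dynamical system $(X_\omega,\Sigma)$ that has pure discrete spectrum.
   Context: $\mathcal{A}=\{1,2,3\}$, $\mathbb{N}=\{0,1,2,\ldots\}$. The Arnoux-Rauzy substitutions are $\alpha_i:i\mapsto i,\ j\mapsto ji$ for $j\in\mathcal{A}\setminus\{i\}$ ($i\in\mathcal{A}$). An Arnoux-Rauzy word with directive sequence $\boldsymbol{\sigma}=(\sigma_n)_{n\in\mathbb{N}}\in\{\alpha_1,\alpha_2,\alpha_3\}^{\mathbb{N}}$, where each $\alpha_i$ occurs infinitely often in $\boldsymbol{\sigma}$, is a limit word of $\boldsymbol{\sigma}$, i.e. an infinite word $\omega=\omega^{(0)}\in\mathcal{A}^{\mathbb{N}}$ for which there are infinite words $\omega^{(n)}$ with $\omega^{(n)}=\sigma_n(\omega^{(n+1)})$ for all $n\in\mathbb{N}$. The directive sequence is recurrent if each finite block of consecutive terms occurs infinitely often in it. An infinite word is uniformly recurrent if each factor occurs infinitely often with bounded gaps; its recurrence function $R(n)$ is the smallest $k$ such that every factor of length $k$ contains every factor of length $n$; it is linearly recurrent if there is a constant $C$ with $R(n)\le Cn$ for all $n$. $\Sigma$ is the shift, $X_\omega$ is the closure of $\{\Sigma^n(\omega):n\in\mathbb{N}\}$ in $\mathcal{A}^{\mathbb{N}}$ (product topology). Pure discrete spectrum: $L^2(X_\omega,\mu)$ is spanned by measurable eigenfunctions, where $\mu$ is the unique shift invariant probability measure on $X_\omega$. *)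

theory Defs
  imports "HOL-Probability.Probability" "HOL-Library.Sublist"
begin

section \<open>Letters and infinite words\<close>

datatype letter = One | Two | Three

instantiation letter :: discrete_topology
begin
definition open_letter :: "letter set \<Rightarrow> bool" where "open_letter A \<longleftrightarrow> True"
instance by standard (auto simp: open_letter_def)
end

type_synonym word = "nat \<Rightarrow> letter"

definition shift :: "word \<Rightarrow> word" where
  "shift w = (\<lambda>n. w (Suc n))"

text \<open>The topology on \<^typ>\<open>word\<close> is the library's product topology on functions.\<close>

definition orbit_closure :: "word \<Rightarrow> word set" where
  "orbit_closure w = closure (range (\<lambda>n. (shift ^^ n) w))"

definition factors :: "word \<Rightarrow> nat \<Rightarrow> letter list set" where
  "factors w n = range (\<lambda>i. map w [i..<i + n])"

section \<open>Substitutions and Arnoux-Rauzy words\<close>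

type_synonym substitution = "letter \<Rightarrow> letter list"

text \<open>Letter \<open>n\<close> of the infinite concatenation \<open>s (w 0) s (w 1) s (w 2) \<dots>\<close>. It is read off from
  the image of the first \<open>n + 1\<close> letters of \<open>w\<close>, which is long enough if \<open>s\<close> is non-erasing.\<close>

definition subst_word :: "substitution \<Rightarrow> word \<Rightarrow> word" where
  "subst_word s w = (\<lambda>n. concat (map (\<lambda>k. s (w k)) [0..<Suc n]) ! n)"

lemma length_concat_nonerasing:
  fixes s :: substitution and w :: word
  assumes "\<And>a. s a \<noteq> []"
  shows "n \<le> length (concat (map (\<lambda>k. s (w k)) [0..<n]))"
proof (induction n)
  case (Suc n)
  have "length (s (w n)) \<ge> 1" using assms[of "w n"] by (cases "s (w n)") auto
  then show ?case using Suc by simp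
qed simp

lemma concat_upt_prefix:
  fixes s :: substitution and w :: word
  assumes "m \<le> n"
  shows "prefix (concat (map (\<lambda>k. s (w k)) [0..<m])) (concat (map (\<lambda>k. s (w k)) [0..<n]))"
  using assms by (induction rule: dec_induct) (auto intro: prefix_order.trans)

lemma subst_word_prefix:
  fixes s :: substitution and w :: word
  assumes "\<And>a. s a \<noteq> []"
  shows "map (subst_word s w) [0..<length (concat (map (\<lambda>k. s (w k)) [0..<n]))] =
    concat (map (\<lambda>k. s (w k)) [0..<n])"
proof (rule nth_equalityI)
  let ?c = "\<lambda>n. concat (map (\<lambda>k. s (w k)) [0..<n])"
  fix i assume "i < length (map (subst_word s w) [0..<length (?c n)])"
  then have i: "i < length (?c n)" by simp
  have j: "i < length (?c (Suc i))"
    using length_concat_nonerasing[of s "Suc i" w] assms by simp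
  have "?c (Suc i) ! i = ?c n ! i"
  proof (cases "Suc i \<le> n")
    case True
    show ?thesis using concat_upt_prefix[OF True, of s w] j by (metis nth_append prefixE)
  next
    case False
    then have le: "n \<le> Suc i" by simp
    show ?thesis using concat_upt_prefix[OF le, of s w] i by (metis nth_append prefixE)
  qed
  then show "map (subst_word s w) [0..<length (?c n)] ! i = ?c n ! i"
    using i by (simp only: nth_map length_upt minus_nat.diff_0 nth_upt add_0 subst_word_def)
qed simp

definition AR_subst :: "letter \<Rightarrow> substitution" where
  "AR_subst i = (\<lambda>j. if j = i then [i] else [j, i])"

definition limit_word :: "(nat \<Rightarrow> substitution) \<Rightarrow> word \<Rightarrow> bool" where
  "limit_word \<sigma> w \<longleftrightarrow>
    (\<exists>W :: nat \<Rightarrow> word. W 0 = w \<and> (\<forall>n. W n = subst_word (\<sigma> n) (W (Suc n))))"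

definition arnoux_rauzy_word :: "(nat \<Rightarrow> substitution) \<Rightarrow> word \<Rightarrow> bool" where
  "arnoux_rauzy_word \<sigma> w \<longleftrightarrow>
    (\<forall>n. \<sigma> n \<in> range AR_subst) \<and>
    (\<forall>i. infinite {n. \<sigma> n = AR_subst i}) \<and>
    limit_word \<sigma> w"

definition recurrent_directive :: "(nat \<Rightarrow> substitution) \<Rightarrow> bool" where
  "recurrent_directive \<sigma> \<longleftrightarrow>
    (\<forall>m l. infinite {n. \<forall>k<l. \<sigma> (n + k) = \<sigma> (m + k)})"

section \<open>Linear recurrence\<close>

definition uniformly_recurrent :: "word \<Rightarrow> bool" where
  "uniformly_recurrent w \<longleftrightarrow>
    (\<forall>n. \<forall>u\<in>factors w n. \<exists>g. \<forall>m. \<exists>i\<in>{m..m + g}. map w [i..<i + n] = u)"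

text \<open>Only meaningful for uniformly recurrent words: otherwise there may be no such \<open>k\<close>.\<close>

definition recurrence_function :: "word \<Rightarrow> nat \<Rightarrow> nat" where
  "recurrence_function w n =
    (LEAST k. \<forall>v\<in>factors w k. \<forall>u\<in>factors w n. sublist u v)"

definition linearly_recurrent :: "word \<Rightarrow> bool" where
  "linearly_recurrent w \<longleftrightarrow>
    uniformly_recurrent w \<and>
    (\<exists>C::real. \<forall>n. real (recurrence_function w n) \<le> C * real n)"

section \<open>Pure discrete spectrum\<close>

definition shift_invariant_prob :: "word set \<Rightarrow> word measure \<Rightarrow> bool" where
  "shift_invariant_prob X \<mu> \<longleftrightarrow>
    sets \<mu> = sets (restrict_space borel X) \<and>
    prob_space \<mu> \<and>
    shift \<in> measurable \<mu> \<mu> \<and>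
    distr \<mu> \<mu> shift = \<mu>"

text \<open>Elements of \<open>L\<^sup>2\<close> are represented by functions rather than by classes modulo null sets.\<close>

definition square_integrable :: "word measure \<Rightarrow> (word \<Rightarrow> complex) \<Rightarrow> bool" where
  "square_integrable \<mu> f \<longleftrightarrow>
    f \<in> borel_measurable \<mu> \<and> integrable \<mu> (\<lambda>x. (cmod (f x))\<^sup>2)"

definition eigenfunction :: "word measure \<Rightarrow> (word \<Rightarrow> complex) \<Rightarrow> bool" where
  "eigenfunction \<mu> f \<longleftrightarrow>
    square_integrable \<mu> f \<and>
    \<not> (AE x in \<mu>. f x = 0) \<and>
    (\<exists>c::complex. AE x in \<mu>. f (shift x) = c * f x)"

text \<open>Spanned in the Hilbert space sense: finite linear combinations of eigenfunctions are dense
  with respect to the \<open>L\<^sup>2\<close> norm.\<close>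

definition spanned_by_eigenfunctions :: "word measure \<Rightarrow> bool" where
  "spanned_by_eigenfunctions \<mu> \<longleftrightarrow>
    (\<forall>f. square_integrable \<mu> f \<longrightarrow>
      (\<forall>\<epsilon>>0. \<exists>E (a :: (word \<Rightarrow> complex) \<Rightarrow> complex).
        finite E \<and> (\<forall>e\<in>E. eigenfunction \<mu> e) \<and>
        sqrt (\<integral>x. (cmod (f x - (\<Sum>e\<in>E. a e * e x)))\<^sup>2 \<partial>\<mu>) < \<epsilon>))"

text \<open>Pure discrete spectrum of a shift space refers to its unique shift invariant Borel probability
  measure, whose existence and uniqueness are part of the assertion.\<close>

definition pure_discrete_spectrum :: "word set \<Rightarrow> bool" where
  "pure_discrete_spectrum X \<longleftrightarrow>
    (\<exists>\<mu>. (\<forall>\<nu>. shift_invariant_prob X \<nu> \<longleftrightarrow> \<nu> = \<mu>) \<and> spanned_by_eigenfunctions \<mu>)"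

end

theory Submission
  imports Defs
begin

text \<open>Linear recurrence bounds the gaps between equal letters in the directive sequence. Hence the vectors
  of deviations of letter counts from their frequencies contract exponentially along the directive
  sequence: the words of all levels are uniformly balanced, and the letter frequencies give
  continuous eigenfunctions. Suppose two positions have nearly the same phase for these eigenfunctions.
  Align the two block decompositions at some level there. By balance, the offset between a boundary of the
  one and the surrounding block of the other is one of finitely many integer vectors. Every image under
  an Arnoux-Rauzy substitution of a letter \<open>j\<close> starts with \<open>j\<close> and ends with a letter that does not depend
  on \<open>j\<close>. From the first property it follows that the offset vanishes after boundedly many
  subdivisions of the blocks, and from the second that the two decompositions then share the block to the left of
  the common boundary. So the letter at most positions is a function of the phase; Urysohn's lemma and the
  Stone-Weierstrass theorem approximate clopen sets by trigonometric polynomials in the eigenfunctions.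
  This gives uniform frequencies of all factors, thus the unique invariant measure, and density of the
  span of the eigenfunctions.\<close>

text \<open>Positions that are close in phase need not be close in the word, so the letter counts
  between \<open>t\<close> and \<open>t'\<close> are not at hand. Their place is taken by the
  integers nearest to \<open>(t' - t) * freq c a\<close>: a vector \<open>d\<close> of sum
  \<open>t' - t\<close>. The incidence matrices are unimodular, so \<open>d\<close> can be carried
  to every level \<open>n\<close> as an integer vector. The inverse matrices enlarge its deviation
  from the frequency line by a factor of at most 3 per level, which a tolerance of order
  \<open>3 ^ (-n)\<close> absorbs. Thus offsets make sense on all levels although \<open>d\<close>
  need not count anything.

  Of the geometry only two inequalities survive: measured by the block lengths, the offset stays
  within one block. Contraction alone would not carry an integer vector to 0; a descending integer
  potential does, and it descends because every letter is used in each window of fixed length. All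
  constants of the collapse depend on the gap bound \<open>L\<close> only, so the same number of
  levels is lost at every height, and each stage settles a fixed proportion of the positions left
  over.\<close>

lemma all_letter: "(\<forall>x. P x) \<longleftrightarrow> P One \<and> P Two \<and> P Three"
  by (metis letter.exhaust)

lemma ex_letter: "(\<exists>x. P x) \<longleftrightarrow> P One \<or> P Two \<or> P Three"
  by (metis letter.exhaust)

lemma UNIV_letter: "(UNIV :: letter set) = {One, Two, Three}"
  using letter.exhaust by blast

instance letter :: finite
  by standard (simp add: UNIV_letter)

lemma two_other_letters:
  obtains k l :: letter where "c \<noteq> k" "c \<noteq> l" "k \<noteq> l" "\<And>x. x = c \<or> x = k \<or> x = l"
proof (cases c)
  case One then show ?thesis by (intro that[of Two Three]) (use letter.exhaust in blast)+
next
  case Two then show ?thesis by (intro that[of One Three]) (use letter.exhaust in blast)+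
next
  case Three then show ?thesis by (intro that[of One Two]) (use letter.exhaust in blast)+
qed

lemma letter_exhaust3:
  "c \<noteq> k \<Longrightarrow> c \<noteq> l \<Longrightarrow> k \<noteq> l \<Longrightarrow> x = c \<or> x = k \<or> x = (l :: letter)"
  by (cases c; cases k; cases l; cases x) auto

lemma third_letter:
  assumes "c \<noteq> k"
  obtains l :: letter where "c \<noteq> l" "k \<noteq> l" "\<And>x. x = c \<or> x = k \<or> x = l"
  by (rule two_other_letters[of c]) (use assms that in metis)

lemma first_use:
  assumes "\<exists>m\<in>{t..<t + L::nat}. c m = a"
  shows "\<exists>m. t \<le> m \<and> m < t + L \<and> c m = a \<and> (\<forall>x. t \<le> x \<and> x < m \<longrightarrow> c x \<noteq> a)"
proof -
  have "\<exists>m. t \<le> m \<and> m < t + L \<and> c m = a" using assms by auto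
  then obtain m where "t \<le> m \<and> m < t + L \<and> c m = a"
    "\<forall>x<m. \<not> (t \<le> x \<and> x < t + L \<and> c x = a)"
    using exists_least_iff[of "\<lambda>m. t \<le> m \<and> m < t + L \<and> c m = a"] by blast
  then show ?thesis by (intro exI[of _ m]) auto
qed

definition vsum :: "(letter \<Rightarrow> 'a::comm_ring_1) \<Rightarrow> 'a" where
  "vsum y = y One + y Two + y Three"

definition dot :: "(letter \<Rightarrow> 'a::comm_ring_1) \<Rightarrow> (letter \<Rightarrow> 'a) \<Rightarrow> 'a" where
  "dot u y = u One * y One + u Two * y Two + u Three * y Three"

lemma vsum_distinct:
  assumes "c \<noteq> k" "c \<noteq> l" "k \<noteq> l"
  shows "vsum y = y c + y k + y l"
  using assms by (cases c; cases k; cases l) (auto simp: vsum_def algebra_simps)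

lemma dot_nonneg: "(\<And>b. 0 \<le> u b) \<Longrightarrow> (\<And>b. 0 \<le> y b) \<Longrightarrow> 0 \<le> dot u (y :: letter \<Rightarrow> 'a::linordered_idom)"
  unfolding dot_def by (intro add_nonneg_nonneg mult_nonneg_nonneg) auto

section \<open>Collapse of lattice offsets\<close>

text \<open>Going down the levels, \<open>t\<close> counts the substitutions applied so far, \<open>c t\<close> is the letter of
  the next one and \<open>h t\<close> are the block lengths. \<open>q t\<close> is the offset, as an integer vector, from the
  right end of a block of type \<open>j t\<close> in one block decomposition to a fixed boundary of another one that
  lies inside this block or at its left end. The first case of \<open>move\<close> is that the boundary ends up in
  the block \<open>j t\<close> of the image \<open>(j t) (c t)\<close>. The offset from the left end is \<open>q t\<close> with \<open>1\<close> added
  at \<open>j t\<close>, and it vanishes eventually.\<close>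

locale collapse =
  fixes q :: "nat \<Rightarrow> letter \<Rightarrow> int" and j c :: "nat \<Rightarrow> letter" and h :: "nat \<Rightarrow> letter \<Rightarrow> int"
    and T L :: nat
  assumes pos: "t \<le> T \<Longrightarrow> 0 < h t b"
    and neg: "t \<le> T \<Longrightarrow> dot (h t) (q t) < 0"
    and nonneg: "t \<le> T \<Longrightarrow> 0 \<le> dot (h t) (q t) + h t (j t)"
    and move: "t < T \<Longrightarrow>
      q (Suc t) = (q t)(c t := vsum (q t) + 1) \<and> j (Suc t) = j t \<and> j t \<noteq> c t \<or>
      q (Suc t) = (q t)(c t := vsum (q t)) \<and> j (Suc t) = c t"
    and gap: "t + L \<le> T \<Longrightarrow> \<exists>m\<in>{t..<t + L}. c m = a"
begin

lemma ex_negative: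
  assumes "t \<le> T" obtains b where "q t b < 0"
  using dot_nonneg[of "h t" "q t"] neg[OF assms] pos[OF assms] by (meson less_imp_le not_less)

text \<open>A negative value of \<open>q\<close> that is compensated by both other values stays so until its letter is
  used, and then \<open>q\<close> becomes nonnegative, which is excluded by \<open>neg\<close>.\<close>

lemma no_compensation:
  assumes "t + L \<le> T" "q t a < 0"
  shows "\<exists>k. k \<noteq> a \<and> q t k + q t a < 0"
proof (rule ccontr)
  assume "\<not> ?thesis"
  then have J: "\<And>k. k \<noteq> a \<Longrightarrow> 0 \<le> q t k + q t a" by force
  obtain k l where kl: "a \<noteq> k" "a \<noteq> l" "k \<noteq> l" and ex: "\<And>x. x = a \<or> x = k \<or> x = l"
    using two_other_letters by blast
  obtain m where m: "t \<le> m" "c m = a" and mT: "m < t + L"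
    and least: "\<forall>x. t \<le> x \<and> x < m \<longrightarrow> c x \<noteq> a"
    using first_use[OF gap[OF assms(1), of a]] by blast
  \<comment> \<open>If \<open>k\<close> is used, its new value plus \<open>q x a\<close> is at least
    the sum of the two old compensations; likewise for \<open>l\<close>.\<close>
  have inv: "q x a < 0 \<and> 0 \<le> q x k + q x a \<and> 0 \<le> q x l + q x a" if "t \<le> x" "x \<le> m" for x
    using that
  proof (induction x rule: dec_induct)
    case base then show ?case using assms(2) J kl by auto
  next
    case (step x)
    then have IH: "q x a < 0" "0 \<le> q x k + q x a" "0 \<le> q x l + q x a" by auto
    have c: "c x = k \<or> c x = l" using least step ex[of "c x"] by auto
    have "x < T" using step mT assms by auto
    from move[OF this] have "q (Suc x) = (q x)(c x := vsum (q x) + 1) \<or> q (Suc x) = (q x)(c x := vsum (q x))"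
      by blast
    then show ?case using c IH kl vsum_distinct[OF kl, of "q x"] by auto
  qed
  have "m < T" using mT assms by auto
  have p: "vsum (q m) > 0" "q m k > 0" "q m l > 0"
    using inv[of m] m vsum_distinct[OF kl, of "q m"] by auto
  have "0 \<le> q (Suc m) b" for b
    using ex[of b] move[OF \<open>m < T\<close>] m kl p by auto
  then have "0 \<le> dot (h (Suc m)) (q (Suc m))" using pos[of "Suc m"] \<open>m < T\<close>
    by (intro dot_nonneg) (auto simp: less_imp_le Suc_leI)
  then show False using neg[of "Suc m"] \<open>m < T\<close> by auto
qed

section \<open>The potential of an offset and its descent\<close>

definition mx :: "nat \<Rightarrow> int" where "mx t = Max (range (q t))"
definition peak :: "nat \<Rightarrow> letter set" where "peak t = {b. q t b = mx t}"

lemma le_mx: "q t b \<le> mx t" unfolding mx_def by (intro Max_ge) auto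

lemma mx_attained: obtains b where "q t b = mx t"
proof -
  have "mx t \<in> range (q t)" unfolding mx_def by (rule Max_in) auto
  then show ?thesis using that by force
qed

lemma peak_nonempty: "peak t \<noteq> {}"
  using mx_attained[of t] unfolding peak_def by auto

text \<open>By \<open>no_compensation\<close> the sum of \<open>q t\<close> is smaller than its maximum, so the maximum cannot grow, and
  it is attained at the letter just used only if nothing has changed.\<close>

lemma step_peak:
  assumes "Suc t + L \<le> T"
  shows "q (Suc t) (c t) < mx t \<or>
    q (Suc t) = q t \<and> j (Suc t) = j t \<and> j t \<noteq> c t \<and> q t (c t) = mx t \<and>
    (\<exists>a k. a \<noteq> c t \<and> k \<noteq> c t \<and> a \<noteq> k \<and> q t a < 0 \<and> q t k + q t a = -1)"
proof (cases "q (Suc t) (c t) < mx t")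
  case False
  have tT: "t < T" "t \<le> T" "Suc t \<le> T" "t + L \<le> T" using assms by auto
  obtain a where a: "q t a < 0" using ex_negative[OF tT(2)] .
  then obtain k where k: "k \<noteq> a" "q t k + q t a < 0" using no_compensation[OF tT(4)] by blast
  obtain l where l: "a \<noteq> l" "k \<noteq> l" "\<And>x. x = a \<or> x = k \<or> x = l" using third_letter[OF k(1)[symmetric]] by blast
  have s: "vsum (q t) = q t a + q t k + q t l" using vsum_distinct k l by metis
  have s2: "q (Suc t) = (q t)(c t := vsum (q t) + 1) \<and> j (Suc t) = j t \<and> j t \<noteq> c t"
    and mxl: "q t l = mx t" and mk: "q t k + q t a = -1"
    using move[OF tT(1)] False s k le_mx[of t l] by fastforce+
  have new: "q (Suc t) (c t) = mx t" using s2 s mxl mk by auto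
  have k0: "0 \<le> q t k" using mk a by auto
  have l0: "0 \<le> q t l" using le_mx[of t k] k0 mxl by auto
  have ca: "c t \<noteq> a"
  proof
    assume "c t = a"
    then have "0 \<le> q (Suc t) b" for b using l(3)[of b] s2 l(1,2) k(1) k0 l0 new mxl by auto
    then have "0 \<le> dot (h (Suc t)) (q (Suc t))" using pos[OF tT(3)]
      by (intro dot_nonneg) (auto simp: less_imp_le)
    then show False using neg[OF tT(3)] by auto
  qed
  show ?thesis
  proof (cases "c t = l")
    case True
    have "q (Suc t) = q t" using s2 new mxl True by (metis fun_upd_same fun_upd_triv)
    moreover have "a \<noteq> c t" "k \<noteq> c t" using True l by auto
    ultimately show ?thesis using s2 mxl True a k mk by blast
  next
    case False
    then have ck: "c t = k" using ca l by metis
    have "q (Suc t) a < 0" using s2 ck k a by auto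
    then obtain k' where k': "k' \<noteq> a" "q (Suc t) k' + q (Suc t) a < 0"
      using no_compensation[OF assms] by blast
    \<comment> \<open>Both values other than that of \<open>a\<close> now equal \<open>mx t\<close>,
      so either choice of \<open>k'\<close> gives this; as \<open>q t k = -1 - q t a\<close>, the
      old value of \<open>k\<close> was already maximal.\<close>
    then have "mx t + q t a < 0" using l(3)[of k'] s2 ck l(1,2) k(1) new mxl by auto
    then have qk: "q t k = mx t" using mk le_mx[of t k] by auto
    have "q (Suc t) = q t" using s2 new qk ck by (metis fun_upd_same fun_upd_triv)
    moreover have "a \<noteq> c t" "l \<noteq> c t" "a \<noteq> l" "q t l + q t a = -1" using ck l k mk qk mxl by auto
    ultimately show ?thesis using s2 ck qk a by blast
  qed
qed blast

lemma mx_mono1: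
  assumes "Suc t + L \<le> T"
  shows "mx (Suc t) \<le> mx t \<and> (mx (Suc t) = mx t \<longrightarrow> peak (Suc t) \<subseteq> peak t)"
proof -
  have "t < T" using assms by auto
  have o: "q (Suc t) b = q t b" if "b \<noteq> c t" for b using move[OF \<open>t < T\<close>] that by auto
  consider "q (Suc t) (c t) < mx t" | "q (Suc t) = q t" using step_peak[OF assms] by auto
  then show ?thesis
  proof cases
    case 1
    then have le: "\<And>b. q (Suc t) b \<le> mx t" using o le_mx[of t] by (metis less_imp_le)
    have "mx (Suc t) \<le> mx t" using le mx_attained[of "Suc t"] by metis
    moreover have "peak (Suc t) \<subseteq> peak t" if "mx (Suc t) = mx t"
      using that 1 o unfolding peak_def by (smt (verit, best) Collect_mono)
    ultimately show ?thesis by blast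
  next
    case 2
    then show ?thesis by (simp add: mx_def peak_def)
  qed
qed

text \<open>Encodes the lexicographic order on the maximum and the number of letters attaining it;
  the factor 3 suffices because that number lies between 1 and 3.\<close>

definition pot :: "nat \<Rightarrow> int" where "pot t = 3 * mx t + int (card (peak t))"

lemma card_peak: "1 \<le> card (peak t)" "card (peak t) \<le> 3"
proof -
  show "1 \<le> card (peak t)" using peak_nonempty[of t] by (simp add: Suc_leI card_gt_0_iff)
  have "card (UNIV :: letter set) = 3" by (simp add: UNIV_letter)
  then show "card (peak t) \<le> 3" by (metis card_mono finite subset_UNIV)
qed

lemma pot_mono1:
  assumes "Suc t + L \<le> T"
  shows "pot (Suc t) \<le> pot t" "pot (Suc t) = pot t \<Longrightarrow> mx (Suc t) = mx t \<and> peak (Suc t) = peak t"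
proof -
  have c: "card (peak (Suc t)) \<le> card (peak t)" if "mx (Suc t) = mx t"
    using mx_mono1[OF assms] that by (simp add: card_mono)
  show "pot (Suc t) \<le> pot t"
    using mx_mono1[OF assms] c card_peak(1)[of t] card_peak(2)[of "Suc t"] unfolding pot_def
    by (cases "mx (Suc t) = mx t") linarith+
  assume e: "pot (Suc t) = pot t"
  then have "mx (Suc t) = mx t"
    using mx_mono1[OF assms] card_peak(1)[of t] card_peak(2)[of "Suc t"] unfolding pot_def
    by linarith
  moreover then have "card (peak (Suc t)) = card (peak t)" using e unfolding pot_def by auto
  ultimately show "mx (Suc t) = mx t \<and> peak (Suc t) = peak t"
    using mx_mono1[OF assms] by (simp add: card_subset_eq)
qed

lemma pot_mono:
  assumes "t \<le> t'" "t' + L \<le> T"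
  shows "pot t' \<le> pot t"
  using assms by (induction rule: dec_induct) (use pot_mono1 in fastforce)+

text \<open>The boundary is the left end of the block \<open>j t\<close>: the offset from the right
  end is minus one letter.\<close>

definition settled :: "nat \<Rightarrow> bool" where
  "settled t \<longleftrightarrow> q t = (\<lambda>b. if b = j t then -1 else 0)"

text \<open>An image starts with the letter itself, so the left end of a block is the left end of
  its first part. The other move would place the boundary to the left of the new block, against
  \<open>nonneg\<close>.\<close>

lemma settled_step:
  assumes "settled t" "t < T"
  shows "settled (Suc t)"
proof (cases "j t = c t")
  case True
  then have "vsum (q t) = -1" using assms(1) unfolding settled_def
    by (cases "j t") (auto simp: vsum_def)
  then show ?thesis using True assms(1) move[OF assms(2)] unfolding settled_def by auto
next
  case False
  have s: "vsum (q t) = -1" using assms(1) unfolding settled_def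
    by (cases "j t") (auto simp: vsum_def)
  show ?thesis
    using move[OF assms(2)]
  proof
    assume "q (Suc t) = (q t)(c t := vsum (q t) + 1) \<and> j (Suc t) = j t \<and> j t \<noteq> c t"
    then show ?thesis using s assms(1) unfolding settled_def by auto
  next
    assume a: "q (Suc t) = (q t)(c t := vsum (q t)) \<and> j (Suc t) = c t"
    then have "q (Suc t) = (\<lambda>b. if b = j t \<or> b = c t then -1 else 0)"
      using s assms(1) unfolding settled_def by auto
    then have "dot (h (Suc t)) (q (Suc t)) = - h (Suc t) (j t) - h (Suc t) (c t)"
      using False by (cases "j t"; cases "c t") (auto simp: dot_def)
    then show ?thesis using a nonneg[of "Suc t"] pos[of "Suc t" "j t"] assms(2) by auto
  qed
qed

lemma settled_mono:
  assumes "t \<le> t'" "settled t" "t' \<le> T"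
  shows "settled t'"
  using assms by (induction rule: dec_induct) (auto intro: settled_step)

text \<open>Bounds the potential from below: if all values were negative, the boundary would lie to
  the left of the block, at least the sum of all three lengths away from its right end.\<close>

lemma mx_nonneg:
  assumes "t \<le> T" "\<not> settled t"
  shows "0 \<le> mx t"
proof (rule ccontr)
  assume "\<not> 0 \<le> mx t"
  then have n: "q t b \<le> -1" for b using le_mx[of t b] by auto
  have p: "0 < h t b" for b using pos[OF assms(1)] .
  have m: "h t b * q t b \<le> - h t b" for b
    using mult_left_mono[OF n, of "h t b" b] p[of b] by auto
  have "dot (h t) (q t) \<le> - h t One - h t Two - h t Three" unfolding dot_def
    using m[of One] m[of Two] m[of Three] by linarith
  then have "dot (h t) (q t) + h t (j t) < 0"
    using p[of One] p[of Two] p[of Three] by (cases "j t") auto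
  then show False using nonneg[OF assms(1)] by auto
qed

text \<open>Suppose that the potential stalls. Within \<open>L\<close> steps a letter of maximal
  value is used, and \<open>step_peak\<close> shows that the offset does not change there and has
  sum \<open>mx t - 1\<close>. It stays the same until, within \<open>L\<close> further steps, the
  negative letter \<open>a\<close> is used and receives the value \<open>mx t - 1\<close> or
  \<open>mx t\<close>. By \<open>neg\<close> this value is negative, so \<open>mx t = 0\<close>, and
  the offset is settled.\<close>

lemma progress:
  assumes T: "t + 3 * L \<le> T" and nd: "\<not> settled (t + 2 * L)"
  shows "pot (t + 2 * L) < pot t"
proof (rule ccontr)
  assume "\<not> ?thesis"
  note neg = this
  have ge: "pot x = pot t" if "t \<le> x" "x \<le> t + 2 * L" for x
    using pot_mono[of t x] pot_mono[of x "t + 2 * L"] that T neg by auto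
  have const: "mx x = mx t \<and> peak x = peak t" if "t \<le> x" "x \<le> t + 2 * L" for x
    using that
  proof (induction x rule: dec_induct)
    case (step x)
    then show ?case using pot_mono1(2)[of x] ge[of x] ge[of "Suc x"] T by auto
  qed auto
  obtain l where l: "l \<in> peak t" using peak_nonempty by blast
  obtain x where x: "t \<le> x" "x < t + L" "c x = l" using gap[of t l] T by auto
  have "q (Suc x) l = mx x" using const[of x] const[of "Suc x"] l x unfolding peak_def by auto
  then obtain a k where ak: "q (Suc x) = q x" "j (Suc x) = j x" "j x \<noteq> l" "q x l = mx t"
      "a \<noteq> l" "k \<noteq> l" "a \<noteq> k" "q x a < 0" "q x k + q x a = -1"
    using step_peak[of x] T x const[of x] by auto
  have ex: "y = a \<or> y = k \<or> y = l" for y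
    using ak(5-7) letter_exhaust3 by metis
  have s: "vsum (q x) = mx t - 1" using vsum_distinct[of a k l "q x"] ak by auto
  have "x + L \<le> T" using T x by simp
  then obtain m where m: "x \<le> m" "c m = a" and mT: "m < x + L"
    and least: "\<forall>y. x \<le> y \<and> y < m \<longrightarrow> c y \<noteq> a"
    using first_use[OF gap[of x a]] by blast
  have inv: "q y = q x \<and> j y \<noteq> l" if "x \<le> y" "y \<le> m" for y
    using that
  proof (induction y rule: dec_induct)
    case base then show ?case using ak by auto
  next
    case (step y)
    have yT: "y < T" "Suc y + L \<le> T" "t \<le> y" "Suc y \<le> t + 2 * L" using step mT x T by auto
    have cy: "c y = k \<or> c y = l" using least step ex[of "c y"] by auto
    have IH: "q y = q x" "j y \<noteq> l" using step by auto
    have mxy: "mx y = mx t" "mx (Suc y) = mx t" "peak y = peak t" "peak (Suc y) = peak t"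
      using const[of y] const[of "Suc y"] yT by auto
    show ?case
    proof (cases "c y \<in> peak t")
      case True
      then have "q (Suc y) (c y) = mx y" using mxy unfolding peak_def by auto
      then show ?thesis using step_peak[OF yT(2)] IH by auto
    next
      case False
      then have ck: "c y = k" using cy l by auto
      have "q (Suc y) k \<noteq> mx t" using False ck mxy unfolding peak_def by auto
      then have st: "q (Suc y) = (q x)(k := mx t - 1)" "j (Suc y) = k"
        using move[OF yT(1)] ck IH s by auto
      have "q (Suc y) a < 0" using st ak by auto
      then obtain k' where k': "k' \<noteq> a" "q (Suc y) k' + q (Suc y) a < 0"
        using no_compensation yT by blast
      \<comment> \<open>Using \<open>k\<close> gives it the value \<open>mx t - 1\<close>. That
        \<open>a\<close> must remain uncompensated shows that \<open>k\<close> had this value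
        before, so again nothing changes.\<close>
      have "mx t - 1 + q x a < 0" using k' st ak ex[of k'] by (auto split: if_splits)
      then have "q x k \<ge> mx t - 1" using ak by auto
      moreover have "q x k \<noteq> mx t" using False ck mxy IH unfolding peak_def by auto
      moreover have "q x k \<le> mx t" using le_mx[of x k] const[of x] x by auto
      ultimately have "q x k = mx t - 1" by auto
      then show ?thesis using st ak by auto
    qed
  qed
  have mm: "m < T" "Suc m \<le> T" using mT x T by auto
  have k0: "0 \<le> q x k" using ak by auto
  then have mx0: "0 \<le> mx t" using le_mx[of x k] const[of x] x by auto
  have st: "q (Suc m) = (q x)(a := mx t) \<or> q (Suc m) = (q x)(a := mx t - 1) \<and> j (Suc m) = a"
    using move[OF mm(1)] inv[of m] m s by auto
  have nn: "\<not> 0 \<le> q (Suc m) a"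
  proof
    assume "0 \<le> q (Suc m) a"
    then have "0 \<le> q (Suc m) b" for b using st k0 mx0 ak(4-7) ex[of b] by auto
    then have "0 \<le> dot (h (Suc m)) (q (Suc m))" using pos[OF mm(2)]
      by (intro dot_nonneg) (auto simp: less_imp_le)
    then show False using collapse.neg[OF collapse_axioms mm(2)] by auto
  qed
  then have "mx t = 0" "q (Suc m) = (q x)(a := -1)" "j (Suc m) = a" using st mx0 by auto
  moreover have "q x k = 0" using k0 le_mx[of x k] const[of x] x \<open>mx t = 0\<close> by auto
  ultimately have "settled (Suc m)" unfolding settled_def using ak ex by (auto simp: fun_eq_iff)
  then show False using settled_mono[of "Suc m" "t + 2 * L"] nd mT x T by auto
qed

text \<open>The potential starts at \<open>3 * Q + 3\<close> at most, is nonnegative before settling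
  and drops every \<open>2 * L\<close> steps, so \<open>3 * Q + 4\<close> rounds exhaust it. The
  additional \<open>L\<close> steps leave room for the last application of
  \<open>progress\<close>.\<close>

lemma collapse:
  assumes q0: "\<And>b. q 0 b \<le> int Q" and T: "2 * L * (3 * Q + 4) + L \<le> T"
  shows "settled T"
proof (rule ccontr)
  assume "\<not> settled T"
  then have nd: "\<not> settled t" if "t \<le> T" for t using settled_mono[of t T] that by auto
  have "pot (2 * L * r) \<le> pot 0 - int r" if "r \<le> 3 * Q + 4" for r
    using that
  proof (induction r)
    case (Suc r)
    have "2 * L * Suc r \<le> 2 * L * (3 * Q + 4)" using Suc by (intro mult_left_mono) auto
    then have le: "2 * L * r + 3 * L \<le> T" using T by (auto simp: algebra_simps)
    then have "pot (2 * L * r + 2 * L) < pot (2 * L * r)"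
      using progress nd by auto
    then show ?case using Suc by (simp add: algebra_simps)
  qed simp
  from this[of "3 * Q + 4"] have "pot (2 * L * (3 * Q + 4)) \<le> pot 0 - int (3 * Q + 4)" by auto
  moreover have "mx 0 \<le> int Q" using q0 mx_attained by metis
  then have "pot 0 \<le> int (3 * Q + 3)" using card_peak[of 0] unfolding pot_def by auto
  moreover have "0 \<le> mx (2 * L * (3 * Q + 4))" using mx_nonneg nd T by auto
  then have "0 \<le> pot (2 * L * (3 * Q + 4))" unfolding pot_def by auto
  ultimately show False by auto
qed

end

section \<open>Block decompositions\<close>

text \<open>Position in the substituted word at which the image of letter number \<open>k\<close>
  starts.\<close>

definition cut :: "letter \<Rightarrow> word \<Rightarrow> nat \<Rightarrow> nat" where
  "cut a w k = (\<Sum>l<k. if w l = a then 1 else 2)"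

lemma cut_0 [simp]: "cut a w 0 = 0"
  and cut_Suc: "cut a w (Suc k) = cut a w k + (if w k = a then 1 else 2)"
  by (auto simp: cut_def)

lemma length_concat_AR: "length (concat (map (\<lambda>k. AR_subst a (w k)) [0..<n])) = cut a w n"
  by (induction n) (auto simp: cut_Suc AR_subst_def)

lemma subst_word_AR:
  shows "subst_word (AR_subst a) w (cut a w k) = w k"
    and "w k \<noteq> a \<Longrightarrow> subst_word (AR_subst a) w (Suc (cut a w k)) = a"
proof -
  have ne: "AR_subst a b \<noteq> []" for b by (simp add: AR_subst_def)
  let ?s = "subst_word (AR_subst a) w" and ?c = "\<lambda>n. concat (map (\<lambda>k. AR_subst a (w k)) [0..<n])"
  have p: "map ?s [0..<cut a w (Suc k)] = ?c k @ AR_subst a (w k)"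
    using subst_word_prefix[of "AR_subst a" w "Suc k"] ne length_concat_AR[of a w "Suc k"] by simp
  have nth: "?s (cut a w k + x) = AR_subst a (w k) ! x" if "x < length (AR_subst a (w k))" for x
  proof -
    have "cut a w k + x < cut a w (Suc k)" using that by (auto simp: cut_Suc AR_subst_def split: if_splits)
    then have "?s (cut a w k + x) = (?c k @ AR_subst a (w k)) ! (cut a w k + x)"
      by (subst p[symmetric]) simp
    then show ?thesis using length_concat_AR[of a w k] by (simp add: nth_append)
  qed
  show "?s (cut a w k) = w k" using nth[of 0] by (auto simp: AR_subst_def split: if_splits)
  show "?s (Suc (cut a w k)) = a" if "w k \<noteq> a" using nth[of 1] that by (auto simp: AR_subst_def)
qed

lemma ex_cut:
  obtains k where "s = cut a w k" | k where "s = Suc (cut a w k)" "w k \<noteq> a"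
proof -
  have "\<exists>k. s = cut a w k \<or> (s = Suc (cut a w k) \<and> w k \<noteq> a)"
  proof (induction s)
    case 0 then show ?case by (auto intro: exI[of _ 0])
  next
    case (Suc s)
    then obtain k where "s = cut a w k \<or> (s = Suc (cut a w k) \<and> w k \<noteq> a)" by auto
    then have "Suc s = cut a w (Suc k) \<or> (Suc s = Suc (cut a w k) \<and> w k \<noteq> a)"
      by (auto simp: cut_Suc)
    then show ?case by blast
  qed
  then show ?thesis using that by blast
qed

text \<open>\<open>Mact a\<close> and \<open>up a\<close> are the actions of the incidence matrix of \<^term>\<open>AR_subst a\<close> on column
  vectors and on row vectors.\<close>

definition Mact :: "letter \<Rightarrow> (letter \<Rightarrow> 'a::comm_ring_1) \<Rightarrow> letter \<Rightarrow> 'a" where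
  "Mact a y = y(a := vsum y)"

definition up :: "letter \<Rightarrow> (letter \<Rightarrow> 'a::comm_ring_1) \<Rightarrow> letter \<Rightarrow> 'a" where
  "up a u b = (if b = a then u b else u b + u a)"

lemma dot_up: "dot (up a u) y = dot u (Mact a y)"
  by (cases a) (simp_all add: dot_def up_def Mact_def vsum_def algebra_simps)

definition unit :: "letter \<Rightarrow> letter \<Rightarrow> 'a::comm_ring_1" where
  "unit a b = of_bool (b = a)"

lemma dot_unit [simp]: "dot u (unit a) = u a"
  by (cases a) (simp_all add: dot_def unit_def)

lemma dot_unit_left [simp]: "dot (unit a) u = u a"
  by (cases a) (simp_all add: dot_def unit_def)

lemma dot_add: "dot u (\<lambda>b. x b + y b) = dot u x + dot u y"
  and dot_diff: "dot u (\<lambda>b. x b - y b) = dot u x - dot u y"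
  and dot_scale: "dot u (\<lambda>b. r * x b) = r * dot u x"
  by (simp_all add: dot_def algebra_simps)

lemma dot_one: "dot (\<lambda>_. 1) y = vsum y"
  by (simp add: dot_def vsum_def)

lemma Mact_add: "Mact a (\<lambda>b. x b + y b) = (\<lambda>b. Mact a x b + Mact a y b)"
  and Mact_diff: "Mact a (\<lambda>b. x b - y b) = (\<lambda>b. Mact a x b - Mact a y b)"
  by (auto simp: Mact_def vsum_def)

lemma Mact_unit: "Mact a (unit b) = (if b = a then unit a else (\<lambda>x. unit b x + unit a x))"
  by (cases a; cases b) (auto simp: Mact_def vsum_def unit_def fun_eq_iff)

text \<open>Parikh vector of the prefix of length \<open>k\<close>, polymorphic so as to serve both
  the integer offsets and the real estimates.\<close>

definition cnt :: "word \<Rightarrow> nat \<Rightarrow> letter \<Rightarrow> 'a::comm_ring_1" where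
  "cnt w k b = (\<Sum>l<k. of_bool (w l = b))"

lemma cnt_0 [simp]: "cnt w 0 = (\<lambda>_. 0)"
  and cnt_Suc: "cnt w (Suc k) = (\<lambda>b. cnt w k b + unit (w k) b)"
  by (auto simp: cnt_def unit_def fun_eq_iff)

lemma vsum_unit [simp]: "vsum (unit a) = 1"
  by (cases a) (simp_all add: vsum_def unit_def)

lemma vsum_add: "vsum (\<lambda>b. x b + y b) = vsum x + vsum y"
  and vsum_diff: "vsum (\<lambda>b. x b - y b) = vsum x - vsum y"
  by (simp_all add: vsum_def algebra_simps)

lemma vsum_cnt: "vsum (cnt w k) = of_nat k"
  by (induction k) (simp_all add: cnt_Suc vsum_add, simp add: vsum_def)

lemma of_int_cnt: "of_int (cnt w k b) = cnt w k b"
  by (simp add: cnt_def)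

text \<open>The row vector \<open>u\<close> times a product of incidence matrices: its entry at
  \<open>b\<close> is the value of the functional \<open>u\<close> on the letter counts of a block
  of type \<open>b\<close> of level \<open>n\<close>. For \<open>u = 1\<close> these are the block
  lengths.\<close>

primrec row :: "(nat \<Rightarrow> letter) \<Rightarrow> (letter \<Rightarrow> 'a::comm_ring_1) \<Rightarrow> nat \<Rightarrow> letter \<Rightarrow> 'a" where
  "row c u 0 = u"
| "row c u (Suc n) = up (c n) (row c u n)"

abbreviation ht :: "(nat \<Rightarrow> letter) \<Rightarrow> nat \<Rightarrow> letter \<Rightarrow> int" where
  "ht c \<equiv> row c (\<lambda>_. 1)"

text \<open>Position in \<open>W 0\<close> of the left end of block number \<open>k\<close> of level
  \<open>n\<close>.\<close>

primrec vert :: "(nat \<Rightarrow> letter) \<Rightarrow> (nat \<Rightarrow> word) \<Rightarrow> nat \<Rightarrow> nat \<Rightarrow> nat" where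
  "vert c W 0 k = k"
| "vert c W (Suc n) k = vert c W n (cut (c n) (W (Suc n)) k)"

lemma row_diff: "row c (\<lambda>b. x b - r * y b) n = (\<lambda>b. row c x n b - r * row c y n b)"
  by (induction n) (auto simp: up_def fun_eq_iff algebra_simps)

lemma of_int_row: "of_int (row c u n b) = row c (\<lambda>b. of_int (u b)) n b"
  by (induction n arbitrary: b) (auto simp: up_def)

lemma of_int_ht: "of_int (ht c n b) = row c (\<lambda>_. 1) n b"
  by (simp add: of_int_row)

lemma ht_pos: "1 \<le> ht c n b"
proof (induction n arbitrary: b)
  case (Suc n)
  show ?case using Suc[of b] Suc[of "c n"] by (auto simp: up_def)
qed simp

lemma ht_Suc: "ht c (Suc n) b = ht c n b + (if b = c n then 0 else ht c n (c n))"
  by (simp add: up_def)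

lemma ht_mono: "n \<le> m \<Longrightarrow> ht c n b \<le> ht c m b"
proof (induction rule: dec_induct)
  case (step m)
  then show ?case using ht_pos[of c m "c m"] by (auto simp: ht_Suc simp del: row.simps)
qed simp

lemma vsum_ht_Suc: "vsum (ht c (Suc n)) = vsum (ht c n) + 2 * ht c n (c n)"
  by (cases "c n") (auto simp: vsum_def up_def)

locale hierarchy =
  fixes c :: "nat \<Rightarrow> letter" and W :: "nat \<Rightarrow> word"
  assumes desubst: "W n = subst_word (AR_subst (c n)) (W (Suc n))"
begin

abbreviation V :: "nat \<Rightarrow> nat \<Rightarrow> nat" where "V \<equiv> vert c W"
abbreviation H :: "nat \<Rightarrow> letter \<Rightarrow> int" where "H \<equiv> ht c"
abbreviation K :: "nat \<Rightarrow> nat \<Rightarrow> nat" where "K n \<equiv> cut (c n) (W (Suc n))"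

lemma W_K: "W n (K n k) = W (Suc n) k"
  and W_Suc_K: "W (Suc n) k \<noteq> c n \<Longrightarrow> W n (Suc (K n k)) = c n"
  by (subst desubst, simp add: subst_word_AR)+

text \<open>Makes every level available as a bottom level, so that estimates for prefixes of
  \<open>W 0\<close> apply to prefixes of \<open>W n\<close>.\<close>

lemma shift: "hierarchy (\<lambda>m. c (n + m)) (\<lambda>m. W (n + m))"
  by unfold_locales (simp only: add_Suc_right, rule desubst)

text \<open>Every image under \<open>AR_subst (c n)\<close> ends with \<open>c n\<close>, whatever
  its letter. All agreement to the left of boundaries comes from here.\<close>

lemma before_K: "0 < k \<Longrightarrow> 0 < K n k \<and> W n (K n k - 1) = c n"
proof (cases k)
  case (Suc l)
  then show ?thesis using W_K[of n l] W_Suc_K[of n l] by (auto simp: cut_Suc)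
qed simp

lemma K_after:
  assumes "W n s = c n" obtains k where "Suc s = K n (Suc k)"
proof (rule ex_cut[of s "c n" "W (Suc n)"])
  fix k assume k: "s = K n k"
  then have "W (Suc n) k = c n" using assms W_K by simp
  then show thesis using k that[of k] by (simp add: cut_Suc)
next
  fix k assume "s = Suc (K n k)" "W (Suc n) k \<noteq> c n"
  then show thesis using that[of k] by (simp add: cut_Suc)
qed

lemma cnt_K: "cnt (W n) (K n k) = Mact (c n) (cnt (W (Suc n)) k)"
proof (induction k)
  case 0 then show ?case by (simp add: Mact_def vsum_def fun_eq_iff)
next
  case (Suc k)
  show ?case
  proof (cases "W (Suc n) k = c n")
    case True
    then show ?thesis using W_K[of n k]
      by (simp add: cut_Suc cnt_Suc Suc Mact_add Mact_unit)
  next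
    case False
    then show ?thesis using W_K[of n k] W_Suc_K[of n k]
      by (simp add: cut_Suc cnt_Suc Suc Mact_add Mact_unit add.assoc)
  qed
qed

lemma dot_row_cnt: "dot (row c u n) (cnt (W n) k) = dot u (cnt (W 0) (V n k))"
proof (induction n arbitrary: k)
  case (Suc n)
  then show ?case by (simp add: dot_up flip: cnt_K)
qed simp

lemma dot_H_cnt: "dot (H n) (cnt (W n) k) = int (V n k)"
  by (simp add: dot_row_cnt dot_one vsum_cnt)

lemma V_Suc: "int (V n (Suc k)) = int (V n k) + H n (W n k)"
  by (simp add: cnt_Suc dot_add flip: dot_H_cnt)

lemma V_Suc': "V n (Suc k) = V n k + nat (H n (W n k))"
  using V_Suc[of n k] ht_pos[of c n "W n k"] by linarith

lemma V_0 [simp]: "V n 0 = 0" by (induction n) auto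

lemma V_less: "k < k' \<Longrightarrow> V n k < V n k'"
proof (rule lift_Suc_mono_less[of "V n"])
  fix k show "V n k < V n (Suc k)" using V_Suc[of n k] ht_pos[of c n "W n k"] by linarith
qed

lemma V_le_iff: "V n k \<le> V n k' \<longleftrightarrow> k \<le> k'"
  using V_less[of k k' n] V_less[of k' k n] by (metis leD le_neq_implies_less linorder_le_cases order_refl)

lemma V_less_iff: "V n k < V n k' \<longleftrightarrow> k < k'"
  using V_le_iff[of n k' k] by auto

lemma V_ge: "k \<le> V n k"
proof (induction k)
  case (Suc k)
  then show ?case using V_less[of k "Suc k" n] by auto
qed simp

lemma W0_V: "W 0 (V n k) = W n k"
  by (induction n arbitrary: k) (auto simp: W_K)

lemma ex_index:
  obtains k where "V n k \<le> t" "t < V n (Suc k)"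
proof -
  let ?S = "{k. V n k \<le> t}"
  have f: "finite ?S" using V_ge[of _ n] by (intro finite_subset[of ?S "{..t}"]) (auto intro: order_trans)
  have ne: "?S \<noteq> {}" by (auto intro: exI[of _ 0])
  have "Max ?S \<in> ?S" using Max_in[OF f ne] .
  moreover have "Suc (Max ?S) \<notin> ?S" using Max_ge[OF f] by (metis Suc_n_not_le_n)
  ultimately show ?thesis using that by auto
qed

lemma refine_index:
  assumes "V (Suc n) k \<le> t" "t < V (Suc n) (Suc k)"
  shows "V n (K n k) \<le> t \<and> t < V n (Suc (K n k)) \<or>
    W (Suc n) k \<noteq> c n \<and> V n (Suc (K n k)) \<le> t \<and> t < V n (Suc (Suc (K n k)))"
  using assms by (auto simp: cut_Suc split: if_splits)

lemma block_eq:
  assumes "W n k = W n k'" "x < nat (H n (W n k))"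
  shows "W 0 (V n k + x) = W 0 (V n k' + x)"
  using assms
proof (induction n arbitrary: k k' x)
  case (Suc n)
  let ?a = "W (Suc n) k"
  have a: "W n (K n k) = ?a" "W n (K n k') = ?a" using Suc W_K by auto
  show ?case
  proof (cases "x < nat (H n ?a)")
    case True then show ?thesis using Suc.IH[of "K n k" "K n k'" x] a by simp
  next
    case False
    then have ne: "?a \<noteq> c n" using Suc.prems by (auto simp: up_def)
    define y where "y = x - nat (H n ?a)"
    have x: "x = nat (H n ?a) + y" using False by (simp add: y_def)
    have "y < nat (H n (c n))" using Suc.prems ne x by (auto simp: up_def)
    moreover have "V n (Suc (K n k)) = V n (K n k) + nat (H n ?a)"
      "V n (Suc (K n k')) = V n (K n k') + nat (H n ?a)"
      using V_Suc'[of n "K n k"] V_Suc'[of n "K n k'"] a by simp_all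
    moreover have "W n (Suc (K n k)) = c n" "W n (Suc (K n k')) = c n"
      using W_Suc_K ne Suc.prems by auto
    ultimately show ?thesis using Suc.IH[of "Suc (K n k)" "Suc (K n k')" y] x
      by (simp add: add.assoc)
  qed
qed simp

lemma before_V:
  assumes "0 < k"
  obtains l where "V (Suc n) k = V n (Suc l)" "W n l = c n"
  using before_K[OF assms, of n] that[of "K n k - 1"] by auto

text \<open>To the left of each boundary of level \<open>Suc n\<close> other than 0 stands a block
  of type \<open>c n\<close> of level \<open>n\<close>, and blocks of one type carry the same
  letters.\<close>

lemma agree_left:
  assumes "0 < k" "0 < k'" "0 < x" "x \<le> nat (H n (c n))"
  shows "x \<le> V (Suc n) k" "W 0 (V (Suc n) k - x) = W 0 (V (Suc n) k' - x)"
proof -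
  obtain l l' where l: "V (Suc n) k = V n (Suc l)" "W n l = c n"
    "V (Suc n) k' = V n (Suc l')" "W n l' = c n"
    using before_V[OF assms(1), of n] before_V[OF assms(2), of n] by metis
  define m where "m = nat (H n (c n))"
  have v: "V n (Suc l) = V n l + m" "V n (Suc l') = V n l' + m"
    using V_Suc'[of n l] V_Suc'[of n l'] l by (auto simp: m_def)
  then show "x \<le> V (Suc n) k" using l assms by (simp add: m_def)
  show "W 0 (V (Suc n) k - x) = W 0 (V (Suc n) k' - x)"
    using block_eq[of n l l' "m - x"] l v assms by (simp add: m_def)
qed

text \<open>Length of a chain that consists of one block of type \<open>c m\<close> for each level
  \<open>m < n\<close>. Such a chain precedes the boundaries of level \<open>n\<close>, and its
  block of level \<open>m\<close> starts at distance \<open>g m\<close>.\<close>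

definition g :: "nat \<Rightarrow> nat" where "g n = (\<Sum>m<n. nat (H m (c m)))"

lemma g_less: "m < n \<Longrightarrow> g m < g n"
  by (rule lift_Suc_mono_less) (use ht_pos[of c _ "c _"] in \<open>simp_all add: g_def int_one_le_iff_zero_less\<close>)

text \<open>Both block lengths other than that of \<open>c n\<close> grow by that of
  \<open>c n\<close>, the summand of \<open>g\<close>. This compares the recognition pattern with
  the blocks themselves.\<close>

lemma vsum_H: "vsum (H n) = 3 + 2 * int (g n)"
proof (induction n)
  case 0 then show ?case by (simp add: g_def vsum_def)
next
  case (Suc n)
  then show ?case using vsum_ht_Suc[of c n] ht_pos[of c n "c n"]
    by (simp add: g_def del: row.simps)
qed

text \<open>A letter \<open>c m\<close> of \<open>W m\<close> always ends a block of the next level, so boundaries of level \<open>n\<close> can be read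
  off from finitely many letters to their left.\<close>

lemma recognize:
  assumes "\<And>m. m < n \<Longrightarrow> W 0 (t + g m) = c m"
  obtains k where "V n k = t + g n" "0 < n \<longrightarrow> 0 < k"
proof -
  have "\<exists>k. V n k = t + g n \<and> (0 < n \<longrightarrow> 0 < k)" using assms
  proof (induction n)
    case 0 then show ?case by (auto simp: g_def)
  next
    case (Suc n)
    then obtain k where k: "V n k = t + g n" by auto
    have "W n k = c n" using W0_V[of n k] k Suc.prems[of n] by auto
    then obtain l where l: "Suc k = K n (Suc l)" using K_after by blast
    have "V (Suc n) (Suc l) = V n (Suc k)" using l by simp
    also have "\<dots> = t + g (Suc n)"
      using V_Suc'[of n k] k \<open>W n k = c n\<close> by (simp add: g_def)
    finally show ?case by blast
  qed
  then show ?thesis using that by blast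
qed

lemma V_pred:
  assumes "0 < k"
  obtains l where "V n l = V (Suc n) k - nat (H n (c n))" "nat (H n (c n)) \<le> V (Suc n) k"
    "W n l = c n" "k \<le> Suc l" 
proof -
  have "W n (K n k - 1) = c n" "0 < K n k" using before_K[OF assms, of n] by auto
  moreover have "k \<le> K n k"
    by (induction k) (auto simp: cut_Suc)
  moreover have "V (Suc n) k = V n (Suc (K n k - 1))" using \<open>0 < K n k\<close> by simp
  ultimately show ?thesis using V_Suc'[of n "K n k - 1"]
    by (intro that[of "K n k - 1"]) auto
qed

text \<open>The converse of \<open>recognize\<close>. Each descent to the block on the left may
  lower the index by one, so \<open>n < k\<close> guarantees that there is such a block on all
  levels.\<close>

lemma pattern_before:
  assumes "n < k"
  shows "g n \<le> V n k \<and> (\<forall>m<n. W 0 (V n k - g n + g m) = c m)"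
  using assms
proof (induction n arbitrary: k)
  case 0 then show ?case by (simp add: g_def)
next
  case (Suc n)
  then have "0 < k" by simp
  then obtain l where l: "V n l = V (Suc n) k - nat (H n (c n))" "nat (H n (c n)) \<le> V (Suc n) k"
    "W n l = c n" "k \<le> Suc l" by (rule V_pred)
  have IH: "g n \<le> V n l" "\<And>m. m < n \<Longrightarrow> W 0 (V n l - g n + g m) = c m"
    using Suc.IH[of l] l(4) Suc.prems by auto
  have gs: "g (Suc n) = g n + nat (H n (c n))" by (simp add: g_def)
  have e: "V (Suc n) k - g (Suc n) = V n l - g n" using l gs by auto
  have "W 0 (V (Suc n) k - g (Suc n) + g m) = c m" if "m < Suc n" for m
  proof (cases "m = n")
    case True
    then show ?thesis using e IH l W0_V[of n l] by simp
  next
    case False then show ?thesis using that e IH by simp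
  qed
  moreover have "g (Suc n) \<le> V (Suc n) k" using IH(1) l gs by linarith
  ultimately show ?case by blast
qed

end

section \<open>Contraction and balance\<close>

text \<open>Solves \<open>2 ^ (L + 1) * x = 1 - x\<close>; at this threshold both cases of
  \<open>isolated_contract\<close> give the same bound.\<close>

definition loss :: "nat \<Rightarrow> real" where "loss L = 1 / (2 ^ (L + 1) + 1)"

lemma loss: "0 < loss L" "loss L < 1" "2 ^ (L + 1) * loss L = 1 - loss L"
proof -
  define x :: real where "x = 2 ^ (L + 1)"
  have p: "0 < x" by (simp add: x_def)
  then show "0 < loss L" "loss L < 1" "2 ^ (L + 1) * loss L = 1 - loss L"
    unfolding loss_def x_def[symmetric] by (simp_all add: field_simps)
qed

definition osc_le :: "(letter \<Rightarrow> real) \<Rightarrow> real \<Rightarrow> bool" where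
  "osc_le w D \<longleftrightarrow> (\<forall>a b. w a - w b \<le> D)"

lemma osc_le_neg: "osc_le (\<lambda>b. - w b) D \<longleftrightarrow> osc_le w D"
proof -
  have "- w a - - w b = w b - w a" for a b by simp
  then show ?thesis unfolding osc_le_def by (simp only:) blast
qed

definition isolated :: "(letter \<Rightarrow> real) \<Rightarrow> letter \<Rightarrow> bool" where
  "isolated w j \<longleftrightarrow> w j \<le> 0 \<and> (\<forall>b. b \<noteq> j \<longrightarrow> 0 \<le> w b)"

text \<open>Abstract form of the deviation rows. Both signs occur on each level because a frequency
  lies between the extreme proportions of its letter in the blocks of that level.\<close>

locale mixed_rows =
  fixes c :: "nat \<Rightarrow> letter" and w :: "nat \<Rightarrow> letter \<Rightarrow> real" and L :: nat
  assumes w_Suc: "w (Suc n) = up (c n) (w n)"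
    and mixed: "\<exists>b. 0 \<le> w n b" "\<exists>b. w n b \<le> 0"
    and gap: "\<exists>m\<in>{n..<n + L}. c m = a"
begin

lemma neg: "mixed_rows c (\<lambda>n b. - w n b) L"
proof
  fix n show "(\<lambda>b. - w (Suc n) b) = up (c n) (\<lambda>b. - w n b)"
    by (auto simp: w_Suc up_def fun_eq_iff)
  show "\<exists>b. 0 \<le> - w n b" "\<exists>b. - w n b \<le> 0" using mixed[of n] by auto
qed (rule gap)

text \<open>Differences between the two increased values are unchanged, and a difference to the
  value of \<open>c n\<close> becomes a single old value, which the oscillation bounds as values of
  both signs are present.\<close>

lemma osc_Suc: "osc_le (w n) D \<Longrightarrow> osc_le (w (Suc n)) D"
proof -
  assume o: "osc_le (w n) D"
  obtain x y where "0 \<le> w n x" "w n y \<le> 0" using mixed by blast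
  then have b: "- w n b \<le> D" "w n b \<le> D" for b
    using o unfolding osc_le_def by (smt (verit))+
  have "w (Suc n) a - w (Suc n) b \<le> D" for a b
    using b[of a] b[of b] o unfolding osc_le_def w_Suc up_def
    by (smt (verit) diff_self)
  then show ?thesis by (simp add: osc_le_def)
qed

lemma osc_mono: "n \<le> m \<Longrightarrow> osc_le (w n) D \<Longrightarrow> osc_le (w m) D"
  by (induction rule: dec_induct) (auto intro: osc_Suc)

lemma osc_abs: "osc_le (w n) D \<Longrightarrow> \<bar>w n b\<bar> \<le> D"
  using mixed[of n] unfolding osc_le_def by (smt (verit))

lemma first_use_after:
  obtains s where "s < L" "c (n + s) = a" "\<And>r. r < s \<Longrightarrow> c (n + r) \<noteq> a"
proof -
  obtain m where "n \<le> m" "m < n + L" "c m = a" "\<forall>x. n \<le> x \<and> x < m \<longrightarrow> c x \<noteq> a"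
    using first_use[OF gap[of n a]] by blast
  then show thesis by (intro that[of "m - n"]) auto
qed

text \<open>When \<open>k\<close> is used, all other values grow by that of \<open>k\<close>, so it can only be as large as the negative part.\<close>

lemma neg_part_controls:
  assumes "\<And>b. - x \<le> w n b" "0 \<le> x"
  shows "w n k \<le> 2 ^ (L + 1) * x"
proof -
  have low: "- (2 ^ s * x) \<le> w (n + s) b" for s b
  proof (induction s arbitrary: b)
    case 0 then show ?case using assms by simp
  next
    case (Suc s)
    have "0 \<le> 2 ^ s * x" using assms by simp
    then show ?case using Suc[of b] Suc[of "c (n + s)"] unfolding add_Suc_right w_Suc up_def
      by auto
  qed
  obtain s where s: "s < L" "c (n + s) = k" "\<And>r. r < s \<Longrightarrow> c (n + r) \<noteq> k"
    using first_use_after by blast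
  have "w n k - (2 ^ r - 1) * x \<le> w (n + r) k" if "r \<le> s" for r
    using that
  proof (induction r)
    case (Suc r)
    then have "w (n + Suc r) k = w (n + r) k + w (n + r) (c (n + r))"
      using s(3)[of r] by (auto simp: w_Suc up_def)
    then show ?case using Suc low[of r "c (n + r)"] by (simp add: algebra_simps)
  qed simp
  from this[of s] have 1: "w n k \<le> w (n + s) k + (2 ^ s - 1) * x" by simp
  \<comment> \<open>Each value after the use of \<open>k\<close> is that of \<open>k\<close>, or
    that of \<open>k\<close> plus a value at least \<open>- (2 ^ s * x)\<close>; so one that is not
    positive bounds the value of \<open>k\<close>.\<close>
  obtain b where "w (Suc (n + s)) b \<le> 0" using mixed by blast
  then have "w (n + s) k \<le> 2 ^ s * x"
    using low[of s b] s(2) assms(2) mult_nonneg_nonneg[of "2 ^ s" x]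
    by (auto simp: w_Suc up_def split: if_splits)
  then have "w n k \<le> 2 ^ (s + 1) * x" using 1 assms(2) by (simp add: algebra_simps)
  also have "\<dots> \<le> 2 ^ (L + 1) * x"
    using assms(2) s(1) by (intro mult_right_mono power_increasing) auto
  finally show ?thesis .
qed

text \<open>If adding the value of \<open>c n\<close> made \<open>j\<close> positive, that value
  would be positive, and so would be all three new values.\<close>

lemma isolated_step:
  assumes "isolated (w n) j" "c n \<noteq> j"
  shows "isolated (w (Suc n)) j"
proof -
  have p: "0 \<le> w n b" if "b \<noteq> j" for b using assms that by (simp add: isolated_def)
  have nn: "0 \<le> w (Suc n) b" if "b \<noteq> j" for b
    using p[OF that] p[OF assms(2)] by (auto simp: w_Suc up_def)
  have "w (Suc n) j \<le> 0"
  proof (rule ccontr)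
    assume "\<not> ?thesis"
    then have j: "0 < w (Suc n) j" by simp
    then have "0 < w n (c n)" using assms by (auto simp: w_Suc up_def isolated_def)
    then have "0 < w (Suc n) b" for b
      using p[of b] j by (cases "b = j") (auto simp: w_Suc up_def)
    then show False using mixed(2)[of "Suc n"] by (meson not_less)
  qed
  then show ?thesis using nn by (simp add: isolated_def)
qed

text \<open>Using the letter whose value has the isolated sign reduces the oscillation by the modulus of that
  value, which is not small by \<open>neg_part_controls\<close>.\<close>

lemma isolated_contract:
  assumes iso: "isolated (w n) j" and o: "osc_le (w n) D"
  shows "osc_le (w (n + L)) ((1 - loss L) * D)"
proof -
  obtain s where s: "s < L" "c (n + s) = j" "\<And>r. r < s \<Longrightarrow> c (n + r) \<noteq> j"
    using first_use_after by blast
  have "isolated (w (n + r)) j" if "r \<le> s" for r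
    using that by (induction r) (use iso isolated_step s in auto)
  then have i: "isolated (w (n + s)) j" by simp
  have o: "osc_le (w (n + s)) D" using osc_mono[OF _ o] by simp
  define x where "x = - w (n + s) j"
  have x: "0 \<le> x" using i by (simp add: x_def isolated_def)
  have x2: "- x \<le> w (n + s) b" for b
    using i x by (cases "b = j") (fastforce simp: x_def isolated_def)+
  have le: "w (n + s) b \<le> (1 - loss L) * D" for b
  proof (cases "loss L * D \<le> x")
    case True
    have "w (n + s) b + x \<le> D" using o unfolding osc_le_def x_def by (metis diff_conv_add_uminus)
    then show ?thesis using True by (simp add: algebra_simps)
  next
    case False
    have "w (n + s) b \<le> 2 ^ (L + 1) * x" using neg_part_controls x x2 by blast
    also have "\<dots> \<le> 2 ^ (L + 1) * (loss L * D)" using False by (intro mult_left_mono) auto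
    also have "\<dots> = (1 - loss L) * D" using loss(3)[of L] by (simp add: mult.assoc[symmetric])
    finally show ?thesis .
  qed
  have D: "0 \<le> (1 - loss L) * D" using o loss[of L] unfolding osc_le_def by (metis diff_ge_0_iff_ge diff_self mult_nonneg_nonneg less_imp_le)
  have nn: "b \<noteq> j \<Longrightarrow> 0 \<le> w (n + s) b" for b using i by (simp add: isolated_def)
  have "w (Suc (n + s)) a - w (Suc (n + s)) b \<le> (1 - loss L) * D" for a b
    using le[of a] le[of b] D nn[of a] nn[of b] x s(2) unfolding w_Suc up_def x_def
    by (auto split: if_splits)
  then have "osc_le (w (Suc (n + s))) ((1 - loss L) * D)" by (simp add: osc_le_def)
  then show ?thesis using osc_mono[of "Suc (n + s)" "n + L"] s(1) by simp
qed

text \<open>Of three values with both signs present, one is alone on its side; changing all signs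
  reduces to the case that it is the negative one.\<close>

lemma contract:
  assumes "osc_le (w n) D"
  shows "osc_le (w (n + L)) ((1 - loss L) * D)"
proof -
  have "\<exists>j. isolated (w n) j \<or> isolated (\<lambda>b. - w n b) j"
    using mixed[of n] unfolding isolated_def ex_letter all_letter
    by (simp, smt (verit))
  then consider j where "isolated (w n) j" | j where "isolated (\<lambda>b. - w n b) j" by blast
  then show ?thesis
  proof cases
    case 1 then show ?thesis using isolated_contract assms by blast
  next
    case 2
    have "osc_le (\<lambda>b. - w n b) D" using assms by (simp add: osc_le_neg)
    then have "osc_le (\<lambda>b. - w (n + L) b) ((1 - loss L) * D)"
      using mixed_rows.isolated_contract[OF neg 2] by blast
    then show ?thesis by (simp add: osc_le_neg)
  qed
qed

end

text \<open>Spreads one contraction by \<open>1 - loss L\<close> per \<open>L\<close> levels over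
  the single levels, by the Bernoulli inequality; \<open>ampl\<close> pays for the last, incomplete
  window.\<close>

definition rate :: "nat \<Rightarrow> real" where "rate L = 1 - loss L / L"
definition ampl :: "nat \<Rightarrow> real" where "ampl L = 1 / (1 - loss L)"

lemma rate:
  assumes "0 < L"
  shows "0 < rate L" "rate L < 1" "1 - loss L \<le> rate L ^ L"
proof -
  have "loss L / L \<le> loss L" "0 < loss L / L" using assms loss[of L] by (auto simp: field_simps)
  then show "0 < rate L" "rate L < 1" using loss[of L] by (auto simp: rate_def)
  then have "1 + real L * (- (loss L / L)) \<le> (1 + (- (loss L / L))) ^ L"
    by (intro Bernoulli_inequality) (simp add: rate_def)
  then show "1 - loss L \<le> rate L ^ L" using assms by (simp add: rate_def)
qed

lemma (in mixed_rows) decay: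
  assumes "osc_le (w 0) 1"
  shows "\<bar>w n b\<bar> \<le> ampl L * rate L ^ n"
proof -
  have L: "0 < L" using gap[of 0] by (cases L) auto
  have p: "osc_le (w (q * L)) ((1 - loss L) ^ q)" for q
  proof (induction q)
    case 0 then show ?case using assms by simp
  next
    case (Suc q)
    from contract[OF this] show ?case by (simp add: add.commute)
  qed
  let ?q = "n div L"
  have n: "?q * L \<le> n" "n \<le> ?q * L + L" using L
    by (auto simp: dividend_less_div_times less_imp_le add.commute)
  have "\<bar>w n b\<bar> \<le> (1 - loss L) ^ ?q" using osc_abs osc_mono[OF n(1) p] by blast
  also have "\<dots> \<le> (rate L ^ L) ^ ?q" using rate[OF L] loss[of L] by (intro power_mono) auto
  also have "\<dots> = rate L ^ (?q * L)" by (simp add: power_mult[symmetric] mult.commute)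
  also have "\<dots> * (1 - loss L) \<le> rate L ^ (?q * L) * rate L ^ L"
    using rate[OF L] by (intro mult_left_mono) auto
  then have "rate L ^ (?q * L) \<le> ampl L * rate L ^ (?q * L + L)"
    using loss[of L] unfolding ampl_def by (simp add: field_simps power_add)
  also have "ampl L * rate L ^ (?q * L + L) \<le> ampl L * rate L ^ n"
    using n rate[OF L] loss[of L] by (intro mult_left_mono power_decreasing) (auto simp: ampl_def)
  finally show ?thesis .
qed

section \<open>Letter frequencies of a directive sequence\<close>

text \<open>The best lower bound, over all levels, for the proportion of \<open>a\<close> in every
  block. It refers to the directive sequence alone and presupposes no convergence, so it applies at
  once to all tails of the sequence.\<close>

definition freq :: "(nat \<Rightarrow> letter) \<Rightarrow> letter \<Rightarrow> real" where
  "freq c a = Sup {x. \<exists>n. \<forall>b. x * row c (\<lambda>_. 1) n b \<le> row c (unit a) n b}"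

lemma row_one_pos: "0 < row c (\<lambda>_. 1 :: real) n b"
proof -
  have "0 < real_of_int (ht c n b)" using ht_pos[of c n b] by linarith
  then show ?thesis unfolding of_int_ht .
qed

lemma row_le:
  fixes u v :: "letter \<Rightarrow> real"
  assumes "n \<le> m" "\<And>b. row c u n b \<le> row c v n b"
  shows "row c u m b \<le> row c v m b"
  using assms
proof (induction arbitrary: b rule: dec_induct)
  case (step m)
  then show ?case by (auto simp: up_def add_mono)
qed simp

lemma row_scale: "row c (\<lambda>b. r * u b) n = (\<lambda>b. r * row c u n b)"
  by (induction n) (auto simp: up_def fun_eq_iff algebra_simps)

text \<open>Inequalities between rows persist to higher levels, so bounds from two levels can be
  compared at the larger one.\<close>

lemma freq_bracket:
  assumes "\<And>b. x * row c (\<lambda>_. 1) n b \<le> row c (unit a) n b"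
    and "\<And>b. row c (unit a) m b \<le> y * row c (\<lambda>_. 1) m b"
  shows "x \<le> (y::real)"
proof -
  let ?N = "max n m"
  have "row c (\<lambda>_. x * 1) ?N One \<le> row c (unit a) ?N One"
    by (rule row_le[of n]) (use assms in \<open>auto simp: row_scale[of c x "\<lambda>_. 1", simplified]\<close>)
  also have "\<dots> \<le> row c (\<lambda>_. y * 1) ?N One"
    by (rule row_le[of m]) (use assms in \<open>auto simp: row_scale[of c y "\<lambda>_. 1", simplified]\<close>)
  finally show ?thesis using row_one_pos[of c ?N One] by (simp only: row_scale) (simp add: mult_le_cancel_right)
qed

lemma unit_bounds: "0 \<le> (unit a b :: real)" "unit a b \<le> (1 :: real)"
  by (auto simp: unit_def)

lemma freq_ge: "(\<And>b. x * row c (\<lambda>_. 1) n b \<le> row c (unit a) n b) \<Longrightarrow> x \<le> freq c a"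
  unfolding freq_def
proof (rule cSup_upper)
  show "bdd_above {x::real. \<exists>n. \<forall>b. x * row c (\<lambda>_. 1) n b \<le> row c (unit a) n b}"
  proof (rule bdd_aboveI[of _ 1], clarify)
    fix x :: real and n
    assume "\<forall>b. x * row c (\<lambda>_. 1) n b \<le> row c (unit a) n b"
    then show "x \<le> 1" by (intro freq_bracket[of x c n a 0 1]) (auto simp: unit_bounds)
  qed
qed blast

lemma freq_le: "(\<And>b. row c (unit a) n b \<le> x * row c (\<lambda>_. 1) n b) \<Longrightarrow> freq c a \<le> x"
  unfolding freq_def
proof (rule cSup_least)
  show "{x::real. \<exists>n. \<forall>b. x * row c (\<lambda>_. 1) n b \<le> row c (unit a) n b} \<noteq> {}"
    by (auto intro!: exI[of _ 0] simp: unit_bounds)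
qed (auto intro: freq_bracket)

lemma freq_bounds: "0 \<le> freq c a" "freq c a \<le> 1"
  by (rule freq_ge[of _ c 0], simp add: unit_bounds, rule freq_le[of c a 0 1], simp add: unit_bounds)

definition dev :: "(nat \<Rightarrow> letter) \<Rightarrow> letter \<Rightarrow> nat \<Rightarrow> letter \<Rightarrow> real" where
  "dev c a = row c (\<lambda>b. unit a b - freq c a * 1)"

lemma dev_eq: "dev c a n b = row c (unit a) n b - freq c a * row c (\<lambda>_. 1) n b"
  unfolding dev_def row_diff by simp

text \<open>If all deviations had one strict sign, the extreme proportion on this level would be a
  bound that the frequency violates.\<close>

lemma dev_mixed: "\<exists>b. 0 \<le> dev c a n b" "\<exists>b. dev c a n b \<le> 0"
proof -
  let ?r = "\<lambda>b. row c (unit a) n b / row c (\<lambda>_. 1) n b :: real"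
  show "\<exists>b. 0 \<le> dev c a n b"
  proof (rule ccontr)
    assume "\<not> ?thesis"
    then have lt: "?r b < freq c a" for b using row_one_pos[of c n b]
      by (auto simp: dev_eq field_simps not_le)
    have "row c (unit a) n b \<le> Max (range ?r) * row c (\<lambda>_. 1) n b" for b
      by (subst pos_divide_le_eq[OF row_one_pos, symmetric]) (rule Max_ge, auto)
    then have le: "freq c a \<le> Max (range ?r)" by (rule freq_le)
    have "Max (range ?r) \<in> range ?r" by (rule Max_in) auto
    then obtain b where b: "Max (range ?r) = ?r b" by (rule rangeE)
    show False using le lt[of b] unfolding b by linarith
  qed
  show "\<exists>b. dev c a n b \<le> 0"
  proof (rule ccontr)
    assume "\<not> ?thesis"
    then have lt: "freq c a < ?r b" for b using row_one_pos[of c n b]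
      by (auto simp: dev_eq field_simps not_le)
    have "Min (range ?r) * row c (\<lambda>_. 1) n b \<le> row c (unit a) n b" for b
      by (subst pos_le_divide_eq[OF row_one_pos, symmetric]) (rule Min_le, auto)
    then have le: "Min (range ?r) \<le> freq c a" by (rule freq_ge)
    have "Min (range ?r) \<in> range ?r" by (rule Min_in) auto
    then obtain b where b: "Min (range ?r) = ?r b" by (rule rangeE)
    show False using le lt[of b] unfolding b by linarith
  qed
qed

section \<open>Growth of block lengths and balance under bounded gaps\<close>

locale gapped = hierarchy +
  fixes L :: nat
  assumes gap: "\<exists>m\<in>{n..<n + L}. c m = a"
begin

lemma L_pos: "0 < L" using gap[of 0] by (cases L) auto

lemma shift_gapped: "gapped (\<lambda>m. c (n + m)) (\<lambda>m. W (n + m)) L"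
proof (rule gapped.intro[OF shift], unfold_locales)
  fix m a
  obtain k where "k \<in> {n + m..<n + m + L}" "c k = a" using gap by blast
  then show "\<exists>k\<in>{m..<m + L}. c (n + k) = a" by (intro bexI[of _ "k - n"]) auto
qed

lemma mixed: "mixed_rows c (dev c a) L"
proof
  fix n show "dev c a (Suc n) = up (c n) (dev c a n)" by (simp add: dev_def)
qed (use dev_mixed gap in auto)

lemma dev_decay: "\<bar>dev c a n b\<bar> \<le> ampl L * rate L ^ n"
  by (rule mixed_rows.decay[OF mixed]) (auto simp: osc_le_def dev_def unit_def)

lemma H_grow: "int n < H (n * L) b"
proof (induction n)
  case (Suc n)
  obtain a where "a \<noteq> b" by (metis letter.distinct(1))
  obtain m where m: "n * L \<le> m" "m < n * L + L" "c m = a" using gap[of "n * L" a] by auto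
  have "H (n * L) b + 1 \<le> H m b + H m a" using ht_mono[OF m(1)] ht_pos[of c m a] by (simp add: add_mono)
  also have "\<dots> = H (Suc m) b" using m \<open>a \<noteq> b\<close> by (simp add: up_def)
  also have "\<dots> \<le> H (Suc n * L) b" using m by (intro ht_mono) (simp add: Suc_leI add.commute)
  finally show ?case using Suc by simp
qed simp

lemma H_large: "m * L \<le> n \<Longrightarrow> int m < H n b"
  using H_grow ht_mono less_le_trans by metis

lemma H_max_step: "(\<And>b. H n b \<le> x) \<Longrightarrow> H (n + m) b \<le> 2 ^ m * x"
proof (induction m arbitrary: b)
  case (Suc m)
  have x: "0 \<le> 2 ^ m * x" using Suc.IH[OF Suc.prems, of One] ht_pos[of c "n + m" One] by linarith
  show ?case using Suc.IH[OF Suc.prems, of b] Suc.IH[OF Suc.prems, of "c (n + m)"] x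
    by (auto simp: up_def)
qed simp

text \<open>The longest block of level \<open>n - L\<close> is of a type used in the next
  \<open>L\<close> steps, after which every block is at least as long; meanwhile the maximal length
  at most doubles per step. For \<open>n < L\<close> the doubling alone suffices.\<close>

lemma H_ratio: "H n a \<le> 2 ^ L * H n b"
proof (cases "n < L")
  case True
  have "H n a \<le> 2 ^ n * 1" using H_max_step[of 0 1 n a] by simp
  also have "\<dots> \<le> 2 ^ L" using True by simp
  also have "\<dots> \<le> 2 ^ L * H n b" using ht_pos[of c n b] by simp
  finally show ?thesis .
next
  case False
  define m where "m = n - L"
  have n: "n = m + L" using False by (simp add: m_def)
  have "Max (range (H m)) \<in> range (H m)" by (rule Max_in) auto
  then obtain a' where a': "H m a' = Max (range (H m))" by (metis rangeE)
  then have mx: "H m b \<le> H m a'" for b by (simp add: a')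
  obtain k where k: "m \<le> k" "k < m + L" "c k = a'" using gap[of m a'] by auto
  have "H m a' \<le> H (Suc k) b"
    using ht_mono[OF k(1), of c a'] ht_pos[of c k b] k(3) by (auto simp: up_def)
  also have "\<dots> \<le> H n b" using k n by (intro ht_mono) simp
  finally have "H m a' \<le> H n b" .
  then have "2 ^ L * H m a' \<le> 2 ^ L * H n b" by simp
  moreover have "H n a \<le> 2 ^ L * H m a'" using H_max_step[OF mx, of L a] n by simp
  ultimately show ?thesis by linarith
qed

text \<open>Sum of the geometric series of the bounds in \<open>dev_decay\<close>.\<close>

definition bal :: real where "bal = ampl L / (1 - rate L)"

lemma ampl_pos: "0 < ampl L" using loss[of L] by (simp add: ampl_def)

lemma bal_pos: "0 < bal" using ampl_pos rate[OF L_pos] by (simp add: bal_def)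

text \<open>A prefix is cut down level by level: either it ends at a boundary of the next level, or
  a single letter, the first of a two-letter image, is left over and costs one deviation of that
  level. The costs form a geometric series.\<close>

lemma dev_balance: "\<bar>dot (dev c a n) (cnt (W n) s)\<bar> \<le> bal * rate L ^ n"
proof -
  let ?E = "\<lambda>n s. dot (dev c a n) (cnt (W n) s)"
  have K: "?E n (K n k) = ?E (Suc n) k" for n k by (simp add: cnt_K dot_up dev_def)
  have "\<exists>k. \<bar>?E n s\<bar> \<le> (\<Sum>m<t. ampl L * rate L ^ (n + m)) + \<bar>?E (n + t) k\<bar> \<and> V (n + t) k \<le> V n s" for t
  proof (induction t)
    case (Suc t)
    then obtain k where k: "\<bar>?E n s\<bar> \<le> (\<Sum>m<t. ampl L * rate L ^ (n + m)) + \<bar>?E (n + t) k\<bar>"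
      "V (n + t) k \<le> V n s" by blast
    show ?case
    proof (rule ex_cut[of k "c (n + t)" "W (Suc (n + t))"])
      fix k' assume k': "k = K (n + t) k'"
      have "0 \<le> ampl L * rate L ^ (n + t)" using ampl_pos rate[OF L_pos] by simp
      then show ?thesis using k K[of "n + t" k'] k' by (intro exI[of _ k']) simp
    next
      fix k' assume k': "k = Suc (K (n + t) k')"
      then have "?E (n + t) k = ?E (Suc (n + t)) k' + dev c a (n + t) (W (n + t) (K (n + t) k'))"
        by (simp add: cnt_Suc dot_add K)
      moreover have "V (n + t) (K (n + t) k') \<le> V (n + t) k" using k' V_less[of "K (n + t) k'" k "n + t"] by simp
      ultimately have "\<bar>?E n s\<bar> \<le> (\<Sum>m<Suc t. ampl L * rate L ^ (n + m)) + \<bar>?E (n + Suc t) k'\<bar>"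
        "V (n + Suc t) k' \<le> V n s"
        using k dev_decay[of a "n + t" "W (n + t) (K (n + t) k')"]
        unfolding sum.lessThan_Suc add_Suc_right by (linarith, simp)
      then show ?thesis by blast
    qed
  qed (auto intro: exI[of _ s])
  \<comment> \<open>So many levels up, the first block is longer than the whole prefix, so that
    nothing remains.\<close>
  from this[of "Suc (V n s) * L"] obtain k where
    k: "\<bar>?E n s\<bar> \<le> (\<Sum>m<Suc (V n s) * L. ampl L * rate L ^ (n + m)) + \<bar>?E (n + Suc (V n s) * L) k\<bar>"
    "V (n + Suc (V n s) * L) k \<le> V n s" by blast
  have "k = 0"
  proof (rule ccontr)
    assume "k \<noteq> 0"
    let ?m = "n + Suc (V n s) * L"
    have "V ?m (Suc 0) \<le> V ?m k" using \<open>k \<noteq> 0\<close> by (simp add: V_le_iff del: vert.simps)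
    moreover have "int (Suc (V n s)) < H ?m (W ?m 0)" by (rule H_large) simp
    ultimately show False using V_Suc[of ?m 0] k(2) by simp
  qed
  then have "\<bar>?E n s\<bar> \<le> (\<Sum>m<Suc (V n s) * L. ampl L * rate L ^ n * rate L ^ m)"
    using k(1) by (simp add: dot_def power_add mult.assoc)
  also have "\<dots> = ampl L * rate L ^ n * (\<Sum>m<Suc (V n s) * L. rate L ^ m)"
    by (simp add: sum_distrib_left)
  also have "\<dots> \<le> ampl L * rate L ^ n * (1 / (1 - rate L))"
  proof (rule mult_left_mono)
    show "(\<Sum>m<Suc (V n s) * L. rate L ^ m) \<le> 1 / (1 - rate L)"
      using rate[OF L_pos] by (subst sum_gp_strict) (auto simp: divide_right_mono)
  qed (use ampl_pos rate[OF L_pos] in simp)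
  finally show ?thesis by (simp add: bal_def algebra_simps)
qed

lemma dot_dev_0: "dot (dev c a 0) y = y a - freq c a * vsum y"
proof -
  have "dot (\<lambda>b. unit a b - freq c a * 1) y = dot (unit a) y - freq c a * vsum y"
    unfolding dot_def vsum_def by (simp add: algebra_simps)
  then show ?thesis by (simp add: dev_def)
qed

lemma balance_V: "\<bar>cnt (W 0) (V n k) a - freq c a * real (V n k)\<bar> \<le> bal * rate L ^ n"
proof -
  have "dot (dev c a n) (cnt (W n) k) = cnt (W 0) (V n k) a - freq c a * real (V n k)"
    unfolding dev_def dot_row_cnt by (subst dot_dev_0[unfolded dev_def, simplified row.simps]) (simp add: vsum_cnt)
  then show ?thesis using dev_balance[of a n k] by simp
qed

lemma balance: "\<bar>cnt (W 0) k a - freq c a * real k\<bar> \<le> bal"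
  using balance_V[of 0 k a] by simp

lemma bounded_multiples_zero:
  fixes x B :: real assumes "\<And>k::nat. \<bar>real k * x\<bar> \<le> B" shows "x = 0"
proof (rule ccontr)
  assume "x \<noteq> 0"
  obtain k :: nat where "B / \<bar>x\<bar> < real k" using reals_Archimedean2 by blast
  then have "B < real k * \<bar>x\<bar>" using \<open>x \<noteq> 0\<close> by (simp add: field_simps)
  then show False using assms[of k] by (simp add: abs_mult)
qed

lemma freq_sum: "vsum (freq c) = 1"
proof -
  have "\<bar>real k * (1 - vsum (freq c))\<bar> \<le> 3 * bal" for k
  proof -
    have "real k * (1 - vsum (freq c)) = vsum (\<lambda>a. cnt (W 0) k a - freq c a * real k)"
      using vsum_cnt[of "W 0" k, where 'a=real] unfolding vsum_diff by (simp add: vsum_def algebra_simps)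
    then show ?thesis using balance[of k One] balance[of k Two] balance[of k Three]
      unfolding vsum_def by linarith
  qed
  then show ?thesis using bounded_multiples_zero by force
qed

text \<open>The counts of \<open>W n\<close> are \<open>k\<close> times the frequencies of its own
  tail up to a bounded error, and the deviation is bounded on them; hence the part linear in
  \<open>k\<close> vanishes.\<close>

lemma dot_dev_freq: "dot (dev c a n) (freq (\<lambda>m. c (n + m))) = 0"
proof -
  interpret s: gapped "\<lambda>m. c (n + m)" "\<lambda>m. W (n + m)" L by (rule shift_gapped)
  let ?f = "freq (\<lambda>m. c (n + m))" and ?A = "ampl L * rate L ^ n"
  have "\<bar>real k * dot (dev c a n) ?f\<bar> \<le> bal * rate L ^ n + 3 * (?A * s.bal)" for k
  proof -
    let ?y = "\<lambda>b. cnt (W n) k b - real k * ?f b"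
    have y: "\<bar>?y b\<bar> \<le> s.bal" for b using s.balance[of k b] by (simp add: mult.commute)
    have "\<bar>dev c a n b * ?y b\<bar> \<le> ?A * s.bal" for b
      unfolding abs_mult using dev_decay[of a n b] y[of b] ampl_pos rate[OF L_pos]
      by (intro mult_mono) auto
    from this[of One] this[of Two] this[of Three] have "\<bar>dot (dev c a n) ?y\<bar> \<le> 3 * (?A * s.bal)"
      unfolding dot_def by linarith
    moreover have "real k * dot (dev c a n) ?f = dot (dev c a n) (cnt (W n) k) - dot (dev c a n) ?y"
      unfolding dot_diff dot_scale by simp
    ultimately show ?thesis using dev_balance[of a n k] by linarith
  qed
  then show ?thesis by (rule bounded_multiples_zero)
qed

end

section \<open>Bounded gaps in the directive sequence\<close>

text \<open>In a stretch of period \<open>m\<close> all windows of length \<open>m\<close> have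
  equal letter counts.\<close>

lemma sum_mod_shift:
  fixes f :: "nat \<Rightarrow> 'a::cancel_comm_monoid_add"
  shows "(\<Sum>y<m. f ((s + y) mod m)) = (\<Sum>y<m. f y)"
proof (cases "m = 0")
  case False
  show ?thesis
  proof (induction s)
    case (Suc s)
    define h where "h y = f ((s + y) mod m)" for y
    have "(\<Sum>y<m. f ((Suc s + y) mod m)) + h 0 = (\<Sum>y<m. h (Suc y)) + h 0" by (simp add: h_def)
    also have "\<dots> = (\<Sum>y<Suc m. h y)" unfolding sum.lessThan_Suc_shift by (simp add: add.commute)
    also have "\<dots> = (\<Sum>y<m. h y) + h m" by simp
    also have "h m = h 0" by (simp add: h_def)
    finally have "(\<Sum>y<m. f ((Suc s + y) mod m)) = (\<Sum>y<m. h y)" by simp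
    then show ?case using Suc by (simp add: h_def)
  qed simp
qed simp

text \<open>Uniform recurrence provides a length with the required property, so that the
  \<open>LEAST\<close> in \<open>recurrence_function\<close> has it too; linear recurrence then
  bounds it.\<close>

lemma linearly_recurrent_windows:
  assumes "linearly_recurrent w"
  obtains C where "\<And>m t t'. 0 < m \<Longrightarrow>
    \<exists>x\<ge>t'. x + m \<le> t' + C * m \<and> (\<forall>y<m. w (x + y) = w (t + y))"
proof -
  obtain C :: real where C: "\<And>n. real (recurrence_function w n) \<le> C * real n"
    and ur: "uniformly_recurrent w"
    using assms unfolding linearly_recurrent_def by blast
  let ?P = "\<lambda>n k. \<forall>v\<in>factors w k. \<forall>u\<in>factors w n. sublist u v"
  have rec: "?P n (recurrence_function w n)" for n
  proof -
    have fin: "finite (factors w n)"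
      by (rule finite_subset[OF _ finite_lists_length_eq[of UNIV n]]) (auto simp: factors_def)
    obtain G where G: "\<And>u m. u \<in> factors w n \<Longrightarrow> \<exists>i\<in>{m..m + G u}. map w [i..<i + n] = u"
      using ur unfolding uniformly_recurrent_def by metis
    \<comment> \<open>There are finitely many factors of length \<open>n\<close>, hence a common
      bound for their gaps.\<close>
    have "?P n (n + Max (G ` factors w n))"
    proof (intro ballI)
      fix v u assume v: "v \<in> factors w (n + Max (G ` factors w n))" and u: "u \<in> factors w n"
      let ?M = "Max (G ` factors w n)"
      obtain m where m: "v = map w [m..<m + (n + ?M)]" using v unfolding factors_def by blast
      obtain i where i: "m \<le> i" "i \<le> m + G u" "map w [i..<i + n] = u" using G[OF u, of m] by auto
      have "G u \<le> ?M" using fin u by simp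
      then have "[m..<m + (n + ?M)] = [m..<i] @ [i..<i + n] @ [i + n..<m + (n + ?M)]"
        using i upt_add_eq_append[of m i "m + (n + ?M) - i"] upt_add_eq_append[of i "i + n" "m + (n + ?M) - (i + n)"]
        by (simp add: add.left_commute)
      then show "sublist u v" using i unfolding m sublist_def by (metis map_append)
    qed
    then show ?thesis unfolding recurrence_function_def by (rule LeastI)
  qed
  show thesis
  proof (rule that[of "nat \<lceil>C\<rceil>"])
    fix m t t' :: nat assume "0 < m"
    define r where "r = recurrence_function w m"
    have "real r \<le> real (nat \<lceil>C\<rceil> * m)"
      using C[of m] mult_right_mono[of C "real (nat \<lceil>C\<rceil>)" "real m"] real_nat_ceiling_ge[of C]
      by (simp add: r_def)
    then have r: "r \<le> nat \<lceil>C\<rceil> * m" by linarith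
    have "sublist (map w [t..<t + m]) (map w [t'..<t' + r])"
      using rec[of m] unfolding r_def factors_def by blast
    then obtain ps ss where ps: "map w [t'..<t' + r] = ps @ map w [t..<t + m] @ ss"
      unfolding sublist_def by blast
    let ?x = "t' + length ps"
    have len: "r = length ps + m + length ss" using arg_cong[OF ps, of length] by simp
    have "w (?x + y) = w (t + y)" if "y < m" for y
    proof -
      have "map w [t'..<t' + r] ! (length ps + y) = w (?x + y)" using that len by (simp add: add.assoc)
      moreover have "(ps @ map w [t..<t + m] @ ss) ! (length ps + y) = w (t + y)"
        using that by (simp add: nth_append)
      ultimately show ?thesis using ps by simp
    qed
    then show "\<exists>x\<ge>t'. x + m \<le> t' + nat \<lceil>C\<rceil> * m \<and> (\<forall>y<m. w (x + y) = w (t + y))"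
      using len r by (intro exI[of _ ?x]) auto
  qed
qed

section \<open>Consequences of infinitely many uses of each letter\<close>

locale ar_hierarchy = hierarchy +
  assumes often: "\<exists>m\<ge>n. c m = a"
begin

lemma H_unbounded: "\<exists>N. \<forall>n\<ge>N. int X < H n b"
proof (induction X)
  case 0
  show ?case using ht_pos[of c _ b] by (intro exI[of _ 0]) (simp add: int_one_le_iff_zero_less)
next
  case (Suc X)
  then obtain N where N: "\<And>n. n \<ge> N \<Longrightarrow> int X < H n b" by blast
  obtain a where a: "a \<noteq> b" by (metis letter.distinct(1))
  obtain m where m: "N \<le> m" "c m = a" using often by blast
  have "int (Suc X) < H (Suc m) b" using N[OF m(1)] m a ht_pos[of c m a] by (simp add: up_def)
  then show ?case using ht_mono[of "Suc m" _ c b] less_le_trans by blast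
qed

lemma le_K: "k \<le> K n k"
  by (induction k) (auto simp: cut_Suc)

lemma letter_occurs: "\<exists>k>x. W n k = a"
proof -
  obtain m where m: "n \<le> m" "c m = a" using often by blast
  have "\<forall>x. \<exists>k>x. W m k = a"
  proof
    fix x
    have "W m (K m (x + 2) - 1) = a" using before_K[of "x + 2" m] m by simp
    moreover have "x < K m (x + 2) - 1" using le_K[of "x + 2" m] by linarith
    ultimately show "\<exists>k>x. W m k = a" by blast
  qed
  with m(1) have "\<forall>x. \<exists>k>x. W n k = a"
  proof (induction rule: inc_induct)
    case (step n)
    then show ?case using W_K le_K by (metis less_le_trans)
  qed
  then show ?thesis by blast
qed

text \<open>Any two boundaries of a high level agree far to the left by \<open>agree_left\<close>,
  while the next letters are the types of the blocks that follow, here \<open>One\<close> and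
  \<open>Two\<close>.\<close>

lemma right_special:
  assumes "0 < m"
  obtains t t' where "\<And>y. Suc y < m \<Longrightarrow> W 0 (t + y) = W 0 (t' + y)"
    "W 0 (t + (m - 1)) = One" "W 0 (t' + (m - 1)) = Two"
proof -
  obtain N1 where N1: "\<And>n. n \<ge> N1 \<Longrightarrow> int m < H n One" using H_unbounded by blast
  obtain n where n: "N1 \<le> n" "c n = One" using often by blast
  obtain k where k: "0 < k" "W (Suc n) k = One" using letter_occurs by blast
  obtain k' where k': "0 < k'" "W (Suc n) k' = Two" using letter_occurs by blast
  have m: "m - 1 \<le> nat (H n (c n))" using N1[OF n(1)] n(2) by simp
  have le: "m - 1 \<le> V (Suc n) k" "m - 1 \<le> V (Suc n) k'"
  proof -
    show "m - 1 \<le> V (Suc n) k" using agree_left(1)[OF k(1) k(1) _ m] by (cases "m - 1") auto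
    show "m - 1 \<le> V (Suc n) k'" using agree_left(1)[OF k'(1) k'(1) _ m] by (cases "m - 1") auto
  qed
  show thesis
  proof (rule that[of "V (Suc n) k - (m - 1)" "V (Suc n) k' - (m - 1)"])
    fix y assume y: "Suc y < m"
    have "W 0 (V (Suc n) k - (m - 1 - y)) = W 0 (V (Suc n) k' - (m - 1 - y))"
      using y m by (intro agree_left(2)[OF k(1) k'(1)]) auto
    then show "W 0 (V (Suc n) k - (m - 1) + y) = W 0 (V (Suc n) k' - (m - 1) + y)"
      using y le by (simp add: diff_diff_eq2 del: vert.simps)
  qed (use le k k' W0_V[of "Suc n"] in \<open>simp_all del: vert.simps\<close>)
qed

text \<open>While only \<open>a\<close> is used, the length of block \<open>a\<close> does not
  change, and each level up puts one more such block in front of the boundaries.\<close>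

lemma run_block:
  assumes "\<And>r. r < l \<Longrightarrow> c (n + r) = a" "r \<le> l" "r < k"
  shows "\<exists>k'\<ge>r. V n k' = V (n + r) k \<and> (\<forall>x<r. W n (k' - Suc x) = a)"
  using assms(2,3)
proof (induction r arbitrary: k)
  case (Suc r)
  have cr: "c (n + r) = a" using assms(1) Suc by simp
  have k: "0 < K (n + r) k" "W (n + r) (K (n + r) k - 1) = a"
    using before_K[of k "n + r"] Suc cr by auto
  let ?k = "K (n + r) k - 1"
  have "r < ?k" using le_K[of k "n + r"] Suc.prems by linarith
  then obtain k' where k': "r \<le> k'" "V n k' = V (n + r) ?k" "\<And>x. x < r \<Longrightarrow> W n (k' - Suc x) = a"
    using Suc by (metis Suc_leD)
  have Wk': "W n k' = a" using W0_V[of n k'] W0_V[of "n + r" ?k] k' k by simp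
  have "H (n + s) a = H n a" if "s \<le> l" for s
    using that
  proof (induction s)
    case (Suc s) then show ?case using assms(1)[of s] by (simp add: up_def)
  qed simp
  then have Hr: "H (n + r) a = H n a" using Suc.prems by simp
  have "V n (Suc k') = V n k' + nat (H n a)" using V_Suc'[of n k'] Wk' by simp
  also have "\<dots> = V (n + r) (Suc ?k)" using V_Suc'[of "n + r" ?k] k k' Hr by simp
  also have "\<dots> = V (n + Suc r) k" using k by simp
  finally have "V n (Suc k') = V (n + Suc r) k" .
  moreover have "W n (Suc k' - Suc x) = a" if "x < Suc r" for x
    using that Wk' k'(3)[of "x - 1"] by (cases x) (auto simp: Suc_diff_Suc)
  ultimately show ?case using k'(1) by (intro exI[of _ "Suc k'"]) auto
qed auto

end

section \<open>Bounded gaps from linear recurrence\<close>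

locale lr_hierarchy = ar_hierarchy +
  fixes C :: nat
  assumes window: "0 < m \<Longrightarrow> \<exists>x\<ge>t'. x + m \<le> t' + C * m \<and> (\<forall>y<m. W 0 (x + y) = W 0 (t + y))"
begin

text \<open>A long run of \<open>a\<close> produces a long power of a word of some length \<open>m\<close>, hence all factors of length
  \<open>m\<close> would have the same letter counts, which fails for the extensions of a right special word.\<close>

lemma run_bounded: "\<exists>r<C. c (n + r) \<noteq> a"
proof (rule ccontr)
  assume "\<not> ?thesis"
  then have run: "\<And>r. r < C \<Longrightarrow> c (n + r) = a" by blast
  obtain k where k: "C \<le> k" "\<And>x. x < C \<Longrightarrow> W n (k - Suc x) = a"
    using run_block[OF run, of C C "Suc C"] by auto
  define m t' where "m = nat (H n a)" and "t' = V n (k - C)"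
  have m: "0 < m" using ht_pos[of c n a] by (simp add: m_def)
  have a: "W n (k - C + x) = a" if "x < C" for x
    using k(2)[of "C - Suc x"] that k(1) by (simp add: Suc_diff_Suc)
  have V: "V n (k - C + x) = t' + x * m" if "x \<le> C" for x
    using that
  proof (induction x)
    case (Suc x)
    then show ?case using V_Suc'[of n "k - C + x"] a[of x] by (simp add: m_def)
  qed (simp add: t'_def)
  have per: "W 0 (t' + z) = W 0 (t' + z mod m)" if "z < C * m" for z
  proof -
    have d: "z div m < C" using that m by (simp add: less_mult_imp_div_less)
    have "W 0 (V n (k - C + z div m) + z mod m) = W 0 (V n (k - C + 0) + z mod m)"
      using a[OF d] a[of 0] d m by (intro block_eq) (auto simp: m_def)
    then show ?thesis using V[of "z div m"] V[of 0] d by (simp add: add.assoc)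
  qed
  \<comment> \<open>The power has length \<open>C * m\<close>, so every factor of length
    \<open>m\<close> occurs in it.\<close>
  have count: "(\<Sum>y<m. of_bool (W 0 (t + y) = b)) = (\<Sum>y<m. of_bool (W 0 (t' + y) = b) :: nat)" for t b
  proof -
    obtain x where x: "t' \<le> x" "x + m \<le> t' + C * m" "\<And>y. y < m \<Longrightarrow> W 0 (x + y) = W 0 (t + y)"
      using window[OF m, of t' t] by auto
    have "W 0 (t + y) = W 0 (t' + (x - t' + y) mod m)" if "y < m" for y
      using x(3)[OF that] per[of "x - t' + y"] x that by simp
    then have "(\<Sum>y<m. of_bool (W 0 (t + y) = b)) =
      (\<Sum>y<m. of_bool (W 0 (t' + (x - t' + y) mod m) = b) :: nat)" by simp
    also have "\<dots> = (\<Sum>y<m. of_bool (W 0 (t' + y) = b))"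
      by (rule sum_mod_shift[of "\<lambda>y. of_bool (W 0 (t' + y) = b)"])
    finally show ?thesis .
  qed
  obtain s s' where s: "\<And>y. Suc y < m \<Longrightarrow> W 0 (s + y) = W 0 (s' + y)"
    "W 0 (s + (m - 1)) = One" "W 0 (s' + (m - 1)) = Two"
    using right_special[OF m] by blast
  obtain m' where m': "m = Suc m'" using m by (cases m) auto
  have "(\<Sum>y<m'. of_bool (W 0 (s + y) = One)) = (\<Sum>y<m'. of_bool (W 0 (s' + y) = One) :: nat)"
    using s(1) m' by (intro sum.cong) auto
  then show False using count[of s One] count[of s' One] s(2,3) unfolding m' by simp
qed

text \<open>Subdividing a block brings in only its own type and the letters used on the way, none of
  which is \<open>z\<close>.\<close>

lemma letter_absent_in_block:
  assumes "\<And>r. r < l \<Longrightarrow> c (n + r) \<noteq> z" "r \<le> l"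
    "W (n + r) k \<noteq> z" "V (n + r) k \<le> V n q" "V n q < V (n + r) (Suc k)"
  shows "W n q \<noteq> z"
  using assms(2-)
proof (induction r arbitrary: k)
  case 0
  then have "q = k" using V_le_iff[of n k q] V_less_iff[of n q "Suc k"] by simp
  then show ?case using 0 by simp
next
  case (Suc r)
  have "V (Suc (n + r)) k \<le> V n q" "V n q < V (Suc (n + r)) (Suc k)" using Suc by auto
  then consider "V (n + r) (K (n + r) k) \<le> V n q" "V n q < V (n + r) (Suc (K (n + r) k))" |
    "W (Suc (n + r)) k \<noteq> c (n + r)" "V (n + r) (Suc (K (n + r) k)) \<le> V n q"
    "V n q < V (n + r) (Suc (Suc (K (n + r) k)))"
    using refine_index by blast
  then show ?case
  proof cases
    case 1
    show ?thesis by (rule Suc.IH[OF _ _ 1]) (use Suc.prems W_K[of "n + r" k] in auto)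
  next
    case 2
    show ?thesis
      by (rule Suc.IH[OF _ _ 2(2,3)]) (use Suc.prems 2(1) W_Suc_K[of "n + r" k] assms(1)[of r] in auto)
  qed
qed

text \<open>If \<open>z\<close> is not used for a long time, then a block without \<open>z\<close> becomes much longer than the pattern
  by which a block of type \<open>z\<close> is recognized.\<close>

lemma gap_after_use:
  assumes "c n = z"
  shows "\<exists>m. n < m \<and> m \<le> n + 4 * C \<and> c m = z"
proof (rule ccontr)
  assume "\<not> ?thesis"
  then have no: "\<not> (\<exists>m. n < m \<and> m \<le> n + 4 * C \<and> c m = z)" .
  let ?n = "Suc n"
  have absent: "c (?n + r) \<noteq> z" if "r < 4 * C" for r
  proof
    assume "c (Suc n + r) = z"
    then have "n < Suc n + r \<and> Suc n + r \<le> n + 4 * C \<and> c (Suc n + r) = z" using that by simp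
    then show False using no by blast
  qed
  obtain a b where ab: "z \<noteq> a" "z \<noteq> b" "a \<noteq> b" and ex: "\<And>x. x = z \<or> x = a \<or> x = b"
    using two_other_letters by blast
  define P where "P = max (H ?n a) (H ?n b)"
  have zP: "H ?n z \<le> P" using assms ab ht_pos[of c n a] by (auto simp: P_def up_def)
  have P0: "1 \<le> P" using ht_pos[of c ?n a] by (simp add: P_def le_max_iff_disj)
  have used: "\<exists>r<C. c (?n + r) = x" if "x \<noteq> z" for x
  proof -
    have zx: "z \<noteq> x" using that by blast
    obtain y where y: "z \<noteq> y" "x \<noteq> y" "\<And>u. u = z \<or> u = x \<or> u = y"
      using third_letter[OF zx] by blast
    obtain r where r: "r < C" "c (?n + r) \<noteq> y" using run_bounded by blast
    then show ?thesis using absent[of r] y(3)[of "c (?n + r)"] by auto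
  qed
  obtain x where x: "x \<noteq> z" "H ?n x = P" using ab unfolding P_def by (metis max_def)
  obtain r where r: "r < C" "c (?n + r) = x" using used x by blast
  have big: "P \<le> H (?n + C) y" if "y \<noteq> z" for y
  proof -
    have "P \<le> H (?n + r) x" using x ht_mono[of ?n "?n + r" c x] by simp
    also have "\<dots> \<le> H (Suc (?n + r)) y" using r ht_pos[of c "?n + r" y] by (simp add: up_def)
    also have "\<dots> \<le> H (?n + C) y" using r by (intro ht_mono) simp
    finally show ?thesis .
  qed
  have big': "P \<le> H (?n + (C + s)) y" if "y \<noteq> z" for y s
    using big[OF that] ht_mono[of "?n + C" "?n + (C + s)" c y] by simp
  \<comment> \<open>After \<open>C\<close> steps both lengths are at least \<open>P\<close>, and
    each of the next \<open>3 * C\<close> steps adds at least \<open>P\<close> to their sum. The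
    factor 3 is that of \<open>2 * (g ?n + 1) \<le> 3 * P\<close> below, so the longer of the two
    blocks reaches \<open>C\<close> times the pattern length.\<close>
  have sum: "P * (2 + int s) \<le> H (?n + (C + s)) a + H (?n + (C + s)) b" if "s \<le> 3 * C" for s
    using that
  proof (induction s)
    case 0 then show ?case using big[of a] big[of b] ab by simp
  next
    case (Suc s)
    define m where "m = ?n + (C + s)"
    have "c m \<noteq> z" using Suc absent[of "C + s"] by (simp add: m_def)
    then have "c m = a \<or> c m = b" using ex by blast
    moreover have "P \<le> H m a" "P \<le> H m b" unfolding m_def using big'[of a s] big'[of b s] ab by simp_all
    ultimately have "H m a + H m b + P \<le> H (Suc m) a + H (Suc m) b"
      using ab(3) unfolding ht_Suc by auto
    moreover have "P * (2 + int s) \<le> H m a + H m b" unfolding m_def using Suc by simp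
    moreover have "?n + (C + Suc s) = Suc m" by (simp add: m_def)
    ultimately show ?case by (simp add: algebra_simps del: row.simps)
  qed
  from sum[of "3 * C"] have Pge: "P * (2 + 3 * int C) \<le> H (?n + 4 * C) a + H (?n + 4 * C) b"
    by simp
  obtain u where u: "u \<noteq> z" "H (?n + 4 * C) a + H (?n + 4 * C) b \<le> 2 * H (?n + 4 * C) u"
  proof (cases "H (?n + 4 * C) b \<le> H (?n + 4 * C) a")
    case True show ?thesis by (rule that[OF ab(1)[symmetric]]) (use True in linarith)
  next
    case False show ?thesis by (rule that[OF ab(2)[symmetric]]) (use False in linarith)
  qed
  have uge: "P * (2 + 3 * int C) \<le> 2 * H (?n + 4 * C) u" using Pge u(2) by linarith
  have "vsum (H ?n) = H ?n z + H ?n a + H ?n b" using vsum_distinct ab by metis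
  then have "2 * (int (g ?n) + 1) \<le> 3 * P" using vsum_H[of ?n] zP by (simp add: P_def)
  then have "int C * (2 * (int (g ?n) + 1)) \<le> int C * (3 * P)" by (intro mult_left_mono) auto
  then have "2 * (int C * (int (g ?n) + 1)) \<le> 2 * H (?n + 4 * C) u"
    using uge P0 by (simp add: algebra_simps)
  then have "int (C * Suc (g ?n)) \<le> H (?n + 4 * C) u" by (simp add: algebra_simps del: row.simps)
  then have m: "C * Suc (g ?n) \<le> nat (H (?n + 4 * C) u)" by linarith
  obtain q where q: "?n < q" "W ?n q = z" using letter_occurs by blast
  note pat = pattern_before[OF q(1)]
  obtain k where k: "W (?n + 4 * C) k = u" using letter_occurs by blast
  let ?t = "V (?n + 4 * C) k"
  \<comment> \<open>The pattern of a boundary followed by \<open>z\<close> has length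
    \<open>Suc (g ?n)\<close>, so linear recurrence finds it inside the long block
    \<open>u\<close>.\<close>
  obtain x where x: "?t \<le> x" "x + Suc (g ?n) \<le> ?t + C * Suc (g ?n)"
    "\<And>y. y < Suc (g ?n) \<Longrightarrow> W 0 (x + y) = W 0 (V ?n q - g ?n + y)"
    using window[of "Suc (g ?n)" ?t "V ?n q - g ?n"] by auto
  have "W 0 (x + g i) = c i" if "i < ?n" for i
    using x(3)[of "g i"] g_less[OF that] that pat by auto
  then obtain q' where q': "V ?n q' = x + g ?n" using recognize[of ?n x] by blast
  have "W ?n q' = z" using W0_V[of ?n q'] q' x(3)[of "g ?n"] pat W0_V[of ?n q] q(2) by simp
  moreover have "W ?n q' \<noteq> z"
  proof (rule letter_absent_in_block[of "4 * C" ?n z "4 * C" k])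
    show "V (?n + 4 * C) k \<le> V ?n q'" using q' x by linarith
    show "V ?n q' < V (?n + 4 * C) (Suc k)"
      using q' x(1,2) m V_Suc'[of "?n + 4 * C" k, unfolded k] by linarith
  qed (use absent k u in auto)
  ultimately show False by blast
qed

text \<open>The summand \<open>N\<close> covers the stretches before the first use of each letter,
  about which \<open>gap_after_use\<close> says nothing.\<close>

lemma bounded_gaps: "\<exists>L. gapped c W L"
proof -
  have "\<exists>n. c n = a" for a using often[of 0] by auto
  then obtain p where p: "\<And>a. c (p a) = a" by metis
  define N where "N = Max (range p)"
  have N: "p a \<le> N" for a unfolding N_def by (rule Max_ge) auto
  let ?L = "Suc N + Suc (4 * C)"
  have "\<exists>m\<in>{n..<n + ?L}. c m = a" for n a
  proof (cases "\<exists>m<n. c m = a")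
    case True
    let ?S = "{m. m < n \<and> c m = a}"
    have S: "finite ?S" "?S \<noteq> {}" using True by auto
    define m where "m = Max ?S"
    have m: "m < n" "c m = a" using Max_in[OF S] by (auto simp: m_def)
    obtain m' where m': "m < m'" "m' \<le> m + 4 * C" "c m' = a" using gap_after_use[OF m(2)] by blast
    have "n \<le> m'"
    proof (rule ccontr)
      assume "\<not> n \<le> m'"
      then have "m' \<le> m" using m' S unfolding m_def by (intro Max_ge) auto
      then show False using m' by simp
    qed
    then show ?thesis using m m' by (intro bexI[of _ m']) auto
  next
    case False
    then have "n \<le> p a" using p by (metis not_le)
    then show ?thesis using N[of a] p[of a] by (intro bexI[of _ "p a"]) auto
  qed
  then show ?thesis by (intro exI[of _ ?L]) (simp add: gapped_def gapped_axioms_def hierarchy_axioms)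
qed

end

section \<open>Coincidences\<close>

text \<open>Closeness of the phases \<open>t * f\<close> and \<open>t' * f\<close> on the
  three-dimensional torus.\<close>

definition rot_near :: "(letter \<Rightarrow> real) \<Rightarrow> real \<Rightarrow> nat \<Rightarrow> nat \<Rightarrow> bool" where
  "rot_near f e t t' \<longleftrightarrow> (\<forall>a. \<exists>d::int. \<bar>d - (real t' - real t) * f a\<bar> \<le> e)"

text \<open>The inverse incidence matrix, integral by unimodularity; thus \<open>pull\<close>
  preserves integer vectors.\<close>

definition Minv :: "letter \<Rightarrow> (letter \<Rightarrow> 'a::comm_ring_1) \<Rightarrow> letter \<Rightarrow> 'a" where
  "Minv a y = y(a := 2 * y a - vsum y)"

lemma Mact_Minv: "Mact a (Minv a y) = y" and Minv_Mact: "Minv a (Mact a y) = y"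
  by (cases a, simp_all add: Mact_def Minv_def vsum_def fun_eq_iff algebra_simps)+

primrec pull :: "(nat \<Rightarrow> letter) \<Rightarrow> (letter \<Rightarrow> 'a::comm_ring_1) \<Rightarrow> nat \<Rightarrow> letter \<Rightarrow> 'a" where
  "pull c y 0 = y"
| "pull c y (Suc n) = Minv (c n) (pull c y n)"

lemma dot_row_pull: "dot (row c u n) (pull c y n) = dot u y"
  by (induction n) (simp_all add: dot_up Mact_Minv)

lemma pull_add: "pull c (\<lambda>b. x b + y b) n = (\<lambda>b. pull c x n b + pull c y n b)"
  by (induction n) (auto simp: Minv_def vsum_def fun_eq_iff algebra_simps)

lemma pull_scale: "pull c (\<lambda>b. r * y b) n = (\<lambda>b. r * pull c y n b)"
  by (induction n) (auto simp: Minv_def vsum_def fun_eq_iff algebra_simps)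

lemma of_int_pull: "of_int (pull c y n b) = pull c (\<lambda>b. of_int (y b)) n b"
proof (induction n arbitrary: b)
  case (Suc n)
  show ?case by (simp add: Minv_def vsum_def Suc)
qed simp

lemma ex_pull: "\<exists>z. pull c z n = y"
proof (induction n arbitrary: y)
  case (Suc n)
  then obtain z where "pull c z n = Mact (c n) y" by blast
  then show ?case by (intro exI[of _ z]) (simp add: Minv_Mact)
qed simp

lemma pull_bound:
  fixes y :: "letter \<Rightarrow> real"
  assumes "\<And>b. \<bar>y b\<bar> \<le> e"
  shows "\<bar>pull c y n b\<bar> \<le> 3 ^ n * e"
proof (induction n arbitrary: b)
  case (Suc n)
  have "0 \<le> 3 ^ n * e" using Suc[of One] by linarith
  then show ?case using Suc[of One] Suc[of Two] Suc[of Three]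
    by (cases "c n") (cases b, auto simp: Minv_def vsum_def)+
qed (use assms in simp)

text \<open>Projection along \<open>f\<close>, onto the vectors of sum 0 if
  \<open>vsum f = 1\<close>.\<close>

definition proj :: "(letter \<Rightarrow> real) \<Rightarrow> (letter \<Rightarrow> real) \<Rightarrow> letter \<Rightarrow> real" where
  "proj f y b = y b - f b * vsum y"

lemma proj_add: "proj f (\<lambda>b. x b + y b) b = proj f x b + proj f y b"
  and proj_diff: "proj f (\<lambda>b. x b - y b) b = proj f x b - proj f y b"
  and proj_scale: "proj f (\<lambda>b. r * y b) b = r * proj f y b"
  by (simp_all add: proj_def vsum_def algebra_simps)

section \<open>Offsets between positions of nearly equal phase\<close>

context gapped
begin

abbreviation fr :: "nat \<Rightarrow> letter \<Rightarrow> real" where "fr n \<equiv> freq (\<lambda>m. c (n + m))"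

text \<open>The inverse matrices map the frequency line of level 0 to that of level
  \<open>n\<close>: by \<open>dot_dev_freq\<close> a preimage of \<open>fr n\<close> is annihilated
  by all \<open>dev c a 0\<close>, hence is a multiple of \<open>freq c\<close>.\<close>

lemma proj_pull_freq: "proj (fr n) (pull c (freq c) n) b = 0"
proof -
  interpret s: gapped "\<lambda>m. c (n + m)" "\<lambda>m. W (n + m)" L by (rule shift_gapped)
  obtain z where z: "pull c z n = fr n" using ex_pull by blast
  have "z a = freq c a * vsum z" for a
  proof -
    have "dot (dev c a 0) z = 0"
      using dot_dev_freq[of a n] dot_row_pull[of c "dev c a 0" n z] z by (simp add: dev_def)
    then show ?thesis by (simp add: dot_dev_0)
  qed
  then have "z = (\<lambda>a. vsum z * freq c a)" by (auto simp: mult.commute)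
  then have "fr n = (\<lambda>a. vsum z * pull c (freq c) n a)" using z pull_scale by metis
  then have e: "fr n a = vsum z * pull c (freq c) n a" for a by (rule fun_cong)
  then have "1 = vsum z * vsum (pull c (freq c) n)"
    using s.freq_sum unfolding vsum_def by (simp add: algebra_simps)
  then show ?thesis using e[of b] unfolding proj_def by (simp add: algebra_simps)
qed

text \<open>Two prefixes deviate by at most \<open>bal\<close> each, the pulled vector by at most 1.
  The second summand of \<open>start_max\<close> bounds the component along the frequencies.\<close>

definition proj_bound :: real where "proj_bound = 2 * bal + 1"
definition start_max :: nat where "start_max = nat \<lceil>proj_bound + 4 ^ L * (1 + 3 * proj_bound)\<rceil>"

lemma proj_bound_pos: "0 < proj_bound" using bal_pos by (simp add: proj_bound_def)

text \<open>Across the frequency direction the offset is bounded by balance, along it by the length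
  of the surrounding block. An upper bound is all that the potential needs.\<close>

lemma start_bound:
  fixes d :: "letter \<Rightarrow> int" and k k' :: nat
  assumes d: "\<And>a. \<bar>d a - vsum d * freq c a\<bar> \<le> e" and e: "4 * (3 ^ n * e) \<le> 1"
  defines "y \<equiv> \<lambda>b. cnt (W n) k b - cnt (W n) k' b + pull c d n b"
  assumes h: "dot (H n) y < H n j"
  shows "y b \<le> int start_max"
proof -
  interpret s: gapped "\<lambda>m. c (n + m)" "\<lambda>m. W (n + m)" L by (rule shift_gapped)
  let ?f = "fr n"
  define s where "s = real_of_int (vsum d)"
  define x where "x = (\<lambda>a. real_of_int (d a) - s * freq c a)"
  define Y where "Y = (\<lambda>b. real_of_int (y b))"
  have Y: "Y = (\<lambda>b. (cnt (W n) k b - cnt (W n) k' b) + (pull c x n b + s * pull c (freq c) n b))"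
  proof -
    have "(\<lambda>a. real_of_int (d a)) = (\<lambda>a. x a + s * freq c a)" by (simp add: x_def)
    then have "real_of_int (pull c d n b) = pull c x n b + s * pull c (freq c) n b" for b
      unfolding of_int_pull by (simp add: pull_add pull_scale)
    then show ?thesis by (simp add: Y_def y_def of_int_cnt fun_eq_iff)
  qed
  have cn: "\<bar>proj ?f (cnt (W n) l) b\<bar> \<le> bal" for l b
    using s.balance[of l b] unfolding proj_def vsum_cnt by simp
  have bx: "\<bar>pull c x n b\<bar> \<le> 3 ^ n * e" for b
    by (rule pull_bound) (use d in \<open>simp add: x_def s_def\<close>)
  have px: "\<bar>proj ?f (pull c x n) b\<bar> \<le> 1" for b
  proof -
    have "\<bar>vsum (pull c x n)\<bar> \<le> 3 * (3 ^ n * e)"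
      using bx[of One] bx[of Two] bx[of Three] unfolding vsum_def by linarith
    then have "\<bar>?f b * vsum (pull c x n)\<bar> \<le> 1 * (3 * (3 ^ n * e))"
      using freq_bounds[of "\<lambda>m. c (n + m)" b] unfolding abs_mult by (intro mult_mono) auto
    then show ?thesis using bx[of b] e unfolding proj_def by linarith
  qed
  have pY: "\<bar>proj ?f Y b\<bar> \<le> proj_bound" for b
    using cn[of k b] cn[of k' b] px[of b]
    unfolding Y proj_add proj_diff proj_scale proj_pull_freq proj_bound_def by linarith
  let ?h = "\<lambda>b. real_of_int (H n b)"
  define h0 where "h0 = ?h One"
  have h0: "0 < h0" using ht_pos[of c n One] by (simp add: h0_def)
  have ratio: "?h a \<le> 2 ^ L * ?h b" for a b
  proof -
    have "?h a \<le> real_of_int (2 ^ L * H n b)" using H_ratio[of n a b] by (simp only: of_int_le_iff)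
    then show ?thesis by simp
  qed
  have hup: "?h b \<le> 2 ^ L * h0" and hlo: "h0 \<le> 2 ^ L * ?h b" for b
    unfolding h0_def by (rule ratio)+
  have hpos: "0 < ?h b" for b using ht_pos[of c n b] by simp
  define v where "v = vsum Y"
  have Yb: "Y b = proj ?f Y b + v * ?f b" for b by (simp add: proj_def v_def)
  have dY: "dot ?h Y < 2 ^ L * h0"
  proof -
    have "dot ?h Y = real_of_int (dot (H n) y)" by (simp add: dot_def Y_def)
    also have "\<dots> < ?h j" using h by simp
    finally show ?thesis using hup[of j] by linarith
  qed
  have dp: "\<bar>dot ?h (proj ?f Y)\<bar> \<le> 3 * (2 ^ L * h0 * proj_bound)"
  proof -
    have "\<bar>?h b * proj ?f Y b\<bar> \<le> 2 ^ L * h0 * proj_bound" for b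
      unfolding abs_mult using hup[of b] pY[of b] hpos[of b] h0 by (intro mult_mono) auto
    from this[of One] this[of Two] this[of Three] show ?thesis unfolding dot_def by linarith
  qed
  have df: "h0 \<le> 2 ^ L * dot ?h ?f"
  proof -
    have "h0 * ?f b \<le> 2 ^ L * ?h b * ?f b" for b
      using hlo freq_bounds by (intro mult_right_mono) auto
    from this[of One] this[of Two] this[of Three]
    have "h0 * vsum ?f \<le> 2 ^ L * dot ?h ?f" unfolding dot_def vsum_def by (simp add: algebra_simps)
    then show ?thesis by (simp add: s.freq_sum)
  qed
  \<comment> \<open>A larger component along the frequencies would outweigh the projection and push
    \<open>dot ?h Y\<close> beyond every block length. The base 4 collects two factors
    \<open>2 ^ L\<close> from comparing blocks.\<close>
  have "v \<le> 4 ^ L * (1 + 3 * proj_bound)"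
  proof (rule ccontr)
    assume "\<not> ?thesis"
    then have v: "4 ^ L * (1 + 3 * proj_bound) < v" by simp
    moreover have "0 < (4::real) ^ L * (1 + 3 * proj_bound)" using proj_bound_pos by simp
    ultimately have v0: "0 < v" by linarith
    have "Y = (\<lambda>b. proj ?f Y b + v * ?f b)" using Yb by auto
    then have "dot ?h Y = dot ?h (proj ?f Y) + v * dot ?h ?f"
      using dot_add[of ?h "proj ?f Y" "\<lambda>b. v * ?f b"] dot_scale[of ?h v ?f] by simp
    then have "v * dot ?h ?f \<le> 2 ^ L * h0 * (1 + 3 * proj_bound)" using dY dp by (simp add: algebra_simps)
    then have "2 ^ L * (v * dot ?h ?f) \<le> 2 ^ L * (2 ^ L * h0 * (1 + 3 * proj_bound))" by simp
    moreover have "v * h0 \<le> v * (2 ^ L * dot ?h ?f)" using df v0 by simp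
    ultimately have "v * h0 \<le> 4 ^ L * (1 + 3 * proj_bound) * h0"
      by (simp add: algebra_simps power_mult_distrib[symmetric] flip: power_add)
    then show False using v h0 by simp
  qed
  then have "v * ?f b \<le> 4 ^ L * (1 + 3 * proj_bound)"
  proof (cases "0 \<le> v")
    case True
    then have "v * ?f b \<le> v * 1" using freq_bounds by (intro mult_left_mono) auto
    then show ?thesis using \<open>v \<le> _\<close> by simp
  next
    case False
    then have "v * ?f b \<le> 0" using freq_bounds[of "\<lambda>m. c (n + m)" b] by (simp add: mult_nonpos_nonneg)
    moreover have "0 < (4::real) ^ L * (1 + 3 * proj_bound)" using proj_bound_pos by simp
    ultimately show ?thesis by linarith
  qed
  then have "Y b \<le> proj_bound + 4 ^ L * (1 + 3 * proj_bound)" using Yb[of b] pY[of b] by linarith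
  then show ?thesis unfolding start_max_def Y_def by linarith
qed

lemma V_lower: "m \<le> n \<Longrightarrow> \<exists>k'. V m k' = V n k"
proof (induction arbitrary: k rule: dec_induct)
  case (step n)
  then show ?case by simp
qed auto

definition settle_time :: nat where "settle_time = 2 * L * (3 * start_max + 4) + L"

text \<open>Adding \<open>vsum d\<close> to the boundary \<open>V n k\<close> gives a position
  \<open>t\<close> that need not be a boundary of level \<open>n\<close>. Its offset from the right
  end of the block around it is followed downwards; once it is settled, \<open>t\<close> is a
  boundary.\<close>

lemma descend:
  fixes d :: "letter \<Rightarrow> int"
  assumes d: "\<And>a. \<bar>d a - vsum d * freq c a\<bar> \<le> e" and e: "4 * (3 ^ n * e) \<le> 1"
    and n: "settle_time \<le> n" and pos: "0 \<le> int (V n k) + vsum d"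
  shows "\<exists>l. int (V (n - settle_time) l) = int (V n k) + vsum d"
proof -
  define t where "t = nat (int (V n k) + vsum d)"
  have t: "int t = int (V n k) + vsum d" using pos by (simp add: t_def)
  have "\<exists>x. V m x = V n k" if "m \<le> n" for m using V_lower[OF that] .
  then obtain kx where kx: "\<And>m. m \<le> n \<Longrightarrow> V m (kx m) = V n k" by metis
  have "\<exists>x. V m x \<le> t \<and> t < V m (Suc x)" for m using ex_index[of m t] by blast
  then obtain ky where ky: "\<And>m. V m (ky m) \<le> t" "\<And>m. t < V m (Suc (ky m))" by metis
  \<comment> \<open>With \<open>d\<close> in the role of the count from \<open>V n k\<close> to
    \<open>t\<close>, this is the count on level \<open>m\<close> from the left end of the block
    around \<open>t\<close> to \<open>t\<close>; \<open>q m\<close> refers to the right end.\<close>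
  define y where "y m = (\<lambda>b. cnt (W m) (kx m) b - cnt (W m) (ky m) b + pull c d m b)" for m
  define j where "j m = W m (ky m)" for m
  define q where "q m = (\<lambda>b. y m b - unit (j m) b)" for m
  have doty: "dot (H m) (y m) = int t - int (V m (ky m))" if "m \<le> n" for m
    unfolding y_def dot_add dot_diff dot_H_cnt dot_row_pull dot_one using t kx[OF that] by simp
  have kxK: "kx m = K m (kx (Suc m))" if "m < n" for m
    using kx[of m] kx[of "Suc m"] that V_le_iff[of m "kx m" "K m (kx (Suc m))"]
      V_le_iff[of m "K m (kx (Suc m))" "kx m"] by simp
  have pull: "pull c d m = Mact (c m) (pull c d (Suc m))" for m by (simp add: Mact_Minv)
  have kyK: "ky m = K m (ky (Suc m)) \<or> W (Suc m) (ky (Suc m)) \<noteq> c m \<and> ky m = Suc (K m (ky (Suc m)))" for m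
  proof -
    have u: "ky m = x" if "V m x \<le> t" "t < V m (Suc x)" for x
    proof -
      have "V m x < V m (Suc (ky m))" "V m (ky m) < V m (Suc x)"
        using that ky[of m] by linarith+
      then show ?thesis by (simp add: V_less_iff)
    qed
    show ?thesis using refine_index[OF ky(1)[of "Suc m"] ky(2)[of "Suc m"]] u by blast
  qed
  have step: "q m = (q (Suc m))(c m := vsum (q (Suc m)) + 1) \<and> j m = j (Suc m) \<and> j (Suc m) \<noteq> c m \<or>
      q m = (q (Suc m))(c m := vsum (q (Suc m))) \<and> j m = c m" if m: "m < n" for m
  proof -
    let ?y = "y (Suc m)" and ?q = "q (Suc m)" and ?j = "j (Suc m)"
    have My: "Mact (c m) ?y = (\<lambda>b. cnt (W m) (kx m) b - cnt (W m) (K m (ky (Suc m))) b + pull c d m b)"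
      unfolding y_def Mact_add Mact_diff kxK[OF m] cnt_K by (subst (3) pull) (rule refl)
    have "?y = (\<lambda>b. ?q b + unit ?j b)" by (simp add: q_def)
    then have Mq: "Mact (c m) ?y = (\<lambda>b. Mact (c m) ?q b + Mact (c m) (unit ?j) b)"
      by (metis Mact_add)
    show ?thesis
    proof (cases "ky m = K m (ky (Suc m))")
      case True
      then have jm: "j m = ?j" using W_K by (simp add: j_def)
      have "y m = Mact (c m) ?y" unfolding My unfolding y_def True ..
      then have "q m = (\<lambda>b. Mact (c m) ?q b + Mact (c m) (unit ?j) b - unit ?j b)"
        by (simp add: q_def jm Mq)
      then show ?thesis using jm by (auto simp: Mact_unit Mact_def[of _ ?q] unit_def fun_eq_iff)
    next
      case False
      then have k: "?j \<noteq> c m" "ky m = Suc (K m (ky (Suc m)))" using kyK by (auto simp: j_def)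
      then have jm: "j m = c m" using W_Suc_K by (simp add: j_def)
      have "W m (K m (ky (Suc m))) = ?j" using W_K by (simp add: j_def)
      then have "y m = (\<lambda>b. Mact (c m) ?y b - unit ?j b)"
        unfolding My unfolding y_def k(2) cnt_Suc by (simp add: fun_eq_iff)
      then have "q m = (\<lambda>b. Mact (c m) ?q b + Mact (c m) (unit ?j) b - unit ?j b - unit (c m) b)"
        by (simp add: q_def jm Mq)
      then show ?thesis using jm k by (auto simp: Mact_unit Mact_def[of _ ?q] fun_eq_iff)
    qed
  qed
  \<comment> \<open>Time runs against the level: step \<open>s\<close> is taken on level
    \<open>n - s\<close>.\<close>
  interpret C: collapse "\<lambda>s. q (n - s)" "\<lambda>s. j (n - s)" "\<lambda>s. c (n - Suc s)" "\<lambda>s. H (n - s)" settle_time L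
  proof
    show "0 < H (n - s) b" for s b using ht_pos[of c "n - s" b] by linarith
    show "dot (H (n - s)) (q (n - s)) < 0" for s
      using doty[of "n - s"] ky(2)[of "n - s"] V_Suc[of "n - s" "ky (n - s)"]
      unfolding q_def dot_diff dot_unit j_def by simp
    show "0 \<le> dot (H (n - s)) (q (n - s)) + H (n - s) (j (n - s))" for s
      using doty[of "n - s"] ky(1)[of "n - s"] unfolding q_def dot_diff dot_unit by simp
    show "q (n - Suc s) = (q (n - s))(c (n - Suc s) := vsum (q (n - s)) + 1) \<and>
        j (n - Suc s) = j (n - s) \<and> j (n - s) \<noteq> c (n - Suc s) \<or>
        q (n - Suc s) = (q (n - s))(c (n - Suc s) := vsum (q (n - s))) \<and> j (n - Suc s) = c (n - Suc s)"
      if "s < settle_time" for s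
      using step[of "n - Suc s"] that n by (simp add: Suc_diff_Suc)
    fix s a assume s: "s + L \<le> settle_time"
    obtain m where m: "n - s - L \<le> m" "m < n - s - L + L" "c m = a" using gap[of "n - s - L" a] by auto
    then show "\<exists>m\<in>{s..<s + L}. c (n - Suc m) = a"
      using s n by (intro bexI[of _ "n - Suc m"]) auto
  qed
  have "C.settled settle_time"
  proof (rule C.collapse)
    fix b
    have "dot (H n) (y n) < H n (j n)"
      using doty[of n] ky(2)[of n] V_Suc[of n "ky n"] by (simp add: j_def)
    then have "y n b \<le> int start_max" unfolding y_def by (intro start_bound[OF d e]) 
    moreover have "q n b \<le> y n b" by (simp add: q_def unit_def)
    ultimately show "q (n - 0) b \<le> int start_max" by simp
  qed (simp add: settle_time_def)
  then have "q (n - settle_time) = (\<lambda>b. if b = j (n - settle_time) then -1 else 0)" by (simp add: C.settled_def)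
  then have "y (n - settle_time) b - unit (j (n - settle_time)) b = (if b = j (n - settle_time) then - 1 else 0)" for b
    by (simp add: q_def fun_eq_iff)
  then have "y (n - settle_time) b = 0" for b by (smt (verit) unit_def of_bool_eq)
  then have "y (n - settle_time) = (\<lambda>_. 0)" by blast
  then have "int (V (n - settle_time) (ky (n - settle_time))) = int t" using doty[of "n - settle_time"] by (simp add: dot_def)
  then show ?thesis using t by auto
qed

text \<open>The position lies in the block to the left of a boundary of level \<open>n\<close> on
  which all boundaries agree after the collapse: \<open>settle_time\<close> levels are lost to
  \<open>descend\<close>, one more to \<open>agree_left\<close>.\<close>

definition good :: "nat \<Rightarrow> nat \<Rightarrow> bool" where
  "good n t \<longleftrightarrow> (\<exists>k>0. t < V n k \<and> V n k \<le> t + nat (H (n - Suc settle_time) (c (n - Suc settle_time))))"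

text \<open>By \<open>descend\<close>, the boundary to the right of \<open>t\<close> has a
  counterpart at the same distance from \<open>t'\<close>, and the letters to the left of both
  agree.\<close>

lemma coincidence:
  assumes n: "settle_time < n" and g: "good n t" and e: "4 * (3 ^ n * e) \<le> 1"
    and near: "rot_near (freq c) e t t'"
  shows "W 0 t = W 0 t'"
proof -
  obtain d :: "letter \<Rightarrow> int" where d: "\<And>a. \<bar>d a - (real t' - real t) * freq c a\<bar> \<le> e"
    using near unfolding rot_near_def by metis
  have "e \<le> 1 / 4"
  proof -
    have "1 * e \<le> 3 ^ n * e" if "0 \<le> e" using that by (intro mult_right_mono) auto
    then show ?thesis using e by (cases "0 \<le> e") auto
  qed
  moreover have "real_of_int (vsum d) - (real t' - real t) =
      vsum (\<lambda>a. real_of_int (d a) - (real t' - real t) * freq c a)"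
  proof -
    have "(real t' - real t) * vsum (freq c) = real t' - real t" by (simp add: freq_sum)
    then show ?thesis unfolding vsum_def distrib_left by simp
  qed
  \<comment> \<open>The error is at most \<open>3 * e \<le> 3 / 4\<close>, so the two integers
    coincide.\<close>
  ultimately have "\<bar>real_of_int (vsum d) - (real t' - real t)\<bar> < 1"
    using d[of One] d[of Two] d[of Three] unfolding vsum_def by linarith
  then have s: "vsum d = int t' - int t" by linarith
  have d': "\<bar>d a - vsum d * freq c a\<bar> \<le> e" for a using d[of a] s by simp
  obtain k where k: "0 < k" "t < V n k" "V n k \<le> t + nat (H (n - Suc settle_time) (c (n - Suc settle_time)))"
    using g unfolding good_def by blast
  define m where "m = n - Suc settle_time"
  have m: "Suc m = n - settle_time" "Suc m \<le> n" using n by (auto simp: m_def)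
  define x where "x = V n k - t"
  obtain l where "int (V (n - settle_time) l) = int (V n k) + vsum d"
    using descend[OF d' e] n k s by fastforce
  then have l: "V (Suc m) l = t' + x" using m s k by (simp add: x_def del: vert.simps)
  obtain k1 where k1: "V (Suc m) k1 = V n k" using V_lower[OF m(2)] by blast
  have "0 < V (Suc m) l" "0 < V (Suc m) k1" using l k1 k(2) by (simp_all add: x_def del: vert.simps)
  then have "0 < l" "0 < k1" using V_0[of "Suc m"] by (metis gr0I less_irrefl)+
  then have "W 0 (V (Suc m) k1 - x) = W 0 (V (Suc m) l - x)"
    using k by (intro agree_left) (auto simp: x_def m_def)
  then show ?thesis using l k1 k by (simp add: x_def del: vert.simps)
qed

section \<open>Density of the exceptional positions\<close>

definition stride :: nat where "stride = Suc settle_time"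
text \<open>The last block of level \<open>r * stride\<close> inside a block of level
  \<open>Suc r * stride\<close> has at least the share \<open>1 / 2 ^ (stride + L)\<close> of its
  length, by \<open>H_max_step\<close> and \<open>H_ratio\<close>.\<close>

definition bad_rate :: real where "bad_rate = 1 - 1 / 2 ^ (stride + L)"

lemma bad_rate: "0 < bad_rate" "bad_rate < 1"
proof -
  have "(1::real) < 2 ^ (stride + L)" unfolding stride_def by (intro one_less_power) auto
  then show "0 < bad_rate" "bad_rate < 1" by (simp_all add: bad_rate_def field_simps)
qed

definition bad :: "nat \<Rightarrow> nat set" where
  "bad r = {t. \<forall>l<r. \<not> good (Suc l * stride) t}"

lemma card_split:
  assumes "a \<le> b" "b \<le> (d::nat)"
  shows "card ({a..<d} \<inter> S) = card ({a..<b} \<inter> S) + card ({b..<d} \<inter> S)"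
proof -
  have "{a..<d} \<inter> S = ({a..<b} \<inter> S) \<union> ({b..<d} \<inter> S)" using assms by auto
  then show ?thesis by (simp add: card_Un_disjoint disjoint_iff)
qed

lemma bad_range:
  fixes x :: real
  assumes tile: "\<And>k. card ({V n k..<V n (Suc k)} \<inter> S) \<le> x * H n (W n k)" and "k \<le> k'"
  shows "card ({V n k..<V n k'} \<inter> S) \<le> x * (real (V n k') - real (V n k))"
  using assms(2)
proof (induction rule: dec_induct)
  case (step k')
  have "card ({V n k..<V n (Suc k')} \<inter> S) = card ({V n k..<V n k'} \<inter> S) + card ({V n k'..<V n (Suc k')} \<inter> S)"
    by (rule card_split) (use step V_le_iff in auto)
  moreover have "real (V n (Suc k')) = real (V n k') + real_of_int (H n (W n k'))"
    using V_Suc[of n k'] by (metis of_int_add of_int_of_nat_eq)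
  ultimately show ?case using step tile[of k'] by (simp add: algebra_simps)
qed simp

text \<open>Each block of level \<open>Suc r * stride\<close> ends with a block of type
  \<open>c (r * stride)\<close> of level \<open>r * stride\<close>, whose positions are all good.
  The rest consists of blocks of level \<open>r * stride\<close>, to which the induction hypothesis
  applies.\<close>

lemma bad_tile: "card ({V (r * stride) k..<V (r * stride) (Suc k)} \<inter> bad r) \<le> bad_rate ^ r * H (r * stride) (W (r * stride) k)"
proof (induction r arbitrary: k)
  case 0
  then show ?case by (simp add: bad_def)
next
  case (Suc r)
  let ?n = "r * stride" and ?N = "Suc r * stride"
  have N: "Suc ?n \<le> ?N" "?n \<le> ?N" "?N = ?n + stride" by (auto simp: stride_def)
  obtain x where x: "V ?n x = V ?N k" using V_lower[OF N(2)] by blast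
  obtain z where z: "V (Suc ?n) z = V ?N (Suc k)" using V_lower[OF N(1)] by blast
  have "0 < z"
  proof (rule Nat.gr0I)
    assume "z = 0"
    then have "V ?N (Suc k) = 0" using z V_0 by metis
    then show False using V_less[of 0 "Suc k" ?N] by simp
  qed
  then obtain l where l: "V ?n (Suc l) = V ?N (Suc k)" "W ?n l = c ?n" using before_V[of z ?n] z by metis
  let ?h = "H ?n (c ?n)" and ?h' = "H ?N (W ?N k)"
  have "V ?n x < V ?n (Suc l)" using x l V_less[of k "Suc k" ?N] by simp
  then have xl: "x \<le> l" by (simp add: V_less_iff)
  have Vl: "V ?n (Suc l) = V ?n l + nat ?h" using V_Suc'[of ?n l] l by simp
  have "bad (Suc r) \<subseteq> bad r" by (auto simp: bad_def)
  then have "card ({V ?n x..<V ?n l} \<inter> bad (Suc r)) \<le> card ({V ?n x..<V ?n l} \<inter> bad r)"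
    by (intro card_mono) auto
  moreover have "{V ?n l..<V ?n (Suc l)} \<inter> bad (Suc r) = {}"
  proof -
    have "good ?N t" if "t \<in> {V ?n l..<V ?n (Suc l)}" for t
    proof -
      have "?N - Suc settle_time = ?n" using N(3) by (simp add: stride_def)
      then show ?thesis unfolding good_def using that l Vl
        by (intro exI[of _ "Suc k"]) auto
    qed
    then show ?thesis by (auto simp: bad_def)
  qed
  moreover have "card ({V ?n x..<V ?n (Suc l)} \<inter> bad (Suc r)) =
    card ({V ?n x..<V ?n l} \<inter> bad (Suc r)) + card ({V ?n l..<V ?n (Suc l)} \<inter> bad (Suc r))"
    by (rule card_split) (use xl V_le_iff in auto)
  moreover have "card ({V ?n x..<V ?n l} \<inter> bad r) \<le> bad_rate ^ r * (real (V ?n l) - real (V ?n x))"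
    by (rule bad_range[OF Suc xl])
  ultimately have "card ({V ?N k..<V ?N (Suc k)} \<inter> bad (Suc r)) \<le> bad_rate ^ r * (real (V ?n l) - real (V ?n x))"
    using x l by simp
  also have "real (V ?n l) - real (V ?n x) = real_of_int ?h' - real_of_int ?h"
    using V_Suc[of ?N k] x l Vl ht_pos[of c ?n "c ?n"] by simp
  also have "real_of_int ?h' - real_of_int ?h \<le> bad_rate * real_of_int ?h'"
  proof -
    have "?h' \<le> 2 ^ stride * (2 ^ L * ?h)" unfolding N(3) by (rule H_max_step) (rule H_ratio)
    then have "real_of_int ?h' \<le> real_of_int (2 ^ stride * (2 ^ L * ?h))" by (simp only: of_int_le_iff)
    then have "real_of_int ?h' \<le> 2 ^ (stride + L) * real_of_int ?h"
      by (simp add: power_add mult.assoc del: row.simps)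
    then show ?thesis by (simp add: bad_rate_def field_simps)
  qed
  finally show ?case using bad_rate by (simp add: mult.assoc mult.left_commute)
qed

lemma bad_density:
  fixes x :: real
  assumes "0 < x"
  shows "\<exists>r N0. \<forall>N\<ge>N0. \<forall>t. card ({t..<t + N} \<inter> bad r) \<le> x * N"
proof -
  \<comment> \<open>The factor 2 is left for the blocks cut by the ends of the interval, whose total
    length \<open>2 * M\<close> is at most \<open>N\<close>.\<close>
  obtain r where r: "bad_rate ^ r < x / 2"
    using real_arch_pow_inv[of "x / 2" bad_rate] assms bad_rate by auto
  let ?n = "r * stride"
  define M where "M = real_of_int (2 ^ L * H ?n One)"
  have M: "real_of_int (H ?n b) \<le> M" for b
    unfolding M_def using H_ratio[of ?n b One] by (simp only: of_int_le_iff)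
  have M0: "0 \<le> M" using M[of One] ht_pos[of c ?n One] by linarith
  define N0 where "N0 = nat \<lceil>2 * M\<rceil>"
  have "card ({t..<t + N} \<inter> bad r) \<le> x * N" if N: "N0 \<le> N" for N t
  proof -
    obtain k where k: "V ?n k \<le> t" "t < V ?n (Suc k)" using ex_index .
    obtain k' where k': "V ?n k' \<le> t + N" "t + N < V ?n (Suc k')" using ex_index .
    have kk: "k \<le> Suc k'"
    proof -
      have "V ?n k < V ?n (Suc k')" using k k' by linarith
      then show ?thesis by (simp add: V_less_iff)
    qed
    have "card ({t..<t + N} \<inter> bad r) \<le> card ({V ?n k..<V ?n (Suc k')} \<inter> bad r)"
      using k k' by (intro card_mono) auto
    also have "\<dots> \<le> bad_rate ^ r * (real (V ?n (Suc k')) - real (V ?n k))"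
      by (rule bad_range[OF bad_tile kk])
    also have "\<dots> \<le> bad_rate ^ r * (N + 2 * M)"
    proof (rule mult_left_mono)
      have "real (V ?n (Suc k')) = real (V ?n k') + real_of_int (H ?n (W ?n k'))"
        "real (V ?n (Suc k)) = real (V ?n k) + real_of_int (H ?n (W ?n k))"
        using V_Suc[of ?n k'] V_Suc[of ?n k] by (metis of_int_add of_int_of_nat_eq)+
      moreover have "real (V ?n k') \<le> real t + real N" "real t < real (V ?n (Suc k))"
        using k k' by linarith+
      ultimately show "real (V ?n (Suc k')) - real (V ?n k) \<le> N + 2 * M"
        using M[of "W ?n k"] M[of "W ?n k'"] by linarith
    qed (use bad_rate in auto)
    also have "\<dots> \<le> bad_rate ^ r * (2 * N)"
    proof (rule mult_left_mono)
      show "N + 2 * M \<le> 2 * N" using N unfolding N0_def by linarith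
    qed (use bad_rate in auto)
    also have "\<dots> \<le> x / 2 * (2 * N)" using r by (intro mult_right_mono) auto
    finally show ?thesis by simp
  qed
  then show ?thesis by blast
qed

theorem coincidence_density:
  fixes x :: real
  assumes "0 < x"
  shows "\<exists>e G N0. 0 < e \<and> (\<forall>N\<ge>N0. \<forall>t. real (card ({t..<t + N} - G)) \<le> x * N) \<and>
    (\<forall>t\<in>G. \<forall>t'. rot_near (freq c) e t t' \<longrightarrow> W 0 t = W 0 t')"
proof -
  obtain r N0 where r: "\<And>N t. N0 \<le> N \<Longrightarrow> card ({t..<t + N} \<inter> bad r) \<le> x * N"
    using bad_density[OF assms] by blast
  \<comment> \<open>The tolerance for the highest level tested; it serves the lower ones as
    well.\<close>
  define e :: real where "e = 1 / (4 * 3 ^ (r * stride))"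
  have "W 0 t = W 0 t'" if t: "t \<in> - bad r" and near: "rot_near (freq c) e t t'" for t t'
  proof -
    obtain l where l: "l < r" "good (Suc l * stride) t" using t by (auto simp: bad_def)
    show ?thesis
    proof (rule coincidence[OF _ l(2) _ near])
      show "settle_time < Suc l * stride" by (simp add: stride_def)
      have "Suc l * stride \<le> r * stride" using l(1) by (intro mult_right_mono) auto
      then have "(3::real) ^ (Suc l * stride) \<le> 3 ^ (r * stride)" by (intro power_increasing) auto
      then show "4 * (3 ^ (Suc l * stride) * e) \<le> 1" by (simp add: e_def field_simps)
    qed
  qed
  moreover have "0 < e" by (simp add: e_def)
  ultimately show ?thesis
    using r by (intro exI[of _ e] exI[of _ "- bad r"] exI[of _ N0]) (simp add: Diff_eq)
qed

end

section \<open>The space of infinite words\<close>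

definition agree :: "nat \<Rightarrow> word \<Rightarrow> word \<Rightarrow> bool" where
  "agree N x y \<longleftrightarrow> (\<forall>n<N. x n = y n)"

lemma agree_refl [simp]: "agree N x x"
  and agree_sym: "agree N x y \<Longrightarrow> agree N y x"
  and agree_trans: "agree N x y \<Longrightarrow> agree N y z \<Longrightarrow> agree N x z"
  and agree_mono: "agree N x y \<Longrightarrow> M \<le> N \<Longrightarrow> agree M x y"
  by (auto simp: agree_def)

lemma open_agree: "open {y. agree N x y}"
proof -
  have "open ((\<lambda>y. y n) -` {x n})" for n
    by (intro open_vimage discrete_topology_class.open_discrete continuous_on_product_coordinates)
  then have "open (\<Inter>n\<in>{..<N}. (\<lambda>y. y n) -` {x n})" by (intro open_INT) auto
  also have "(\<Inter>n\<in>{..<N}. (\<lambda>y. y n) -` {x n}) = {y. agree N x y}"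
    by (auto simp: agree_def)
  finally show ?thesis .
qed

lemma open_word_iff: "open U \<longleftrightarrow> (\<forall>x\<in>U. \<exists>N. \<forall>y. agree N x y \<longrightarrow> y \<in> (U :: word set))"
proof
  assume U: "open U"
  show "\<forall>x\<in>U. \<exists>N. \<forall>y. agree N x y \<longrightarrow> y \<in> U"
  proof
    fix x assume "x \<in> U"
    then obtain Y where Y: "x \<in> (\<Pi>\<^sub>E i\<in>UNIV. Y i)" "finite {i. Y i \<noteq> topspace (euclidean :: letter topology)}"
      "(\<Pi>\<^sub>E i\<in>UNIV. Y i) \<subseteq> U"
      using product_topology_open_contains_basis[of "\<lambda>_. euclidean" UNIV U x] U
      unfolding open_fun_def by blast
    obtain N where N: "\<And>i. i \<in> {i. Y i \<noteq> UNIV} \<Longrightarrow> i < N"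
      using Y(2) finite_nat_set_iff_bounded[of "{i. Y i \<noteq> UNIV}"] by auto
    have "y \<in> U" if "agree N x y" for y
    proof -
      have "y i \<in> Y i" for i
      proof (cases "i < N")
        case True
        then show ?thesis using that Y(1) by (metis PiE_mem UNIV_I agree_def)
      next
        case False
        then show ?thesis using N[of i] by auto
      qed
      then show ?thesis using Y(3) by (auto simp: PiE_def)
    qed
    then show "\<exists>N. \<forall>y. agree N x y \<longrightarrow> y \<in> U" by blast
  qed
next
  assume r: "\<forall>x\<in>U. \<exists>N. \<forall>y. agree N x y \<longrightarrow> y \<in> U"
  show "open U"
  proof (subst open_subopen, intro ballI)
    fix x assume "x \<in> U"
    then obtain N where "\<forall>y. agree N x y \<longrightarrow> y \<in> U" using r by blast
    then show "\<exists>T. open T \<and> x \<in> T \<and> T \<subseteq> U"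
      using open_agree[of N x] by (intro exI[of _ "{y. agree N x y}"]) auto
  qed
qed

lemma compact_word: "compact (UNIV :: word set)"
proof -
  have "compact_space (euclidean :: letter topology)"
    by (simp add: compact_space_def finite_imp_compact)
  then have "compact_space (product_topology (\<lambda>_::nat. euclidean :: letter topology) UNIV)"
    by (simp add: compact_space_product_topology)
  then show ?thesis by (simp add: compact_space_def euclidean_product_topology)
qed

lemma funpow_shift: "(shift ^^ t) x = (\<lambda>n. x (t + n))"
  by (induction t arbitrary: x) (auto simp: shift_def)

lemma orbit_closure_iff: "x \<in> orbit_closure w \<longleftrightarrow> (\<forall>N. \<exists>t. agree N x ((shift ^^ t) w))"
proof
  assume x: "x \<in> orbit_closure w"
  show "\<forall>N. \<exists>t. agree N x ((shift ^^ t) w)"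
  proof
    fix N
    have "range (\<lambda>n. (shift ^^ n) w) \<inter> {y. agree N x y} \<noteq> {}"
      using x open_agree[of N x] unfolding orbit_closure_def
      by (auto simp: closure_iff_nhds_not_empty dest!: spec[of _ "{y. agree N x y}"])
    then show "\<exists>t. agree N x ((shift ^^ t) w)" by blast
  qed
next
  assume r: "\<forall>N. \<exists>t. agree N x ((shift ^^ t) w)"
  show "x \<in> orbit_closure w"
    unfolding orbit_closure_def closure_iff_nhds_not_empty
  proof (intro allI impI)
    fix S U assume SU: "(U :: word set) \<subseteq> S" "open U" "x \<in> U"
    then obtain N where "\<forall>y. agree N x y \<longrightarrow> y \<in> U" unfolding open_word_iff by blast
    moreover obtain t where "agree N x ((shift ^^ t) w)" using r by blast
    ultimately show "range (\<lambda>n. (shift ^^ n) w) \<inter> S \<noteq> {}" using SU by blast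
  qed
qed

text \<open>Finite unions of cylinders; they stand for the clopen sets.\<close>

definition det :: "nat \<Rightarrow> word set \<Rightarrow> bool" where
  "det m S \<longleftrightarrow> (\<forall>x y. agree m x y \<longrightarrow> (x \<in> S \<longleftrightarrow> y \<in> S))"

lemma det_mono: "det m S \<Longrightarrow> m \<le> n \<Longrightarrow> det n S"
  unfolding det_def using agree_mono by blast

lemma continuous_on_wordI:
  fixes F :: "word \<Rightarrow> 'a::real_normed_vector"
  assumes "\<And>x e. x \<in> X \<Longrightarrow> 0 < e \<Longrightarrow> \<exists>N. \<forall>y\<in>X. agree N x y \<longrightarrow> norm (F x - F y) \<le> e"
  shows "continuous_on X F"
  unfolding continuous_on_topological
proof (intro ballI allI impI)
  fix x B assume x: "x \<in> X" "open B" "F x \<in> B"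
  then obtain e where e: "0 < e" "ball (F x) e \<subseteq> B" using open_contains_ball by blast
  have "0 < e / 2" using e by simp
  then obtain N where N: "\<And>y. y \<in> X \<Longrightarrow> agree N x y \<Longrightarrow> norm (F x - F y) \<le> e / 2"
    using assms[OF x(1)] by blast
  have "F y \<in> B" if "y \<in> X" "agree N x y" for y
  proof -
    have "dist (F x) (F y) < e" using N[OF that] e by (simp add: dist_norm)
    then show ?thesis using e by auto
  qed
  then show "\<exists>A. open A \<and> x \<in> A \<and> (\<forall>y\<in>X. y \<in> A \<longrightarrow> F y \<in> B)"
    using open_agree[of N x] by (intro exI[of _ "{y. agree N x y}"]) auto
qed

lemma continuous_on_indicator_det:
  assumes "det m S" shows "continuous_on X (indicator S :: word \<Rightarrow> 'a::real_normed_field)"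
proof (rule continuous_on_wordI)
  fix x :: word and e :: real assume "0 < e"
  then show "\<exists>N. \<forall>y\<in>X. agree N x y \<longrightarrow> norm (indicator S x - indicator S y :: 'a) \<le> e"
    using assms by (intro exI[of _ m]) (auto simp: det_def indicator_def)
qed

lemma continuous_on_shift: "continuous_on X shift"
  unfolding shift_def[abs_def]
  by (intro continuous_on_coordinatewise_then_product
    continuous_on_subset[OF continuous_on_product_coordinates subset_UNIV])

lemma cis_near_one:
  assumes "0 < (e::real)"
  shows "\<exists>\<eta>>0. \<forall>x. cmod (cis (2 * pi * x) - 1) < \<eta> \<longrightarrow> (\<exists>d::int. \<bar>d - x\<bar> \<le> e)"
proof -
  have "isCont Arg 1" by (rule continuous_at_Arg) (simp add: complex_nonpos_Reals_iff)
  then obtain \<eta> where \<eta>: "0 < \<eta>" "\<And>z. dist z 1 < \<eta> \<Longrightarrow> dist (Arg z) (Arg 1) < 2 * pi * e"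
    using assms unfolding continuous_at_eps_delta by (metis mult_pos_pos pi_gt_zero zero_less_numeral)
  have "\<exists>d::int. \<bar>d - x\<bar> \<le> e" if "cmod (cis (2 * pi * x) - 1) < \<eta>" for x
  proof -
    define A where "A = Arg (cis (2 * pi * x))"
    have A: "\<bar>A\<bar> < 2 * pi * e" using \<eta>(2)[of "cis (2 * pi * x)"] that by (simp add: dist_norm A_def)
    have "cis A = cis (2 * pi * x)" unfolding A_def by (subst cis_Arg) (simp_all add: sgn_div_norm)
    then have "cis (2 * pi * x - A) = 1" by (metis cis_divide cis_neq_zero divide_self)
    then have "cos (2 * pi * x - A) = 1" by (metis cis.sel(1) one_complex.sel(1))
    then obtain n :: int where "2 * pi * x - A = n * 2 * pi" using cos_one_2pi_int by auto
    then have "2 * pi * (x - n) = A" by (simp add: algebra_simps)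
    then have "2 * pi * \<bar>n - x\<bar> = \<bar>A\<bar>" by (simp add: abs_mult[symmetric] abs_minus_commute flip: abs_mult)
       (metis abs_minus_commute abs_mult abs_of_pos pi_gt_zero abs_numeral)
    then have "\<bar>n - x\<bar> < e" using A by (smt (verit) mult_less_cancel_left_pos pi_gt_zero)
    then show ?thesis by (intro exI[of _ n]) auto
  qed
  then show ?thesis using \<eta>(1) by blast
qed

lemma cis_lipschitz: "cmod (cis a - cis b) \<le> 2 * \<bar>a - b\<bar>"
proof -
  have s: "\<bar>sin ((a - b) / 2)\<bar> \<le> \<bar>a - b\<bar> / 2" "\<bar>sin ((b - a) / 2)\<bar> \<le> \<bar>a - b\<bar> / 2"
    using abs_sin_x_le_abs_x[of "(a - b) / 2"] abs_sin_x_le_abs_x[of "(b - a) / 2"] by simp_all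
  have "\<bar>cos a - cos b\<bar> \<le> \<bar>a - b\<bar>"
    unfolding cos_diff_cos abs_mult
    using mult_mono[OF abs_sin_le_one[of "(a + b) / 2"] s(2)] by simp
  moreover have "\<bar>sin a - sin b\<bar> \<le> \<bar>a - b\<bar>"
    unfolding sin_diff_sin abs_mult
    using mult_mono[OF s(1) abs_cos_le_one[of "(a + b) / 2"]] by simp
  ultimately show ?thesis using cmod_le[of "cis a - cis b"] by simp
qed

section \<open>Words coded by a rotation\<close>

text \<open>\<open>phase\<close> says that the phase \<open>t f\<close> modulo \<open>1\<close> is determined, approximately, by the letters that follow
  \<open>t\<close>, and \<open>coincidence\<close> that conversely it determines the letter at \<open>t\<close>, for most \<open>t\<close>.\<close>

locale word_rotation =
  fixes w :: word and f :: "letter \<Rightarrow> real"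
  assumes phase: "0 < e \<Longrightarrow> \<exists>N. \<forall>t t'. (\<forall>n<N. w (t + n) = w (t' + n)) \<longrightarrow>
      rot_near f e t t'"
    and coincidence: "0 < x \<Longrightarrow> \<exists>e G N0. 0 < e \<and>
      (\<forall>N\<ge>N0. \<forall>t. real (card ({t..<t + N} - G)) \<le> x * N) \<and>
      (\<forall>t\<in>G. \<forall>t'. rot_near f e t t' \<longrightarrow> w t = w t')"
begin

abbreviation X :: "word set" where "X \<equiv> orbit_closure w"

definition pt :: "nat \<Rightarrow> word" where "pt t = (\<lambda>n. w (t + n))"

lemma pt_in_X [simp]: "pt t \<in> X"
  unfolding orbit_closure_iff funpow_shift pt_def using agree_refl by blast

lemma X_approx: "x \<in> X \<Longrightarrow> \<exists>t. agree N x (pt t)"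
  unfolding orbit_closure_iff funpow_shift pt_def by blast

lemma shift_pt: "shift (pt t) = pt (Suc t)"
  by (simp add: shift_def pt_def)

lemma funpow_shift_pt: "(shift ^^ u) (pt t) = pt (t + u)"
  by (simp add: funpow_shift pt_def add.assoc)

lemma agree_shift: "agree (Suc N) x y \<Longrightarrow> agree N (shift x) (shift y)"
  by (auto simp: agree_def shift_def)

lemma shift_X: "x \<in> X \<Longrightarrow> shift x \<in> X"
proof -
  assume x: "x \<in> X"
  have "\<exists>t. agree N (shift x) ((shift ^^ t) w)" for N
  proof -
    obtain t where "agree (Suc N) x (pt t)" using X_approx x by blast
    then have "agree N (shift x) (pt (Suc t))" using agree_shift shift_pt by metis
    then show ?thesis unfolding funpow_shift pt_def by blast
  qed
  then show ?thesis unfolding orbit_closure_iff by blast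
qed

lemma funpow_shift_X: "x \<in> X \<Longrightarrow> (shift ^^ u) x \<in> X"
  by (induction u) (auto simp: shift_X)

definition ev :: "letter \<Rightarrow> nat \<Rightarrow> complex" where "ev a t = cis (2 * pi * (f a * t))"

lemma ev_close:
  assumes "\<bar>real_of_int d - (real t' - real t) * f a\<bar> \<le> e"
  shows "cmod (ev a t - ev a t') \<le> 4 * pi * e"
proof -
  have "cis (2 * pi * (f a * t' - d)) = ev a t'"
    by (simp add: ev_def right_diff_distrib flip: cis_divide) 
  then have "cmod (ev a t - ev a t') = cmod (cis (2 * pi * (f a * t)) - cis (2 * pi * (f a * t' - d)))"
    by (simp add: ev_def)
  also have "\<dots> \<le> 2 * \<bar>2 * pi * (f a * t) - 2 * pi * (f a * t' - d)\<bar>" by (rule cis_lipschitz)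
  also have "2 * pi * (f a * t) - 2 * pi * (f a * t' - d) = 2 * pi * (d - (real t' - real t) * f a)"
    by (simp add: algebra_simps)
  also have "2 * \<bar>2 * pi * (d - (real t' - real t) * f a)\<bar> = 4 * pi * \<bar>d - (real t' - real t) * f a\<bar>"
    by (simp add: abs_mult)
  also have "\<dots> \<le> 4 * pi * e" using assms by (intro mult_left_mono) auto
  finally show ?thesis .
qed

lemma ev_continuous:
  assumes "0 < e"
  obtains N where "\<And>t t'. agree N (pt t) (pt t') \<Longrightarrow> cmod (ev a t - ev a t') \<le> e"
proof -
  have "0 < e / (4 * pi)" using assms by simp
  then obtain N where N: "\<And>t t'. \<forall>n<N. w (t + n) = w (t' + n) \<Longrightarrow>
      rot_near f (e / (4 * pi)) t t'"
    using phase by meson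
  show thesis
  proof (rule that[of N])
    fix t t' assume "agree N (pt t) (pt t')"
    then obtain d :: int where "\<bar>d - (real t' - real t) * f a\<bar> \<le> e / (4 * pi)"
      using N unfolding agree_def pt_def rot_near_def by blast
    from ev_close[OF this] show "cmod (ev a t - ev a t') \<le> e" by simp
  qed
qed

definition near :: "nat \<Rightarrow> word \<Rightarrow> nat" where "near N x = (SOME t. agree N x (pt t))"

lemma near: "x \<in> X \<Longrightarrow> agree N x (pt (near N x))"
  unfolding near_def by (rule someI_ex[OF X_approx])

text \<open>Continuous extension to \<open>X\<close> of the function \<open>ev a\<close> on the
  orbit, which \<open>phase\<close> makes uniformly continuous.\<close>

definition phi :: "letter \<Rightarrow> word \<Rightarrow> complex" where "phi a x = lim (\<lambda>N. ev a (near N x))"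

lemma phi_approx:
  assumes "0 < e"
  obtains N where "\<And>x t. x \<in> X \<Longrightarrow> agree N x (pt t) \<Longrightarrow> cmod (phi a x - ev a t) \<le> e"
proof -
  have conv: "(\<lambda>N. ev a (near N x)) \<longlonglongrightarrow> phi a x" if x: "x \<in> X" for x
  proof -
    have "Cauchy (\<lambda>N. ev a (near N x))"
    proof (rule CauchyI)
      fix r :: real assume "0 < r"
      then obtain N where N: "\<And>t t'. agree N (pt t) (pt t') \<Longrightarrow> cmod (ev a t - ev a t') \<le> r / 2"
        using ev_continuous[of "r / 2"] by (metis half_gt_zero)
      have "cmod (ev a (near m x) - ev a (near n x)) < r" if "N \<le> m" "N \<le> n" for m n
      proof -
        have "agree N (pt (near m x)) (pt (near n x))"
          using near[OF x, of m] near[OF x, of n] that agree_mono agree_sym agree_trans by blast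
        from N[OF this] show ?thesis using \<open>0 < r\<close> by linarith
      qed
      then show "\<exists>M. \<forall>m\<ge>M. \<forall>n\<ge>M. cmod (ev a (near m x) - ev a (near n x)) < r" by blast
    qed
    then show ?thesis unfolding phi_def by (simp add: Cauchy_convergent_iff convergent_LIMSEQ_iff)
  qed
  obtain N where N: "\<And>t t'. agree N (pt t) (pt t') \<Longrightarrow> cmod (ev a t - ev a t') \<le> e"
    using ev_continuous assms by blast
  show thesis
  proof (rule that[of N])
    fix x t assume x: "x \<in> X" "agree N x (pt t)"
    have "(\<lambda>m. cmod (ev a (near m x) - ev a t)) \<longlonglongrightarrow> cmod (phi a x - ev a t)"
      by (intro tendsto_intros conv x)
    moreover have "cmod (ev a (near m x) - ev a t) \<le> e" if "N \<le> m" for m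
      using N near[OF x(1), of m] that x(2) agree_mono agree_sym agree_trans by meson
    ultimately show "cmod (phi a x - ev a t) \<le> e" by (meson LIMSEQ_le_const2)
  qed
qed

lemma eq_if_le_all:
  fixes x y :: "'a::real_normed_vector"
  assumes "\<And>e. 0 < e \<Longrightarrow> norm (x - y) \<le> e" shows "x = y"
proof (rule ccontr)
  assume "x \<noteq> y"
  then show False using assms[of "norm (x - y) / 2"] by simp
qed

lemma phi_pt: "phi a (pt t) = ev a t"
proof (rule eq_if_le_all)
  fix e :: real assume "0 < e"
  then show "cmod (phi a (pt t) - ev a t) \<le> e"
    using phi_approx[of e a] by (metis agree_refl pt_in_X)
qed

section \<open>Continuous eigenfunctions and trigonometric polynomials\<close>

definition char :: "(word \<Rightarrow> complex) \<Rightarrow> bool" where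
  "char F \<longleftrightarrow> (\<forall>x\<in>X. cmod (F x) = 1) \<and> (\<exists>z. \<forall>x\<in>X. F (shift x) = z * F x) \<and> continuous_on X F"

lemma continuous_phi: "continuous_on X (phi a)"
proof (rule continuous_on_wordI)
  fix x and e :: real assume x: "x \<in> X" and "0 < e"
  then obtain N where N: "\<And>x t. x \<in> X \<Longrightarrow> agree N x (pt t) \<Longrightarrow> cmod (phi a x - ev a t) \<le> e / 2"
    using phi_approx[of "e / 2"] by (metis half_gt_zero)
  have "cmod (phi a x - phi a y) \<le> e" if xy: "y \<in> X" "agree N x y" for y
  proof -
    let ?t = "near N x"
    have "agree N x (pt ?t)" "agree N y (pt ?t)" using near x xy agree_sym agree_trans by blast+
    then have "cmod (phi a x - ev a ?t) \<le> e / 2" "cmod (phi a y - ev a ?t) \<le> e / 2" using N x xy by auto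
    then show ?thesis using norm_triangle_ineq4[of "phi a x - ev a ?t" "phi a y - ev a ?t"] by simp
  qed
  then show "\<exists>N. \<forall>y\<in>X. agree N x y \<longrightarrow> cmod (phi a x - phi a y) \<le> e" by blast
qed

lemma X_closure: "X = closure (range pt)"
  by (simp add: orbit_closure_def funpow_shift pt_def[abs_def])

lemma le_on_orbit:
  fixes F :: "word \<Rightarrow> real"
  assumes "continuous_on X F" "\<And>t. F (pt t) \<le> B" "x \<in> X"
  shows "F x \<le> B"
  using image_closure_subset[of "range pt" F "{..B}"] assms unfolding X_closure by auto

lemma eq_on_orbit:
  fixes F G :: "word \<Rightarrow> 'a::real_normed_vector"
  assumes "continuous_on X F" "continuous_on X G" "\<And>t. F (pt t) = G (pt t)" "x \<in> X"
  shows "F x = G x"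
  using le_on_orbit[of "\<lambda>x. norm (F x - G x)" 0 x] assms by (simp add: continuous_intros)

lemma continuous_comp_shift: "continuous_on X F \<Longrightarrow> continuous_on X (\<lambda>x. F (shift x))"
  using shift_X by (intro continuous_on_compose2[OF _ continuous_on_shift]) auto

lemma char_phi: "char (phi a)"
  unfolding char_def
proof (intro conjI exI[of _ "cis (2 * pi * f a)"] ballI continuous_phi)
  fix x assume x: "x \<in> X"
  show "cmod (phi a x) = 1"
    by (rule eq_on_orbit[OF _ _ _ x]) (auto simp: phi_pt ev_def intro!: continuous_intros continuous_phi)
  show "phi a (shift x) = cis (2 * pi * f a) * phi a x"
    by (rule eq_on_orbit[OF _ _ _ x])
      (auto simp: shift_pt phi_pt ev_def cis_mult algebra_simps
        intro!: continuous_intros continuous_comp_shift continuous_phi)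
qed

lemma char_cnj: "char F \<Longrightarrow> char (\<lambda>x. cnj (F x))"
  unfolding char_def by (auto intro: continuous_intros)

lemma char_mult:
  assumes "char F" "char G" shows "char (\<lambda>x. F x * G x)"
proof -
  obtain y z where "\<And>x. x \<in> X \<Longrightarrow> F (shift x) = y * F x" "\<And>x. x \<in> X \<Longrightarrow> G (shift x) = z * G x"
    using assms unfolding char_def by metis
  then have "\<forall>x\<in>X. F (shift x) * G (shift x) = y * z * (F x * G x)" by simp
  then show ?thesis using assms unfolding char_def by (auto simp: norm_mult intro: continuous_intros)
qed

lemma char_one: "char (\<lambda>_. 1)"
  unfolding char_def by (auto intro: exI[of _ 1])

text \<open>The linear span of the continuous eigenfunctions of modulus 1. As these are closed under
  products, it is an algebra, so polynomials in the real and imaginary parts of \<open>phi\<close>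
  stay inside.\<close>

inductive_set TP :: "(word \<Rightarrow> complex) set" where
  mono: "char F \<Longrightarrow> (\<lambda>x. b * F x) \<in> TP"
| add: "F \<in> TP \<Longrightarrow> G \<in> TP \<Longrightarrow> (\<lambda>x. F x + G x) \<in> TP"

lemma TP_const: "(\<lambda>_. b) \<in> TP"
  using TP.mono[OF char_one, of b] by simp

lemma TP_scale: "F \<in> TP \<Longrightarrow> (\<lambda>x. b * F x) \<in> TP"
proof (induction rule: TP.induct)
  case (mono F b') then show ?case using TP.mono[of F "b * b'"] by (simp add: mult.assoc)
next
  case (add F G) then show ?case using TP.add[OF add.IH] by (simp add: distrib_left)
qed

lemma TP_mult_char: "F \<in> TP \<Longrightarrow> char G \<Longrightarrow> (\<lambda>x. F x * G x) \<in> TP"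
proof (induction rule: TP.induct)
  case (mono F b) then show ?case using TP.mono[OF char_mult[of F G], of b] by (simp add: mult.assoc)
next
  case (add F F') then show ?case using TP.add[OF add.IH] by (simp add: distrib_right)
qed

lemma TP_mult: "G \<in> TP \<Longrightarrow> F \<in> TP \<Longrightarrow> (\<lambda>x. F x * G x) \<in> TP"
proof (induction rule: TP.induct)
  case (mono G b)
  then show ?case using TP_scale[OF TP_mult_char[of F G], of b] by (simp add: mult.left_commute)
next
  case (add G G') then show ?case using TP.add[OF add.IH] by (simp add: distrib_left)
qed

lemma TP_continuous: "F \<in> TP \<Longrightarrow> continuous_on X F"
  by (induction rule: TP.induct) (auto simp: char_def intro: continuous_intros)

lemma TP_span:
  "F \<in> TP \<Longrightarrow> \<exists>E b. finite E \<and> (\<forall>e\<in>E. char e) \<and> F = (\<lambda>x. \<Sum>e\<in>E. b e * e x)"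
proof (induction rule: TP.induct)
  case (mono F b)
  then show ?case by (intro exI[of _ "{F}"] exI[of _ "\<lambda>_. b"]) simp
next
  case (add F G)
  then obtain E b E' b' where
    E: "finite E" "\<forall>e\<in>E. char e" "F = (\<lambda>x. \<Sum>e\<in>E. b e * e x)" and
    E': "finite E'" "\<forall>e\<in>E'. char e" "G = (\<lambda>x. \<Sum>e\<in>E'. b' e * e x)" by blast
  let ?b = "\<lambda>e. (if e \<in> E then b e else 0) + (if e \<in> E' then b' e else 0)"
  have "F x + G x = (\<Sum>e\<in>E \<union> E'. ?b e * e x)" for x
  proof -
    have "(\<Sum>e\<in>E \<union> E'. ?b e * e x) =
      (\<Sum>e\<in>E \<union> E'. (if e \<in> E then b e * e x else 0)) + (\<Sum>e\<in>E \<union> E'. (if e \<in> E' then b' e * e x else 0))"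
      unfolding sum.distrib[symmetric] by (intro sum.cong) (auto simp: distrib_right)
    also have "(\<Sum>e\<in>E \<union> E'. (if e \<in> E then b e * e x else 0)) = F x"
      unfolding E(3) using E(1) E'(1) by (simp add: sum.inter_restrict[symmetric] Int_absorb1)
    also have "(\<Sum>e\<in>E \<union> E'. (if e \<in> E' then b' e * e x else 0)) = G x"
      unfolding E'(3) using E(1) E'(1) by (simp add: sum.inter_restrict[symmetric] Int_absorb1)
    finally show ?thesis ..
  qed
  then show ?case using E E' by (intro exI[of _ "E \<union> E'"] exI[of _ ?b]) auto
qed

definition torus :: "word \<Rightarrow> complex \<times> complex \<times> complex" where
  "torus x = (phi One x, phi Two x, phi Three x)"

text \<open>A real linear functional on the plane is a combination of \<open>z\<close> and
  \<open>cnj z\<close>.\<close>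

lemma TP_linear_phi:
  assumes "bounded_linear (p :: complex \<Rightarrow> real)"
  shows "(\<lambda>x. complex_of_real (p (phi a x))) \<in> TP"
proof -
  interpret bounded_linear p by fact
  let ?u = "complex_of_real (p 1)" and ?v = "complex_of_real (p \<i>)"
  have e: "p z = Re z * p 1 + Im z * p \<i>" for z
  proof -
    have "z = Re z *\<^sub>R 1 + Im z *\<^sub>R \<i>" by (simp add: complex_eq_iff)
    then show ?thesis using add scaleR by (metis real_scaleR_def)
  qed
  have "complex_of_real (p z) = (?u - \<i> * ?v) / 2 * z + (?u + \<i> * ?v) / 2 * cnj z" for z
    unfolding e[of z] by (simp add: complex_eq_iff field_simps)
  then have "(\<lambda>x. complex_of_real (p (phi a x))) =
    (\<lambda>x. (?u - \<i> * ?v) / 2 * phi a x + (?u + \<i> * ?v) / 2 * cnj (phi a x))" by blast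
  moreover have "(\<lambda>x. (?u - \<i> * ?v) / 2 * phi a x + (?u + \<i> * ?v) / 2 * cnj (phi a x)) \<in> TP"
    by (intro TP.add TP.mono char_phi char_cnj)
  ultimately show ?thesis by simp
qed

lemma TP_polynomial:
  assumes "real_polynomial_function p"
  shows "(\<lambda>x. complex_of_real (p (torus x))) \<in> TP"
  using assms
proof (induction rule: real_polynomial_function.induct)
  case (linear p)
  note bl = linear
  interpret bounded_linear p by fact
  have split: "p (a, b, c) = p (a, 0, 0) + p (0, b, 0) + p (0, 0, c)" for a b c
    by (simp flip: add)
  have e: "(\<lambda>x. complex_of_real (p (torus x))) = (\<lambda>x. complex_of_real (p (phi One x, 0, 0)) +
      complex_of_real (p (0, phi Two x, 0)) + complex_of_real (p (0, 0, phi Three x)))"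
    unfolding torus_def by (subst split) (simp only: of_real_add)
  have "bounded_linear (\<lambda>z. p (z, 0, 0))" "bounded_linear (\<lambda>z. p (0, z, 0))" "bounded_linear (\<lambda>z. p (0, 0, z))"
    by (intro bounded_linear_compose[OF bl] bounded_linear_Pair bounded_linear_ident bounded_linear_zero)+
  then show ?case unfolding e by (intro TP.add TP_linear_phi)
next
  case (const b) then show ?case by (rule TP_const)
next
  case (add p q) then show ?case using TP.add[OF add.IH] by simp
next
  case (mult p q) then show ?case using TP_mult[OF mult.IH(2,1)] by simp
qed

section \<open>Uniform convergence of Birkhoff averages\<close>

definition avg :: "(word \<Rightarrow> 'a::real_normed_field) \<Rightarrow> nat \<Rightarrow> word \<Rightarrow> 'a" where
  "avg F N x = (\<Sum>u<N. F ((shift ^^ u) x)) / of_nat N"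

text \<open>For an eigenvalue other than 1 the sum is geometric, hence bounded; for eigenvalue 1 the
  function is constant on the orbit.\<close>

lemma char_avg:
  assumes "char F"
  shows "\<exists>M. uniform_limit UNIV (\<lambda>N t. avg F N (pt t)) (\<lambda>_. M) sequentially"
proof -
  obtain z where z: "\<And>x. x \<in> X \<Longrightarrow> F (shift x) = z * F x" using assms unfolding char_def by blast
  have n: "cmod (F (pt t)) = 1" for t using assms unfolding char_def by auto
  have p: "F (pt (t + u)) = z ^ u * F (pt t)" for t u
    by (induction u) (simp_all add: z mult.assoc flip: shift_pt)
  have nz: "cmod z = 1" using z[of "pt 0"] n[of 0] n[of 1] shift_pt[of 0] by (simp add: norm_mult)
  have a: "avg F N (pt t) = (\<Sum>u<N. z ^ u) * F (pt t) / of_nat N" for N t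
    unfolding avg_def funpow_shift_pt p by (simp add: sum_distrib_right)
  show ?thesis
  proof (cases "z = 1")
    case True
    have "F (pt t) = F (pt 0)" for t using p[of 0 t] True by simp
    then have "avg F N (pt t) = F (pt 0)" if "1 \<le> N" for N t using that True unfolding a by simp
    then show ?thesis
      by (intro exI[of _ "F (pt 0)"] uniform_limitI eventually_sequentiallyI[of 1]) auto
  next
    case False
    define B where "B = 2 / cmod (1 - z)"
    have B: "cmod (avg F N (pt t)) \<le> B / N" for N t
    proof -
      have "cmod (1 - z ^ N) \<le> 2" using norm_triangle_ineq4[of 1 "z ^ N"] nz by (simp add: norm_power)
      then have "cmod (\<Sum>u<N. z ^ u) \<le> B" using False unfolding B_def
        by (simp add: sum_gp_strict norm_divide divide_right_mono)
      then show ?thesis unfolding a by (simp add: norm_divide norm_mult n divide_right_mono)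
    qed
    have "uniform_limit UNIV (\<lambda>N t. avg F N (pt t)) (\<lambda>_. 0) sequentially"
    proof (rule uniform_limitI)
      fix e :: real assume "0 < e"
      have "(\<lambda>N. B / real N) \<longlonglongrightarrow> 0" by (rule lim_const_over_n)
      then have "\<forall>\<^sub>F N in sequentially. B / real N < e" using \<open>0 < e\<close> by (rule order_tendstoD)
      then show "\<forall>\<^sub>F N in sequentially. \<forall>t\<in>UNIV. dist (avg F N (pt t)) 0 < e"
        by eventually_elim (use B in \<open>auto intro: le_less_trans\<close>)
    qed
    then show ?thesis by blast
  qed
qed

lemma TP_avg:
  "F \<in> TP \<Longrightarrow> \<exists>M. uniform_limit UNIV (\<lambda>N t. avg F N (pt t)) (\<lambda>_. M) sequentially"
proof (induction rule: TP.induct)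
  case (mono F b)
  then obtain M where "uniform_limit UNIV (\<lambda>N t. avg F N (pt t)) (\<lambda>_. M) sequentially"
    using char_avg by blast
  from bounded_linear.uniform_limit[OF bounded_linear_mult_right this, of b]
  show ?case by (auto simp: avg_def sum_distrib_left)
next
  case (add F G)
  then obtain M M' where "uniform_limit UNIV (\<lambda>N t. avg F N (pt t)) (\<lambda>_. M) sequentially"
    "uniform_limit UNIV (\<lambda>N t. avg G N (pt t)) (\<lambda>_. M') sequentially" by blast
  from uniform_limit_add[OF this] show ?case
    by (auto simp: avg_def sum.distrib add_divide_distrib)
qed

end

section \<open>Approximation of clopen sets in the mean\<close>

context word_rotation
begin

lemma continuous_funpow_shift: "continuous_on X F \<Longrightarrow> continuous_on X (\<lambda>x. F ((shift ^^ u) x))"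
  by (induction u) (simp_all add: funpow_swap1 continuous_comp_shift[of "\<lambda>x. F ((shift ^^ _) x)"])

lemma continuous_avg: "continuous_on X F \<Longrightarrow> continuous_on X (avg F N)"
  unfolding avg_def[abs_def] divide_inverse by (intro continuous_intros continuous_funpow_shift)

lemma torus_pt: "torus (pt t) = (ev One t, ev Two t, ev Three t)"
  by (simp add: torus_def phi_pt)

lemma ev_ratio: "cmod (ev a t' - ev a t) = cmod (cis (2 * pi * ((real t' - real t) * f a)) - 1)"
proof -
  have "ev a t' = ev a t * cis (2 * pi * ((real t' - real t) * f a))"
    by (simp add: ev_def cis_mult algebra_simps)
  then have "ev a t' - ev a t = ev a t * (cis (2 * pi * ((real t' - real t) * f a)) - 1)"
    by (simp add: algebra_simps)
  then show ?thesis by (simp add: norm_mult ev_def)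
qed

text \<open>Closeness of phases depends on the difference of the positions only, so it survives a
  common shift by \<open>l\<close> and fixes \<open>m\<close> consecutive letters.\<close>

lemma torus_separates:
  assumes S: "det m S" and e: "0 < e"
    and G: "\<forall>t\<in>G. \<forall>t'. rot_near f e t t' \<longrightarrow> w t = w t'"
  obtains \<eta> where "0 < \<eta>"
    "\<And>t t'. \<forall>l<m. t + l \<in> G \<Longrightarrow> dist (torus (pt t)) (torus (pt t')) < \<eta> \<Longrightarrow>
      pt t \<in> S \<longleftrightarrow> pt t' \<in> S"
proof -
  obtain \<eta> where \<eta>: "0 < \<eta>" "\<And>x. cmod (cis (2 * pi * x) - 1) < \<eta> \<Longrightarrow> \<exists>d::int. \<bar>d - x\<bar> \<le> e"
    using cis_near_one[OF e] by blast
  show thesis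
  proof (rule that[OF \<eta>(1)])
    fix t t' assume t: "\<forall>l<m. t + l \<in> G" and d: "dist (torus (pt t)) (torus (pt t')) < \<eta>"
    have "dist (ev a t) (ev a t') \<le> dist (torus (pt t)) (torus (pt t'))" for a
    proof (cases a)
      case One
      then show ?thesis using dist_fst_le[of "torus (pt t)" "torus (pt t')"] by (simp add: torus_pt)
    next
      case Two
      then show ?thesis using dist_snd_le[of "torus (pt t)" "torus (pt t')"]
          dist_fst_le[of "snd (torus (pt t))" "snd (torus (pt t'))"] by (simp add: torus_pt)
    next
      case Three
      then show ?thesis using dist_snd_le[of "torus (pt t)" "torus (pt t')"]
          dist_snd_le[of "snd (torus (pt t))" "snd (torus (pt t'))"] by (simp add: torus_pt)
    qed
    then have "cmod (ev a t' - ev a t) < \<eta>" for a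
      using d le_less_trans by (simp only: dist_norm norm_minus_commute[of "ev a t'"]) blast
    then have near: "\<exists>d::int. \<bar>d - (real t' - real t) * f a\<bar> \<le> e" for a
      unfolding ev_ratio using \<eta>(2) by blast
    have "w (t + l) = w (t' + l)" if "l < m" for l
    proof -
      have "rot_near f e (t + l) (t' + l)" using near by (simp add: rot_near_def)
      then show ?thesis using G t that by blast
    qed
    then have "agree m (pt t) (pt t')" by (simp add: agree_def pt_def)
    then show "pt t \<in> S \<longleftrightarrow> pt t' \<in> S" using S unfolding det_def by blast
  qed
qed

lemma card_not_all:
  fixes G :: "nat set"
  shows "card ({t..<t + N} - {t. \<forall>l<m. t + l \<in> G}) \<le> (\<Sum>l<m. card ({t + l..<t + l + N} - G))"
proof -
  have "{t..<t + N} - {t. \<forall>l<m. t + l \<in> G} \<subseteq> (\<Union>l<m. (\<lambda>u. u - l) ` ({t + l..<t + l + N} - G))"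
  proof
    fix u assume "u \<in> {t..<t + N} - {t. \<forall>l<m. t + l \<in> G}"
    then obtain l where l: "l < m" "u + l \<notin> G" "t \<le> u" "u < t + N" by auto
    have "u = (u + l) - l" "u + l \<in> {t + l..<t + l + N} - G" using l by auto
    then show "u \<in> (\<Union>l<m. (\<lambda>u. u - l) ` ({t + l..<t + l + N} - G))" using l(1) by blast
  qed
  then have "card ({t..<t + N} - {t. \<forall>l<m. t + l \<in> G}) \<le>
      card (\<Union>l<m. (\<lambda>u. u - l) ` ({t + l..<t + l + N} - G))"
    by (intro card_mono) auto
  also have "\<dots> \<le> (\<Sum>l<m. card ((\<lambda>u. u - l) ` ({t + l..<t + l + N} - G)))"
    by (rule card_UN_le) simp
  also have "\<dots> \<le> (\<Sum>l<m. card ({t + l..<t + l + N} - G))"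
    by (intro sum_mono card_image_le) simp
  finally show ?thesis .
qed

text \<open>A uniform approximation cannot be expected, since the phase fails to determine some
  letters. The polynomial is good at phases followed by \<open>m\<close> good positions; elsewhere
  the error is only bounded, by 3, but such positions are rare. The average bound on the orbit
  passes to \<open>X\<close> by continuity.\<close>

lemma approximation:
  assumes S: "det m S" and e: "0 < e"
  obtains T N0 where "T \<in> TP" "\<And>x. x \<in> X \<Longrightarrow> cmod (indicator S x - T x) \<le> 3"
    "\<And>N x. N0 \<le> N \<Longrightarrow> x \<in> X \<Longrightarrow> avg (\<lambda>x. cmod (indicator S x - T x)) N x \<le> e"
proof -
  define r where "r = min 1 (e / 2)"
  have r: "0 < r" "r \<le> 1" "r \<le> e / 2" using e by (auto simp: r_def)
  \<comment> \<open>The \<open>m\<close> shifts of the exceptional set, each with error at most 3,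
    contribute at most \<open>e / 2\<close>; the polynomial error \<open>r\<close> contributes the
    other half.\<close>
  define d where "d = e / (6 * (real m + 1))"
  have d: "0 < d" "3 * (real m * d) \<le> e / 2"
    using e by (auto simp: d_def field_simps)
  obtain e' :: real and G :: "nat set" and N0 :: nat where G: "0 < e'" "\<And>N t. N0 \<le> N \<Longrightarrow> card ({t..<t + N} - G) \<le> d * N"
    "\<forall>t\<in>G. \<forall>t'. rot_near f e' t t' \<longrightarrow> w t = w t'"
    using coincidence[OF d(1)] by blast
  define Gm where "Gm = {t. \<forall>l<m. t + l \<in> G}"
  obtain \<eta> where \<eta>0: "0 < \<eta>" "\<And>t t'. \<forall>l<m. t + l \<in> G \<Longrightarrow>
      dist (torus (pt t)) (torus (pt t')) < \<eta> \<Longrightarrow> pt t \<in> S \<longleftrightarrow> pt t' \<in> S"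
    by (rule torus_separates[OF S G(1) G(3)]) (rule that)
  have \<eta>: "0 < \<eta>" "\<And>t t'. t \<in> Gm \<Longrightarrow> dist (torus (pt t)) (torus (pt t')) < \<eta> \<Longrightarrow>
      pt t \<in> S \<longleftrightarrow> pt t' \<in> S"
    using \<eta>0 by (simp_all add: Gm_def)
  define A B where "A = closure ((\<lambda>t. torus (pt t)) ` {t \<in> Gm. pt t \<in> S})"
    and "B = closure ((\<lambda>t. torus (pt t)) ` {t \<in> Gm. pt t \<notin> S})"
  have "A \<inter> B = {}"
  proof (rule ccontr)
    assume "A \<inter> B \<noteq> {}"
    then obtain z where z: "z \<in> A" "z \<in> B" by blast
    have \<eta>2: "0 < \<eta> / 2" using \<eta> by simp
    obtain t where t: "t \<in> Gm" "pt t \<in> S" "dist (torus (pt t)) z < \<eta> / 2"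
      using z(1) \<eta>2 unfolding A_def closure_approachable by blast
    obtain t' where t': "t' \<in> Gm" "pt t' \<notin> S" "dist (torus (pt t')) z < \<eta> / 2"
      using z(2) \<eta>2 unfolding B_def closure_approachable by blast
    have "dist (torus (pt t)) (torus (pt t')) < \<eta>"
      using dist_triangle2[of "torus (pt t)" "torus (pt t')" z] t(3) t'(3) by simp
    then show False using \<eta>(2)[OF t(1)] t t' by blast
  qed
  then obtain g :: "complex \<times> complex \<times> complex \<Rightarrow> real" where g: "continuous_on UNIV g"
    "\<And>z. g z \<in> closed_segment 1 0" "\<And>z. z \<in> A \<Longrightarrow> g z = 1" "\<And>z. z \<in> B \<Longrightarrow> g z = 0"
    using Urysohn[of A B "1::real" 0] unfolding A_def B_def by auto
  define Y where "Y = closure (range (\<lambda>t. torus (pt t)))"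
  have "norm (torus (pt t)) \<le> 3" for t
    using norm_Pair_le[of "ev One t" "(ev Two t, ev Three t)"] norm_Pair_le[of "ev Two t" "ev Three t"]
    unfolding torus_pt by (simp add: ev_def)
  then have "bounded (range (\<lambda>t. torus (pt t)))" unfolding bounded_iff by blast
  then have "compact Y" unfolding Y_def by (simp add: compact_eq_bounded_closed bounded_closure)
  then obtain p where p: "real_polynomial_function p" "\<And>z. z \<in> Y \<Longrightarrow> \<bar>g z - p z\<bar> < r"
    using Stone_Weierstrass_real_polynomial_function[of Y g r] continuous_on_subset[OF g(1)] r by auto
  define T where "T x = complex_of_real (p (torus x))" for x
  have T: "T \<in> TP" unfolding T_def[abs_def] by (rule TP_polynomial[OF p(1)])
  define F where "F x = cmod (indicator S x - T x)" for x
  have gp: "\<bar>g (torus (pt t)) - p (torus (pt t))\<bar> < r" for t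
    by (rule p(2)) (simp add: Y_def closure_subset[THEN subsetD])
  have F_eq: "F (pt t) = \<bar>indicator S (pt t) - p (torus (pt t))\<bar>" for t
  proof -
    have "indicator S (pt t) - T (pt t) = complex_of_real (indicator S (pt t) - p (torus (pt t)))"
      by (simp add: T_def indicator_def)
    then show ?thesis unfolding F_def by (metis norm_of_real)
  qed
  have F3: "F (pt t) \<le> 3" for t
    using gp[of t] g(2)[of "torus (pt t)"] r unfolding F_eq
    by (auto simp: closed_segment_eq_real_ivl indicator_def split: if_splits)
  have Fr: "F (pt t) \<le> r" if "t \<in> Gm" for t
  proof -
    have "g (torus (pt t)) = indicator S (pt t)"
    proof (cases "pt t \<in> S")
      case True
      then have "torus (pt t) \<in> A" unfolding A_def using that by (intro closure_subset[THEN subsetD]) auto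
      then show ?thesis using g(3) True by simp
    next
      case False
      then have "torus (pt t) \<in> B" unfolding B_def using that by (intro closure_subset[THEN subsetD]) auto
      then show ?thesis using g(4) False by simp
    qed
    then show ?thesis using gp[of t] unfolding F_eq by simp
  qed
  have cF: "continuous_on X F"
    unfolding F_def[abs_def] by (intro continuous_intros TP_continuous T continuous_on_indicator_det[OF S])
  have avg_pt: "avg F N (pt t) \<le> e" if N: "N0 \<le> N" for N t
  proof (cases "N = 0")
    case True then show ?thesis using e by (simp add: avg_def)
  next
    case False
    have "(\<Sum>u<N. F (pt (t + u))) \<le> (\<Sum>u<N. r + 3 * of_bool (t + u \<notin> Gm))"
    proof (rule sum_mono)
      fix u show "F (pt (t + u)) \<le> r + 3 * of_bool (t + u \<notin> Gm)"
        using F3[of "t + u"] Fr[of "t + u"] r by (cases "t + u \<in> Gm") auto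
    qed
    also have "\<dots> = r * N + 3 * real (card ({u. u < N \<and> t + u \<notin> Gm}))"
      by (simp add: sum.distrib sum_distrib_left[symmetric] sum_of_bool_eq Int_def Collect_conj_eq[symmetric] mult.commute)
    also have "card {u. u < N \<and> t + u \<notin> Gm} = card ({t..<t + N} - Gm)"
      by (rule bij_betw_same_card[of "\<lambda>u. t + u"], rule bij_betw_byWitness[where f' = "\<lambda>u. u - t"]) auto
    also have "real (card ({t..<t + N} - Gm)) \<le> (\<Sum>l<m. real (card ({t + l..<t + l + N} - G)))"
      using card_not_all[of t N m G] unfolding Gm_def by (simp flip: of_nat_sum)
    also have "\<dots> \<le> (\<Sum>l<m. d * N)" using G(2)[OF N] by (intro sum_mono) auto
    also have "\<dots> = real m * d * N" by simp
    finally have "(\<Sum>u<N. F (pt (t + u))) \<le> (r + 3 * (real m * d)) * N" by (simp add: algebra_simps)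
    also have "\<dots> \<le> e * N" using r d by (intro mult_right_mono) auto
    finally show ?thesis using False unfolding avg_def funpow_shift_pt
      by (simp add: pos_divide_le_eq)
  qed
  show thesis
  proof (rule that[OF T])
    show "cmod (indicator S x - T x) \<le> 3" if "x \<in> X" for x
      using le_on_orbit[OF cF F3 that] by (simp add: F_def)
    show "avg (\<lambda>x. cmod (indicator S x - T x)) N x \<le> e" if "N0 \<le> N" "x \<in> X" for N x
      using le_on_orbit[OF continuous_avg[OF cF] avg_pt[OF that(1)] that(2)]
      unfolding F_def[abs_def] .
  qed
qed

lemma norm_avg_le: "norm (avg F N x) \<le> avg (\<lambda>x. norm (F x)) N x"
  unfolding avg_def norm_divide using norm_sum[of "\<lambda>u. F ((shift ^^ u) x)" "{..<N}"]
  by (simp add: divide_right_mono)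

lemma avg_diff: "avg (\<lambda>x. F x - G x) N x = avg F N x - avg G N x"
  by (simp add: avg_def sum_subtractf diff_divide_distrib)

definition mean :: "word set \<Rightarrow> real" where
  "mean S = lim (\<lambda>N. avg (indicator S) N (pt 0))"

text \<open>Averages of the indicator stay close to those of a trigonometric polynomial, which
  converge uniformly on the orbit.\<close>

lemma mean:
  assumes S: "det m S" and e: "0 < e"
  obtains N0 where "\<And>N x. N0 \<le> N \<Longrightarrow> x \<in> X \<Longrightarrow> \<bar>avg (indicator S) N x - mean S\<bar> \<le> e"
proof -
  \<comment> \<open>Here \<open>M\<close> still depends on \<open>r\<close>. It suffices for the
    Cauchy property at \<open>pt 0\<close>, and the limit then inherits the uniformity.\<close>
  have near: "\<exists>M N0. \<forall>N\<ge>N0. \<forall>t. \<bar>avg (indicator S) N (pt t) - M\<bar> \<le> r" if r: "0 < r" for r :: real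
  proof -
    have r2: "0 < r / 2" using r by simp
    obtain T N0 where T: "T \<in> TP" "\<And>x. x \<in> X \<Longrightarrow> cmod (indicator S x - T x) \<le> 3"
      "\<And>N x. N0 \<le> N \<Longrightarrow> x \<in> X \<Longrightarrow> avg (\<lambda>x. cmod (indicator S x - T x)) N x \<le> r / 2"
      by (rule approximation[OF S r2]) (rule that)
    obtain M where "uniform_limit UNIV (\<lambda>N t. avg T N (pt t)) (\<lambda>_. M) sequentially"
      using TP_avg[OF T(1)] by blast
    from uniform_limitD[OF this r2] obtain N1
      where M: "\<And>N t. N1 \<le> N \<Longrightarrow> cmod (avg T N (pt t) - M) < r / 2"
      by (auto simp: eventually_sequentially dist_norm)
    have "\<bar>avg (indicator S) N (pt t) - Re M\<bar> \<le> r" if "max N0 N1 \<le> N" for N t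
    proof -
      have "cmod (avg (indicator S) N (pt t) - avg T N (pt t)) \<le> r / 2"
        using norm_avg_le[of "\<lambda>x. indicator S x - T x" N "pt t"] T(3)[of N "pt t"] that
        unfolding avg_diff by simp
      then have "cmod (avg (indicator S) N (pt t) - M) \<le> r"
        using less_imp_le[OF M[of N t]] that norm_triangle_ineq[of "avg (indicator S) N (pt t) - avg T N (pt t)" "avg T N (pt t) - M"]
        by simp
      moreover have "avg (indicator S) N (pt t) = complex_of_real (avg (indicator S) N (pt t))"
        by (simp add: avg_def indicator_def)
      ultimately show ?thesis
        using abs_Re_le_cmod[of "complex_of_real (avg (indicator S) N (pt t)) - M"] by simp
    qed
    then show ?thesis by blast
  qed
  have "Cauchy (\<lambda>N. avg (indicator S) N (pt 0) :: real)"
  proof (rule CauchyI)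
    fix r :: real assume "0 < r"
    then obtain M N0 where M: "\<And>N t. N0 \<le> N \<Longrightarrow> \<bar>avg (indicator S) N (pt t) - M\<bar> \<le> r / 3"
      using near[of "r / 3"] by auto
    have "norm (avg (indicator S) i (pt 0) - avg (indicator S) j (pt 0) :: real) < r" if "N0 \<le> i" "N0 \<le> j" for i j
      using M[OF that(1), of 0] M[OF that(2), of 0] \<open>0 < r\<close> unfolding real_norm_def by linarith
    then show "\<exists>M. \<forall>m\<ge>M. \<forall>n\<ge>M. norm (avg (indicator S) m (pt 0) - avg (indicator S) n (pt 0) :: real) < r"
      by blast
  qed
  then have lim: "(\<lambda>N. avg (indicator S) N (pt 0)) \<longlonglongrightarrow> mean S"
    unfolding mean_def by (simp add: Cauchy_convergent_iff convergent_LIMSEQ_iff)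
  obtain M N0 where M: "\<And>N t. N0 \<le> N \<Longrightarrow> \<bar>avg (indicator S) N (pt t) - M\<bar> \<le> e / 2"
    using near[of "e / 2"] e by auto
  have "(\<lambda>N. \<bar>avg (indicator S) N (pt 0) - M\<bar>) \<longlonglongrightarrow> \<bar>mean S - M\<bar>"
    by (intro tendsto_intros lim)
  then have "\<bar>mean S - M\<bar> \<le> e / 2" using M by (meson LIMSEQ_le_const2)
  then have pt: "\<bar>avg (indicator S) N (pt t) - mean S\<bar> \<le> e" if "N0 \<le> N" for N t
    using M[OF that, of t] by linarith
  have "continuous_on X (\<lambda>x. \<bar>avg (indicator S) N x - mean S\<bar>)" for N
    by (intro continuous_intros continuous_avg continuous_on_indicator_det[OF S])
  from le_on_orbit[OF this pt] show thesis by (rule that)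
qed

end

section \<open>The invariant measure\<close>

lemma det_max: "det m S \<Longrightarrow> det (max m n) S" "det n S \<Longrightarrow> det (max m n) S"
  by (auto intro: det_mono)

lemma det_Int: "det m S \<Longrightarrow> det n T \<Longrightarrow> det (max m n) (S \<inter> T)"
  and det_Un: "det m S \<Longrightarrow> det n T \<Longrightarrow> det (max m n) (S \<union> T)"
proof -
  assume "det m S" "det n T"
  then have "det (max m n) S" "det (max m n) T" by (simp_all add: det_max)
  then show "det (max m n) (S \<inter> T)" "det (max m n) (S \<union> T)" unfolding det_def by blast+
qed

lemma det_Compl: "det m S \<Longrightarrow> det m (- S)"
  and det_UNIV: "det 0 UNIV" and det_empty: "det 0 {}"
  by (auto simp: det_def)

lemma det_open: "det m S \<Longrightarrow> open S"
  unfolding open_word_iff det_def by blast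

lemma det_closed: "det m S \<Longrightarrow> closed S"
  using det_open[OF det_Compl] by (simp add: closed_def)

definition clopens :: "word set \<Rightarrow> word set set" where
  "clopens X = {S \<inter> X | S. \<exists>m. det m S}"

lemma clopensI: "det m S \<Longrightarrow> S \<inter> X \<in> clopens X"
  by (auto simp: clopens_def)

lemma clopensE:
  assumes "A \<in> clopens X" obtains S m where "A = S \<inter> X" "det m S"
  using assms by (auto simp: clopens_def)

lemma clopens_Pow: "clopens X \<subseteq> Pow X"
  by (auto simp: clopens_def)

lemma algebra_clopens: "algebra X (clopens X)"
  unfolding algebra_iff_Un
proof (intro conjI ballI)
  show "{} \<in> clopens X" using clopensI[OF det_empty, of X] by simp
  fix A assume "A \<in> clopens X"
  then obtain S m where A: "A = S \<inter> X" "det m S" by (auto simp: clopens_def)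
  have "X - A = - S \<inter> X" using A by auto
  then show "X - A \<in> clopens X" using clopensI[OF det_Compl[OF A(2)]] by simp
  fix B assume "B \<in> clopens X"
  then obtain T n where B: "B = T \<inter> X" "det n T" by (auto simp: clopens_def)
  have "A \<union> B = (S \<union> T) \<inter> X" using A B by auto
  then show "A \<union> B \<in> clopens X" using clopensI[OF det_Un[OF A(2) B(2)]] by simp
qed (rule clopens_Pow)

lemma Int_stable_clopens: "Int_stable (clopens X)"
proof (rule Int_stableI)
  fix A B assume "A \<in> clopens X" "B \<in> clopens X"
  then obtain S T m n where "A = S \<inter> X" "det m S" "B = T \<inter> X" "det n T"
    by (auto simp: clopens_def)
  moreover then have "A \<inter> B = (S \<inter> T) \<inter> X" by blast
  ultimately show "A \<inter> B \<in> clopens X" using clopensI[OF det_Int] by metis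
qed

text \<open>An open set is the union of the cylinders inside it, and there are only countably many
  finite words.\<close>

lemma sets_restrict_borel: "sets (restrict_space borel X) = sigma_sets X (clopens X)"
proof (rule antisym)
  interpret S: sigma_algebra X "sigma_sets X (clopens X)"
    by (rule sigma_algebra_sigma_sets[OF clopens_Pow])
  have "X \<inter> B \<in> sigma_sets X (clopens X)" if "B \<in> sets borel" for B
  proof -
    have "B \<in> sigma_sets UNIV {U. open U}" using that by (simp add: borel_def)
    then show ?thesis
    proof (induction rule: sigma_sets.induct)
      case (Basic U)
      define cyl where "cyl l = {x :: word. map x [0..<length l] = l}" for l
      have det: "det (length l) (cyl l)" for l
        unfolding det_def
      proof (intro allI impI)
        fix x y assume "agree (length l) x y"
        then have "map x [0..<length l] = map y [0..<length l]" by (simp add: agree_def)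
        then show "x \<in> cyl l \<longleftrightarrow> y \<in> cyl l" unfolding cyl_def mem_Collect_eq by (simp only:)
      qed
      have "U = (\<Union>l\<in>{l. cyl l \<subseteq> U}. cyl l)"
      proof (intro antisym subsetI)
        fix x assume "x \<in> U"
        then obtain N where N: "\<And>y. agree N x y \<Longrightarrow> y \<in> U"
          using Basic unfolding mem_Collect_eq open_word_iff by blast
        have "cyl (map x [0..<N]) \<subseteq> U"
          unfolding cyl_def by (auto intro!: N simp: agree_def)
        moreover have "x \<in> cyl (map x [0..<N])" by (simp add: cyl_def)
        ultimately show "x \<in> (\<Union>l\<in>{l. cyl l \<subseteq> U}. cyl l)" by blast
      qed blast
      then have "X \<inter> U = (\<Union>l\<in>{l. cyl l \<subseteq> U}. cyl l \<inter> X)" by blast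
      moreover have "(\<Union>l\<in>{l. cyl l \<subseteq> U}. cyl l \<inter> X) \<in> sigma_sets X (clopens X)"
        by (rule S.countable_UN') (auto intro!: sigma_sets.Basic clopensI det)
      ultimately show ?case by simp
    next
      case Empty then show ?case by simp
    next
      case (Compl B)
      have "X \<inter> (UNIV - B) = X - (X \<inter> B)" by blast
      then show ?case using Compl.IH S.compl_sets by simp
    next
      case (Union B)
      have "X \<inter> (\<Union>i. B i) = (\<Union>i. X \<inter> B i)" by blast
      then show ?case using S.countable_nat_UN[of "\<lambda>i. X \<inter> B i"] Union.IH by auto
    qed
  qed
  then show "sets (restrict_space borel X) \<subseteq> sigma_sets X (clopens X)"
    by (auto simp: sets_restrict_space)
  show "sigma_sets X (clopens X) \<subseteq> sets (restrict_space borel X)"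
  proof (rule sets.sigma_sets_subset')
    show "clopens X \<subseteq> sets (restrict_space borel X)"
      unfolding clopens_def sets_restrict_space using det_open by (auto simp: Int_commute)
    show "X \<in> sets (restrict_space borel X)" by (auto simp: sets_restrict_space image_iff)
  qed
qed

section \<open>Existence of the invariant measure\<close>

context word_rotation
begin

lemma mean_lim:
  assumes "det m S" "x \<in> X"
  shows "(\<lambda>N. avg (indicator S) N x) \<longlonglongrightarrow> mean S"
proof (rule LIMSEQ_I)
  fix r :: real assume r: "0 < r"
  then have "0 < r / 2" by simp
  then obtain N0 where N0: "\<And>N x. N0 \<le> N \<Longrightarrow> x \<in> X \<Longrightarrow> \<bar>avg (indicator S) N x - mean S\<bar> \<le> r / 2"
    by (rule mean[OF assms(1)]) (rule that)
  have "norm (avg (indicator S) N x - mean S) < r" if "N0 \<le> N" for N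
    using N0[OF that assms(2)] r by simp
  then show "\<exists>N0. \<forall>N\<ge>N0. norm (avg (indicator S) N x - mean S) < r" by blast
qed

lemma avg_restrict: "x \<in> X \<Longrightarrow> avg (indicator (S \<inter> X)) N x = avg (indicator S) N x"
  unfolding avg_def by (simp add: indicator_inter_arith funpow_shift_X)

lemma mean_restrict: "mean (S \<inter> X) = mean S"
  unfolding mean_def by (simp add: avg_restrict)

lemma mean_nonneg: "det m S \<Longrightarrow> 0 \<le> mean S"
  by (rule LIMSEQ_le_const[OF mean_lim[OF _ pt_in_X]]) (auto simp: avg_def intro!: divide_nonneg_nonneg sum_nonneg)

lemma mean_UNIV: "mean UNIV = 1"
proof (rule LIMSEQ_unique[OF mean_lim[OF det_UNIV pt_in_X[of 0]]])
  have "avg (indicator UNIV) N (pt 0) = (1::real)" if "1 \<le> N" for N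
    using that by (simp add: avg_def)
  then show "(\<lambda>N. avg (indicator UNIV) N (pt 0)) \<longlonglongrightarrow> (1::real)"
    by (intro tendsto_eventually eventually_sequentiallyI[of 1]) auto
qed

lemma mean_empty: "mean {} = 0"
  unfolding mean_def by (simp add: avg_def)

lemma mean_add:
  assumes "det m S" "det n T" "S \<inter> T \<inter> X = {}"
  shows "mean (S \<union> T) = mean S + mean T"
proof (rule LIMSEQ_unique[OF mean_lim[OF det_Un[OF assms(1,2)] pt_in_X[of 0]]])
  have "avg (indicator (S \<union> T)) N (pt 0) = (avg (indicator S) N (pt 0) + avg (indicator T) N (pt 0) :: real)" for N
    unfolding avg_def add_divide_distrib[symmetric] sum.distrib[symmetric]
    using assms(3) funpow_shift_X[OF pt_in_X[of 0]]
    by (intro arg_cong2[where f="(/)"] sum.cong) (auto simp: indicator_def)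
  then show "(\<lambda>N. avg (indicator (S \<union> T)) N (pt 0)) \<longlonglongrightarrow> mean S + mean T"
    by (simp add: tendsto_add mean_lim[OF assms(1)] mean_lim[OF assms(2)])
qed

lemma det_shift: "det m S \<Longrightarrow> det (Suc m) (shift -` S)"
  unfolding det_def using agree_shift by blast

lemma mean_shift:
  assumes "det m S" shows "mean (shift -` S) = mean S"
proof (rule LIMSEQ_unique[OF mean_lim[OF det_shift[OF assms] pt_in_X[of 0]]])
  have "avg (indicator (shift -` S)) N (pt 0) = (avg (indicator S) N (pt 1) :: real)" for N
    unfolding avg_def funpow_shift_pt by (simp add: indicator_def shift_pt)
  then show "(\<lambda>N. avg (indicator (shift -` S)) N (pt 0)) \<longlonglongrightarrow> mean S"
    using mean_lim[OF assms pt_in_X[of 1]] by simp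
qed

lemma compact_X: "compact X"
  using compact_word closed_Int_compact[of X UNIV] by (simp add: orbit_closure_def)

text \<open>Compactness in the form of the finite intersection property. It makes continuity at the
  empty set, as required for the Caratheodory extension, trivial.\<close>

lemma decreasing_clopens:
  assumes A: "range A \<subseteq> clopens X" "decseq A" "(\<Inter>i. A i) = {}"
  shows "\<exists>i. A i = {}"
proof (rule ccontr)
  assume ne: "\<nexists>i. A i = {}"
  have "\<exists>S m. A i = S \<inter> X \<and> det m S" for i
  proof -
    have "A i \<in> clopens X" using A(1) by blast
    then show ?thesis by (auto simp: clopens_def)
  qed
  then obtain S m where S: "\<And>i. A i = S i \<inter> X" "\<And>i. det (m i) (S i)" by metis
  have "X \<inter> (\<Inter>i\<in>UNIV. S i) \<noteq> {}"
  proof (rule compact_imp_fip_image[OF compact_X det_closed[OF S(2)]])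
    fix I :: "nat set" assume I: "finite I"
    then obtain n where n: "\<And>i. i \<in> I \<Longrightarrow> i \<le> n" using finite_nat_set_iff_bounded_le by auto
    have "A n \<subseteq> X \<inter> (\<Inter>i\<in>I. S i)" using S(1) n decseqD[OF A(2)] by blast
    then show "X \<inter> (\<Inter>i\<in>I. S i) \<noteq> {}" using ne by blast
  qed
  then show False using A(3) S(1) by blast
qed

lemma ex_measure:
  obtains \<mu> where "sets \<mu> = sigma_sets X (clopens X)" "\<And>m S. det m S \<Longrightarrow> emeasure \<mu> (S \<inter> X) = ennreal (mean S)"
proof -
  interpret A: algebra X "clopens X" by (rule algebra_clopens)
  let ?f = "\<lambda>A. ennreal (mean A)"
  have "\<exists>\<mu>. (\<forall>s\<in>clopens X. \<mu> s = ?f s) \<and> measure_space X (sigma_sets X (clopens X)) \<mu>"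
  proof (rule A.caratheodory_empty_continuous)
    show "positive (clopens X) ?f" by (simp add: positive_def mean_empty)
    show "additive (clopens X) ?f"
      unfolding additive_def
    proof (intro ballI impI)
      fix A B assume A: "A \<in> clopens X" and B: "B \<in> clopens X" and d: "A \<inter> B = {}"
      obtain S m where S: "A = S \<inter> X" "det m S" by (rule clopensE[OF A])
      obtain T n where T: "B = T \<inter> X" "det n T" by (rule clopensE[OF B])
      have "mean (A \<union> B) = mean ((S \<union> T) \<inter> X)" unfolding S T by (simp add: Int_Un_distrib2)
      also have "\<dots> = mean S + mean T"
        unfolding mean_restrict by (rule mean_add[OF S(2) T(2)]) (use d S T in auto)
      finally show "?f (A \<union> B) = ?f A + ?f B"
        unfolding S T mean_restrict using mean_nonneg[OF S(2)] mean_nonneg[OF T(2)] by simp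
    qed
    show "(\<lambda>i. ?f (A i)) \<longlonglongrightarrow> 0"
      if A: "range A \<subseteq> clopens X" "decseq A" "(\<Inter>i. A i) = {}" for A
    proof -
      obtain i where "A i = {}" using decreasing_clopens[OF A] by blast
      then have "A j = {}" if "i \<le> j" for j using decseqD[OF A(2) that] by blast
      then have "\<forall>\<^sub>F j in sequentially. ?f (A j) = 0"
        by (intro eventually_sequentiallyI[of i]) (simp add: mean_empty)
      then show ?thesis by (rule tendsto_eventually)
    qed
  qed simp
  then obtain \<mu> where \<mu>: "\<And>s. s \<in> clopens X \<Longrightarrow> \<mu> s = ?f s" "measure_space X (sigma_sets X (clopens X)) \<mu>"
    by blast
  define M where "M = measure_of X (clopens X) \<mu>"
  show thesis
  proof (rule that[of M])
    show "sets M = sigma_sets X (clopens X)" by (simp add: M_def clopens_Pow)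
    fix m S assume "det m S"
    then have c: "S \<inter> X \<in> clopens X" by (rule clopensI)
    have "emeasure M (S \<inter> X) = \<mu> (S \<inter> X)"
      unfolding M_def
    proof (rule emeasure_measure_of[OF refl])
      show "positive (sets (measure_of X (clopens X) \<mu>)) \<mu>" "countably_additive (sets (measure_of X (clopens X) \<mu>)) \<mu>"
        using \<mu>(2) by (simp_all add: clopens_Pow measure_space_def)
    qed (use c clopens_Pow in auto)
    then show "emeasure M (S \<inter> X) = ennreal (mean S)" using \<mu>(1)[OF c] by (simp add: mean_restrict)
  qed
qed

lemma eqI_clopens:
  assumes "sets M = sigma_sets X (clopens X)" "sets N = sigma_sets X (clopens X)"
    and "\<And>m S. det m S \<Longrightarrow> emeasure M (S \<inter> X) = ennreal (mean S)"
    and "\<And>m S. det m S \<Longrightarrow> emeasure N (S \<inter> X) = ennreal (mean S)"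
  shows "M = N"
proof (rule measure_eqI_generator_eq[OF Int_stable_clopens clopens_Pow _ assms(1,2)])
  show "emeasure M A = emeasure N A" if "A \<in> clopens X" for A
    using that assms(3,4) by (auto simp: clopens_def)
  show "range (\<lambda>_. X) \<subseteq> clopens X" using clopensI[OF det_UNIV, of X] by auto
  show "emeasure M X \<noteq> \<infinity>" using assms(3)[OF det_UNIV] by (simp add: mean_UNIV)
qed simp

lemma ex_invariant: "\<exists>\<mu>. shift_invariant_prob X \<mu>"
proof -
  obtain \<mu> where \<mu>: "sets \<mu> = sigma_sets X (clopens X)"
    "\<And>m S. det m S \<Longrightarrow> emeasure \<mu> (S \<inter> X) = ennreal (mean S)"
    by (rule ex_measure) (rule that)
  have sp: "space \<mu> = X"
    using sets_eq_imp_space_eq[of \<mu> "restrict_space borel X"] \<mu>(1)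
    by (simp add: sets_restrict_borel space_restrict_space)
  have m: "shift \<in> measurable \<mu> \<mu>"
  proof (rule measurable_sigma_sets[OF \<mu>(1) clopens_Pow])
    show "shift \<in> space \<mu> \<rightarrow> X" using shift_X sp by auto
    fix A assume "A \<in> clopens X"
    then obtain S n where S: "A = S \<inter> X" "det n S" by (auto simp: clopens_def)
    have "shift -` A \<inter> space \<mu> = (shift -` S) \<inter> X" using S sp shift_X by auto
    then show "shift -` A \<inter> space \<mu> \<in> sets \<mu>"
      unfolding \<mu>(1) using clopensI[OF det_shift[OF S(2)]] by (auto intro: sigma_sets.Basic)
  qed
  have "prob_space \<mu>" using \<mu>(2)[OF det_UNIV] by (intro prob_spaceI) (simp add: sp mean_UNIV)
  moreover have "distr \<mu> \<mu> shift = \<mu>"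
  proof (rule eqI_clopens)
    fix n S assume S: "det n S"
    have "S \<inter> X \<in> sets \<mu>" unfolding \<mu>(1) using clopensI[OF S] by (rule sigma_sets.Basic)
    then have "emeasure (distr \<mu> \<mu> shift) (S \<inter> X) = emeasure \<mu> (shift -` (S \<inter> X) \<inter> X)"
      by (simp add: emeasure_distr[OF m] sp)
    also have "shift -` (S \<inter> X) \<inter> X = (shift -` S) \<inter> X" using shift_X by auto
    finally show "emeasure (distr \<mu> \<mu> shift) (S \<inter> X) = ennreal (mean S)"
      using \<mu>(2)[OF det_shift[OF S]] mean_shift[OF S] by simp
  qed (use \<mu> in auto)
  ultimately show ?thesis
    using m \<mu>(1) unfolding shift_invariant_prob_def sets_restrict_borel by blast
qed

end

section \<open>Uniqueness of the invariant measure\<close>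

locale invariant_measure = word_rotation +
  fixes \<nu> :: "word measure"
  assumes inv: "shift_invariant_prob (orbit_closure w) \<nu>"
begin

lemma sets_nu: "sets \<nu> = sets (restrict_space borel X)"
  and shift_measurable: "shift \<in> measurable \<nu> \<nu>"
  and distr_shift: "distr \<nu> \<nu> shift = \<nu>"
  using inv unfolding shift_invariant_prob_def by auto

sublocale prob_space \<nu>
  using inv unfolding shift_invariant_prob_def by auto

lemma space_nu: "space \<nu> = X"
  using sets_eq_imp_space_eq[OF sets_nu] by (simp add: space_restrict_space)

lemma continuous_measurable:
  fixes F :: "word \<Rightarrow> 'b::topological_space"
  assumes "continuous_on X F" shows "F \<in> borel_measurable \<nu>"
  using borel_measurable_continuous_on_restrict[OF assms] measurable_cong_sets[OF sets_nu refl] by blast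

lemma integral_funpow_shift:
  fixes F :: "word \<Rightarrow> real"
  assumes F: "integrable \<nu> F"
  shows "integrable \<nu> (\<lambda>x. F ((shift ^^ u) x)) \<and> (\<integral>x. F ((shift ^^ u) x) \<partial>\<nu>) = (\<integral>x. F x \<partial>\<nu>)"
proof (induction u)
  case (Suc u)
  let ?g = "\<lambda>x. F ((shift ^^ u) x)"
  have "integrable (distr \<nu> \<nu> shift) ?g" using Suc distr_shift by simp
  then have "integrable \<nu> (\<lambda>x. ?g (shift x))" by (rule integrable_distr[OF shift_measurable])
  moreover have "(\<integral>x. ?g (shift x) \<partial>\<nu>) = (\<integral>x. ?g x \<partial>distr \<nu> \<nu> shift)"
    using Suc by (intro integral_distr[symmetric] shift_measurable) (simp add: borel_measurable_integrable)
  ultimately show ?case using Suc distr_shift by (simp add: funpow_swap1)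
qed (use F in simp)

lemma integral_avg:
  fixes F :: "word \<Rightarrow> real"
  assumes "integrable \<nu> F" "0 < N"
  shows "integrable \<nu> (avg F N)" "(\<integral>x. avg F N x \<partial>\<nu>) = (\<integral>x. F x \<partial>\<nu>)"
  using integral_funpow_shift[OF assms(1)] assms(2) unfolding avg_def by auto

text \<open>An invariant measure integrates the averages of a function like the function itself, and
  these averages are uniformly close to the constant \<open>mean S\<close>.\<close>

lemma measure_clopen:
  assumes S: "det m S" shows "measure \<nu> (S \<inter> X) = mean S"
proof -
  let ?F = "indicator S :: word \<Rightarrow> real"
  have F: "integrable \<nu> ?F"
    using continuous_measurable[OF continuous_on_indicator_det[OF S]] by (intro integrable_const_bound[of _ 1]) auto
  have "\<bar>measure \<nu> (S \<inter> X) - mean S\<bar> \<le> e" if e: "0 < e" for e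
  proof -
    obtain N0 where N0: "\<And>N x. N0 \<le> N \<Longrightarrow> x \<in> X \<Longrightarrow> \<bar>avg (indicator S) N x - mean S\<bar> \<le> e"
      by (rule mean[OF S e]) (rule that)
    define N where "N = Suc N0"
    have i: "integrable \<nu> (avg ?F N)" "(\<integral>x. avg ?F N x \<partial>\<nu>) = (\<integral>x. ?F x \<partial>\<nu>)"
      using integral_avg[OF F, of N] by (auto simp: N_def)
    have "(\<integral>x. ?F x \<partial>\<nu>) = measure \<nu> (S \<inter> X)"
      by (simp add: space_nu flip: integral_indicator) 
    then have "measure \<nu> (S \<inter> X) - mean S = (\<integral>x. avg ?F N x - mean S \<partial>\<nu>)"
      using i by (simp add: prob_space)
    also have "\<bar>\<dots>\<bar> \<le> (\<integral>x. \<bar>avg ?F N x - mean S\<bar> \<partial>\<nu>)" by (rule integral_abs_bound)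
    also have "\<dots> \<le> (\<integral>x. e \<partial>\<nu>)"
      using i N0[of N] by (intro integral_mono) (auto simp: space_nu N_def)
    finally show ?thesis by (simp add: prob_space)
  qed
  then show ?thesis using eq_if_le_all[of "measure \<nu> (S \<inter> X)" "mean S"] by simp
qed

end

context word_rotation
begin

lemma invariant_unique:
  assumes "shift_invariant_prob X M" "shift_invariant_prob X N" shows "M = N"
proof -
  interpret M: invariant_measure w f M by unfold_locales (rule assms)
  interpret N: invariant_measure w f N by unfold_locales (rule assms)
  show ?thesis
    by (rule eqI_clopens)
      (simp_all add: M.sets_nu N.sets_nu sets_restrict_borel M.emeasure_eq_measure N.emeasure_eq_measure
        M.measure_clopen N.measure_clopen)
qed

end

section \<open>Pure discrete spectrum\<close>

lemma norm_add_square_le: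
  fixes a b :: "'a::real_normed_vector"
  shows "(norm (a + b))\<^sup>2 \<le> 2 * (norm a)\<^sup>2 + 2 * (norm b)\<^sup>2"
proof -
  have "(norm (a + b))\<^sup>2 \<le> (norm a + norm b)\<^sup>2"
    by (intro power_mono norm_triangle_ineq) auto
  also have "\<dots> \<le> 2 * (norm a)\<^sup>2 + 2 * (norm b)\<^sup>2"
    using zero_le_power2[of "norm a - norm b"] by (simp add: power2_eq_square algebra_simps)
  finally show ?thesis .
qed

section \<open>Density of trigonometric polynomials in the L2 norm\<close>

context invariant_measure
begin

lemma TP_measurable: "F \<in> TP \<Longrightarrow> F \<in> borel_measurable \<nu>"
  by (rule continuous_measurable[OF TP_continuous])

text \<open>The bound \<open>r\<close> is on the squared distance. Integrability is demanded because
  the integral of a function that is not integrable is 0 by convention.\<close>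

definition close :: "(word \<Rightarrow> complex) \<Rightarrow> (word \<Rightarrow> complex) \<Rightarrow> real \<Rightarrow> bool" where
  "close g h r \<longleftrightarrow> g \<in> borel_measurable \<nu> \<and> h \<in> borel_measurable \<nu> \<and>
    integrable \<nu> (\<lambda>x. (cmod (g x - h x))\<^sup>2) \<and> (\<integral>x. (cmod (g x - h x))\<^sup>2 \<partial>\<nu>) \<le> r"

text \<open>Triangle inequality without square roots, at the price of a factor 2; hence the quarters
  \<open>r / 4\<close> below. The form of \<open>d\<close> covers both transitivity and
  sums.\<close>

lemma close_sum:
  assumes d: "\<And>x. x \<in> X \<Longrightarrow> g x - h x = (g1 x - h1 x) + (g2 x - h2 x)"
    and m: "g \<in> borel_measurable \<nu>" "h \<in> borel_measurable \<nu>"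
    and c: "close g1 h1 r" "close g2 h2 s"
  shows "close g h (2 * r + 2 * s)"
proof -
  let ?a = "\<lambda>x. (cmod (g1 x - h1 x))\<^sup>2" and ?b = "\<lambda>x. (cmod (g2 x - h2 x))\<^sup>2"
  have i: "integrable \<nu> (\<lambda>x. 2 * ?a x + 2 * ?b x)" using c by (simp add: close_def)
  have le: "(cmod (g x - h x))\<^sup>2 \<le> 2 * ?a x + 2 * ?b x" if "x \<in> X" for x
    unfolding d[OF that] by (rule norm_add_square_le)
  have int: "integrable \<nu> (\<lambda>x. (cmod (g x - h x))\<^sup>2)"
    by (rule Bochner_Integration.integrable_bound[OF i]) (use m le space_nu in auto)
  have "(\<integral>x. (cmod (g x - h x))\<^sup>2 \<partial>\<nu>) \<le> (\<integral>x. 2 * ?a x + 2 * ?b x \<partial>\<nu>)"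
    using le space_nu by (intro integral_mono int i) auto
  also have "\<dots> = 2 * (\<integral>x. ?a x \<partial>\<nu>) + 2 * (\<integral>x. ?b x \<partial>\<nu>)"
    using c by (simp add: close_def)
  also have "\<dots> \<le> 2 * r + 2 * s" using c by (intro add_mono) (auto simp: close_def)
  finally show ?thesis using m int by (simp add: close_def)
qed

definition approximable :: "(word \<Rightarrow> complex) \<Rightarrow> bool" where
  "approximable g \<longleftrightarrow> (\<forall>r>0. \<exists>T\<in>TP. close g T r)"

lemma approximable_measurable: "approximable g \<Longrightarrow> g \<in> borel_measurable \<nu>"
  unfolding approximable_def close_def using zero_less_one by blast

lemma approximable_limit:
  assumes "\<And>r. 0 < r \<Longrightarrow> \<exists>h. approximable h \<and> close g h r"
  shows "approximable g"
  unfolding approximable_def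
proof (intro allI impI)
  fix r :: real assume "0 < r"
  then have r: "0 < r / 4" by simp
  obtain h where h: "approximable h" "close g h (r / 4)" using assms[OF r] by blast
  obtain T where T: "T \<in> TP" "close h T (r / 4)" using h(1) r unfolding approximable_def by blast
  have "close g T (2 * (r / 4) + 2 * (r / 4))"
    by (rule close_sum[OF _ _ _ h(2) T(2)]) (use h(2) T(2) in \<open>auto simp: close_def\<close>)
  then show "\<exists>T\<in>TP. close g T r" using T(1) by auto
qed

lemma approximable_add:
  assumes "approximable g" "approximable h" shows "approximable (\<lambda>x. g x + h x)"
  unfolding approximable_def
proof (intro allI impI)
  fix r :: real assume "0 < r"
  then have r: "0 < r / 4" by simp
  obtain T where T: "T \<in> TP" "close g T (r / 4)" using assms(1) r unfolding approximable_def by blast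
  obtain U where U: "U \<in> TP" "close h U (r / 4)" using assms(2) r unfolding approximable_def by blast
  have "close (\<lambda>x. g x + h x) (\<lambda>x. T x + U x) (2 * (r / 4) + 2 * (r / 4))"
    by (rule close_sum[OF _ _ _ T(2) U(2)]) (use T(2) U(2) in \<open>auto simp: close_def\<close>)
  then show "\<exists>T\<in>TP. close (\<lambda>x. g x + h x) T r" using TP.add[OF T(1) U(1)] by auto
qed

lemma approximable_TP: "T \<in> TP \<Longrightarrow> approximable T"
  unfolding approximable_def close_def by (auto intro!: bexI[of _ T] TP_measurable)

lemma approximable_scale:
  assumes "approximable g" shows "approximable (\<lambda>x. b * g x)"
  unfolding approximable_def
proof (intro allI impI)
  fix r :: real assume r: "0 < r"
  then have "0 < r / ((cmod b)\<^sup>2 + 1)" by (simp add: add_nonneg_pos)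
  then obtain T where T: "T \<in> TP" "close g T (r / ((cmod b)\<^sup>2 + 1))"
    using assms unfolding approximable_def by blast
  have e: "(cmod (b * g x - b * T x))\<^sup>2 = (cmod b)\<^sup>2 * (cmod (g x - T x))\<^sup>2" for x
    by (simp add: norm_mult power_mult_distrib flip: right_diff_distrib)
  have "(cmod b)\<^sup>2 * (\<integral>x. (cmod (g x - T x))\<^sup>2 \<partial>\<nu>) \<le> ((cmod b)\<^sup>2 + 1) * (r / ((cmod b)\<^sup>2 + 1))"
    using T(2) by (intro mult_mono) (auto simp: close_def)
  also have "\<dots> = r" by (simp add: add_nonneg_eq_0_iff)
  finally have "close (\<lambda>x. b * g x) (\<lambda>x. b * T x) r"
    using T(2) unfolding close_def e by auto
  then show "\<exists>T\<in>TP. close (\<lambda>x. b * g x) T r" using TP_scale[OF T(1)] by blast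
qed

lemma approximable_cong:
  assumes "approximable g" "\<And>x. x \<in> X \<Longrightarrow> h x = g x" shows "approximable h"
proof (rule approximable_limit)
  fix r :: real assume r: "0 < r"
  have g: "g \<in> borel_measurable \<nu>" by (rule approximable_measurable[OF assms(1)])
  have h: "h \<in> borel_measurable \<nu>"
    using g measurable_cong[of \<nu> h g borel] assms(2) space_nu by auto
  have "integrable \<nu> (\<lambda>x. (cmod (h x - g x))\<^sup>2) \<longleftrightarrow> integrable \<nu> (\<lambda>_. 0 :: real)"
    by (rule Bochner_Integration.integrable_cong[OF refl]) (simp add: assms(2) space_nu)
  moreover have "(\<integral>x. (cmod (h x - g x))\<^sup>2 \<partial>\<nu>) = (\<integral>x. 0 \<partial>\<nu>)"
    by (rule Bochner_Integration.integral_cong[OF refl]) (simp add: assms(2) space_nu)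
  ultimately have "close h g r" using g h r by (simp add: close_def)
  then show "\<exists>h'. approximable h' \<and> close h h' r" using assms(1) by blast
qed

lemma approximable_sum:
  "(\<And>i. i \<in> I \<Longrightarrow> approximable (g i)) \<Longrightarrow> approximable (\<lambda>x. \<Sum>i\<in>I. g i x)"
proof (induction I rule: infinite_finite_induct)
  case (insert i I)
  then have "approximable (\<lambda>x. g i x + (\<Sum>i\<in>I. g i x))" by (intro approximable_add) auto
  then show ?case using insert by simp
qed (use approximable_TP[OF TP_const[of 0]] in auto)

text \<open>As the error \<open>?F\<close> is at most 3,
  \<open>(?F x)\<^sup>2 \<le> 3 * ?F x\<close> reduces the squared error to the mean error, and
  invariance replaces \<open>?F\<close> by an average that is uniformly at most
  \<open>r / 3\<close>.\<close>

lemma approximable_clopen: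
  assumes S: "det m S" shows "approximable (indicator S)"
  unfolding approximable_def
proof (intro allI impI)
  fix r :: real assume "0 < r"
  then have r: "0 < r / 3" by simp
  obtain T N0 where T: "T \<in> TP" "\<And>x. x \<in> X \<Longrightarrow> cmod (indicator S x - T x) \<le> 3"
    "\<And>N x. N0 \<le> N \<Longrightarrow> x \<in> X \<Longrightarrow> avg (\<lambda>x. cmod (indicator S x - T x)) N x \<le> r / 3"
    by (rule approximation[OF S r]) (rule that)
  let ?F = "\<lambda>x. cmod (indicator S x - T x)"
  have cF: "continuous_on X ?F" by (intro continuous_intros TP_continuous T continuous_on_indicator_det[OF S])
  have mF: "?F \<in> borel_measurable \<nu>" by (rule continuous_measurable[OF cF])
  have F: "integrable \<nu> ?F"
    by (rule integrable_const_bound[of _ 3, OF _ mF]) (use T(2) space_nu in auto)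
  have F2: "integrable \<nu> (\<lambda>x. (?F x)\<^sup>2)"
  proof (rule integrable_const_bound[of _ 9])
    have "(?F x)\<^sup>2 \<le> 3\<^sup>2" if "x \<in> X" for x using T(2)[OF that] by (intro power_mono) auto
    then show "AE x in \<nu>. norm ((?F x)\<^sup>2) \<le> 9" using space_nu by (auto intro!: AE_I2)
  qed (use mF in measurable)
  have "(\<integral>x. (?F x)\<^sup>2 \<partial>\<nu>) \<le> (\<integral>x. 3 * ?F x \<partial>\<nu>)"
  proof (rule integral_mono[OF F2])
    show "(?F x)\<^sup>2 \<le> 3 * ?F x" if "x \<in> space \<nu>" for x
      unfolding power2_eq_square using T(2)[of x] that space_nu by (intro mult_right_mono) auto
  qed (use F in simp)
  also have "\<dots> = 3 * (\<integral>x. ?F x \<partial>\<nu>)" by simp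
  also have "(\<integral>x. ?F x \<partial>\<nu>) = (\<integral>x. avg ?F (Suc N0) x \<partial>\<nu>)" using integral_avg(2)[OF F] by simp
  also have "\<dots> \<le> (\<integral>x. r / 3 \<partial>\<nu>)"
    by (intro integral_mono integral_avg(1)[OF F]) (use T(3)[of "Suc N0"] space_nu in auto)
  finally have "(\<integral>x. (?F x)\<^sup>2 \<partial>\<nu>) \<le> r" by (simp add: prob_space)
  then have "close (indicator S) T r"
    unfolding close_def using F2 continuous_measurable[OF continuous_on_indicator_det[OF S]] TP_measurable[OF T(1)] by simp
  then show "\<exists>T\<in>TP. close (indicator S) T r" using T(1) by blast
qed

text \<open>Induction over the generated sigma-algebra in its disjoint form, where a countable union
  is approached in measure by its finite parts.\<close>

lemma approximable_indicator:
  assumes "A \<in> sets \<nu>" shows "approximable (indicator A)"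
proof -
  have "A \<in> sigma_sets X (clopens X)" using assms by (simp add: sets_nu sets_restrict_borel)
  from Int_stable_clopens clopens_Pow this show ?thesis
  proof (induction rule: sigma_sets_induct_disjoint)
    case (basic A)
    obtain S m where S: "A = S \<inter> X" "det m S" by (rule clopensE[OF basic])
    show ?case by (rule approximable_cong[OF approximable_clopen[OF S(2)]]) (simp add: S indicator_def)
  next
    case empty
    show ?case using approximable_TP[OF TP_const[of 0]] by simp
  next
    case (compl A)
    have "approximable (\<lambda>x. 1 + -1 * indicator A x)"
      by (intro approximable_add approximable_scale approximable_TP TP_const compl)
    then show ?case by (rule approximable_cong) (auto simp: indicator_def)
  next
    case (union D)
    have D: "D i \<in> sets \<nu>" for i using union(2) by (auto simp: sets_nu sets_restrict_borel)
    define U where "U n = (\<Union>i<n. D i)" for n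
    have U: "U n \<in> sets \<nu>" "U n \<subseteq> (\<Union>i. D i)" for n using D by (auto simp: U_def)
    have UD: "(\<Union>n. U n) = (\<Union>i. D i)" unfolding U_def by blast
    have "approximable (\<lambda>x. \<Sum>i<n. indicator (D i) x)" for n by (intro approximable_sum union)
    moreover have "indicator (U n) x = (\<Sum>i<n. indicator (D i) x :: complex)" for n x
      unfolding U_def by (intro indicator_UN_disjoint) (use union(1) in \<open>auto simp: disjoint_family_on_def\<close>)
    ultimately have aU: "approximable (indicator (U n))" for n using approximable_cong by metis
    have "(\<lambda>n. measure \<nu> (U n)) \<longlonglongrightarrow> measure \<nu> (\<Union>n. U n)"
    proof (rule finite_Lim_measure_incseq)
      show "incseq U" unfolding incseq_def U_def by (intro allI impI UN_mono) auto
    qed (use U in auto)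
    then have lim: "(\<lambda>n. measure \<nu> (U n)) \<longlonglongrightarrow> measure \<nu> (\<Union>i. D i)" unfolding UD .
    show ?case
    proof (rule approximable_limit)
      fix r :: real assume "0 < r"
      then obtain n where "norm (measure \<nu> (U n) - measure \<nu> (\<Union>i. D i)) < r" using LIMSEQ_D[OF lim] by blast
      then have n: "measure \<nu> ((\<Union>i. D i) - U n) \<le> r"
        using finite_measure_Diff[of "\<Union>i. D i" "U n"] U D by auto
      have e: "(cmod (indicator (\<Union>i. D i) x - indicator (U n) x))\<^sup>2 = indicator ((\<Union>i. D i) - U n) x" for x
        using U(2)[of n] by (auto simp: indicator_def)
      have "close (indicator (\<Union>i. D i)) (indicator (U n)) r"
        unfolding close_def e using n U(1)[of n] D by (auto simp: emeasure_eq_measure)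
      then show "\<exists>h. approximable h \<and> close (indicator (\<Union>i. D i)) h r" using aU by blast
    qed
  qed
qed

lemma approximable_simple:
  fixes s :: "word \<Rightarrow> complex"
  assumes s: "simple_function \<nu> s" shows "approximable s"
proof -
  have fin: "finite (s ` X)" and sets: "\<And>y. s -` {y} \<inter> X \<in> sets \<nu>"
    using simple_functionD[OF s] space_nu by auto
  have "approximable (\<lambda>x. \<Sum>y\<in>s ` X. y * indicator (s -` {y} \<inter> X) x)"
    by (intro approximable_sum approximable_scale approximable_indicator sets)
  then show ?thesis
  proof (rule approximable_cong)
    fix x assume x: "x \<in> X"
    have "(\<Sum>y\<in>s ` X. y * indicator (s -` {y} \<inter> X) x) = (\<Sum>y\<in>s ` X. if y = s x then s x else 0)"
      using x by (intro sum.cong) (auto simp: indicator_def)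
    then show "s x = (\<Sum>y\<in>s ` X. y * indicator (s -` {y} \<inter> X) x)" using fin x by simp
  qed
qed

lemma approximable_square_integrable:
  assumes "square_integrable \<nu> g" shows "approximable g"
proof (rule approximable_limit)
  fix r :: real assume r: "0 < r"
  have g: "g \<in> borel_measurable \<nu>" "integrable \<nu> (\<lambda>x. (cmod (g x))\<^sup>2)"
    using assms by (auto simp: square_integrable_def)
  obtain s where s: "\<And>i. simple_function \<nu> (s i)" "\<And>x. x \<in> space \<nu> \<Longrightarrow> (\<lambda>i. s i x) \<longlonglongrightarrow> g x"
    "\<And>i x. x \<in> space \<nu> \<Longrightarrow> dist (s i x) 0 \<le> 2 * dist (g x) 0"
    using borel_measurable_implies_sequence_metric[OF g(1), of 0] by blast
  have m: "s i \<in> borel_measurable \<nu>" for i by (rule borel_measurable_simple_function[OF s(1)])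
  have b: "(cmod (g x - s i x))\<^sup>2 \<le> 9 * (cmod (g x))\<^sup>2" if "x \<in> space \<nu>" for i x
  proof -
    have "cmod (g x - s i x) \<le> 3 * cmod (g x)"
      using norm_triangle_ineq4[of "g x" "s i x"] s(3)[OF that, of i] by (simp add: dist_norm)
    then have "(cmod (g x - s i x))\<^sup>2 \<le> (3 * cmod (g x))\<^sup>2" by (intro power_mono) auto
    then show ?thesis by (simp add: power_mult_distrib)
  qed
  have i9: "integrable \<nu> (\<lambda>x. 9 * (cmod (g x))\<^sup>2)" using g(2) by simp
  have int: "integrable \<nu> (\<lambda>x. (cmod (g x - s i x))\<^sup>2)" for i
    by (rule Bochner_Integration.integrable_bound[OF i9]) (use g(1) m b in auto)
  have "(\<lambda>i. \<integral>x. (cmod (g x - s i x))\<^sup>2 \<partial>\<nu>) \<longlonglongrightarrow> (\<integral>x. 0 \<partial>\<nu>)"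
  proof (rule integral_dominated_convergence[OF _ _ i9])
    show "AE x in \<nu>. (\<lambda>i. (cmod (g x - s i x))\<^sup>2) \<longlonglongrightarrow> 0"
    proof (rule AE_I2)
      fix x assume "x \<in> space \<nu>"
      then have "(\<lambda>i. (cmod (g x - s i x))\<^sup>2) \<longlonglongrightarrow> (cmod (g x - g x))\<^sup>2"
        by (intro tendsto_intros s(2))
      then show "(\<lambda>i. (cmod (g x - s i x))\<^sup>2) \<longlonglongrightarrow> 0" by simp
    qed
  qed (use g(1) m b in auto)
  then obtain i where "norm ((\<integral>x. (cmod (g x - s i x))\<^sup>2 \<partial>\<nu>) - (\<integral>x. 0 \<partial>\<nu>)) < r"
    using LIMSEQ_D[OF _ r] by blast
  then have "close g (s i) r" using g(1) m int by (simp add: close_def)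
  then show "\<exists>h. approximable h \<and> close g h r" using approximable_simple[OF s(1)] by blast
qed

lemma char_eigenfunction:
  assumes "char F" shows "eigenfunction \<nu> F"
proof -
  have n: "x \<in> X \<Longrightarrow> cmod (F x) = 1" for x using assms by (simp add: char_def)
  obtain z where z: "\<And>x. x \<in> X \<Longrightarrow> F (shift x) = z * F x" using assms unfolding char_def by blast
  have m: "F \<in> borel_measurable \<nu>" using assms by (simp add: char_def continuous_measurable)
  have "integrable \<nu> (\<lambda>x. (cmod (F x))\<^sup>2)"
    by (rule integrable_const_bound[of _ 1]) (use m n space_nu in auto)
  moreover have "\<not> (AE x in \<nu>. F x = 0)"
  proof
    assume "AE x in \<nu>. F x = 0"
    moreover have "AE x in \<nu>. F x \<noteq> 0" using n space_nu by (intro AE_I2) force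
    ultimately have "AE x in \<nu>. False" by eventually_elim simp
    then show False by (simp add: AE_False)
  qed
  moreover have "AE x in \<nu>. F (shift x) = z * F x" using z space_nu by (intro AE_I2) auto
  ultimately show ?thesis using m unfolding eigenfunction_def square_integrable_def by blast
qed

lemma spanned: "spanned_by_eigenfunctions \<nu>"
  unfolding spanned_by_eigenfunctions_def
proof (intro allI impI)
  fix g and e :: real assume g: "square_integrable \<nu> g" and e: "0 < e"
  then have "0 < e\<^sup>2 / 2" by simp
  then obtain T where T: "T \<in> TP" "close g T (e\<^sup>2 / 2)"
    using approximable_square_integrable[OF g] unfolding approximable_def by blast
  obtain E b where E: "finite E" "\<forall>e\<in>E. char e" "T = (\<lambda>x. \<Sum>e\<in>E. b e * e x)"
    using TP_span[OF T(1)] by blast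
  have "(\<integral>x. (cmod (g x - T x))\<^sup>2 \<partial>\<nu>) < e\<^sup>2" using T(2) e unfolding close_def
    by (smt (verit) field_sum_of_halves zero_less_power2)
  then have "sqrt (\<integral>x. (cmod (g x - T x))\<^sup>2 \<partial>\<nu>) < e"
    using e real_less_lsqrt real_sqrt_less_iff[of _ "e\<^sup>2"] by simp
  then show "\<exists>E a. finite E \<and> (\<forall>e\<in>E. eigenfunction \<nu> e) \<and>
      sqrt (\<integral>x. (cmod (g x - (\<Sum>e\<in>E. a e * e x)))\<^sup>2 \<partial>\<nu>) < e"
    using E char_eigenfunction by (intro exI[of _ E] exI[of _ b]) auto
qed

end

theorem (in word_rotation) pure_discrete: "pure_discrete_spectrum X"
proof -
  obtain \<mu> where \<mu>: "shift_invariant_prob X \<mu>" using ex_invariant by blast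
  interpret invariant_measure w f \<mu> by unfold_locales (rule \<mu>)
  show ?thesis
    unfolding pure_discrete_spectrum_def using \<mu> invariant_unique spanned by blast
qed

text \<open>Equal letters after \<open>t\<close> and \<open>t'\<close> show boundaries of level
  \<open>n\<close> at equal distances from both. Prefix counts up to such boundaries follow the
  frequencies with error \<open>bal * rate L ^ n\<close>, so their difference is an integer close to
  \<open>(t' - t) * freq c a\<close>.\<close>

lemma (in gapped) phase:
  assumes "0 < e"
  shows "\<exists>N. \<forall>t t'. (\<forall>x<N. W 0 (t + x) = W 0 (t' + x)) \<longrightarrow> rot_near (freq c) e t t'"
proof -
  have "0 < e / (2 * bal)" using assms bal_pos by simp
  then obtain n where "rate L ^ n < e / (2 * bal)"
    using real_arch_pow_inv[of "e / (2 * bal)" "rate L"] rate[OF L_pos] by auto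
  then have n: "2 * (bal * rate L ^ n) \<le> e" using bal_pos by (simp add: field_simps)
  define M where "M = nat (2 ^ L * H n One)"
  \<comment> \<open>\<open>g n\<close> lets the pattern start after \<open>t\<close>,
    \<open>V n (Suc n)\<close> makes the index of the boundary exceed \<open>n\<close> as
    \<open>pattern_before\<close> requires, and \<open>M\<close> bounds the block that is crossed to
    reach it.\<close>
  define N where "N = g n + V n (Suc n) + M"
  have "\<exists>d::int. \<bar>d - (real t' - real t) * freq c a\<bar> \<le> e"
    if eq: "\<And>x. x < N \<Longrightarrow> W 0 (t + x) = W 0 (t' + x)" for t t' a
  proof -
    obtain k where k: "V n k \<le> t + g n + V n (Suc n)" "t + g n + V n (Suc n) < V n (Suc k)"
      using ex_index .
    have nk: "n < Suc k"
    proof -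
      have "V n (Suc n) < V n (Suc k)" using k(2) by linarith
      then show ?thesis by (simp add: V_less_iff)
    qed
    note pat = pattern_before[OF nk]
    define p where "p = V n (Suc k) - g n - t"
    have Vk: "V n (Suc k) = t + p + g n" using k(2) by (simp add: p_def)
    have "V n (Suc k) \<le> t + g n + V n (Suc n) + M"
      using k(1) V_Suc'[of n k] H_ratio[of n "W n k" One] by (simp add: M_def nat_mono)
    then have pN: "p + g n \<le> N" by (simp add: p_def N_def)
    have "W 0 (t' + p + g m) = c m" if m: "m < n" for m
    proof -
      have "W 0 (t + (p + g m)) = c m" using pat m Vk by (simp add: add.assoc)
      then show ?thesis using eq[of "p + g m"] g_less[OF m] pN by (simp add: add.assoc)
    qed
    then obtain k' where k': "V n k' = t' + p + g n" using recognize[of n "t' + p"] by blast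
    define d :: int where "d = cnt (W 0) (V n k') a - cnt (W 0) (V n (Suc k)) a"
    have "real_of_int d = cnt (W 0) (V n k') a - cnt (W 0) (V n (Suc k)) a"
      by (simp add: d_def of_int_cnt)
    moreover have "real (V n k') - real (V n (Suc k)) = real t' - real t" using k' Vk by simp
    then have "freq c a * real (V n k') - freq c a * real (V n (Suc k)) = (real t' - real t) * freq c a"
      by (metis mult.commute right_diff_distrib)
    ultimately have "\<bar>d - (real t' - real t) * freq c a\<bar> \<le> 2 * (bal * rate L ^ n)"
      using balance_V[of n k' a] balance_V[of n "Suc k" a] by linarith
    then show ?thesis using n by (intro exI[of _ d]) linarith
  qed
  then show ?thesis unfolding rot_near_def by blast
qed

lemma AR_subst_inj: "AR_subst a = AR_subst b \<longleftrightarrow> a = b"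
  by (auto simp: AR_subst_def fun_eq_iff split: if_splits)

theorem corollary3p9:
  fixes \<sigma> :: "nat \<Rightarrow> substitution" and \<omega> :: word
  assumes "arnoux_rauzy_word \<sigma> \<omega>"
    and "recurrent_directive \<sigma>"
    and "linearly_recurrent \<omega>"
  shows "pure_discrete_spectrum (orbit_closure \<omega>)"
proof -
  have "\<forall>n. \<exists>a. \<sigma> n = AR_subst a" using assms(1) by (auto simp: arnoux_rauzy_word_def)
  then obtain c where c: "\<And>n. \<sigma> n = AR_subst (c n)" by metis
  obtain W where W: "W 0 = \<omega>" "\<And>n. W n = subst_word (\<sigma> n) (W (Suc n))"
    using assms(1) unfolding arnoux_rauzy_word_def limit_word_def by blast
  obtain C where C: "\<And>m t t'. 0 < m \<Longrightarrow>
      \<exists>x\<ge>t'. x + m \<le> t' + C * m \<and> (\<forall>y<m. \<omega> (x + y) = \<omega> (t + y))"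
    by (rule linearly_recurrent_windows[OF assms(3)]) (rule that)
  interpret lr_hierarchy c W C
  proof
    show "W n = subst_word (AR_subst (c n)) (W (Suc n))" for n using W(2)[of n] c by simp
    show "\<exists>m\<ge>n. c m = a" for n a
    proof -
      have "infinite {m. c m = a}" using assms(1) by (simp add: arnoux_rauzy_word_def c AR_subst_inj)
      then show ?thesis unfolding infinite_nat_iff_unbounded_le by auto
    qed
    show "\<exists>x\<ge>t'. x + m \<le> t' + C * m \<and> (\<forall>y<m. W 0 (x + y) = W 0 (t + y))" if "0 < m" for m t t'
      unfolding W(1) by (rule C[OF that])
  qed
  obtain L where "gapped c W L" using bounded_gaps by blast
  then interpret gapped c W L .
  interpret word_rotation "W 0" "freq c"
    by unfold_locales (rule phase, assumption, rule coincidence_density)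
  show ?thesis using pure_discrete unfolding W(1) .
qed

end
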